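(* Let $(\mathfrak g,s)$ be a semisimple, orthogonal, symmetric Lie algebra with Cartan-like decomposition $\mathfrak g=\mathfrak k\oplus\mathfrak p$ and associated pair $(G,K)$ with $K$ connected, and let $\mathfrak a\subseteq\mathfrak p$ be a maximal Abelian subspace. Let $\Omega$ be a measurable space and let $\rho:\Omega\to\mathfrak p$ be measurable. Then there exist measurable functions $U:\Omega\to K$ and $\lambda:\Omega\to\mathfrak a$ such that $\rho(\omega)=\mathrm{Ad}_{U(\omega)}(\lambda(\omega))$ for all $\omega\in\Omega$.
   Context: A symmetric Lie algebra $(\mathfrak g,s)$ is a real finite-dimensional Lie algebra $\mathfrak g$ with an involutive Lie algebra automorphism $s$; $\mathfrak k$ and $\mathfrak p$ denote the $+1$ and $-1$ eigenspaces of $s$, and $\mathfrak g=\mathfrak k\oplus\mathfrak p$ is the Cartan-like decomposition. It is semisimple if $\mathfrak g$ is, and orthogonal if the connected Lie subgroup $\mathrm{Int}_{\mathfrak k}(\mathfrak g)\subseteq \mathrm{GL}(\mathfrak g)$ with Lie algebra $\mathrm{ad}_{\mathfrak k}$ is compact. An associated pair $(G,K)$ consists of a connected Lie group $G$ with Lie algebra identified with $\mathfrak g$ and a Lie subgroup $K\subseteq G$ with Lie algebra $\mathfrak k$; $K$ acts on $\mathfrak p$ by the adjoint action. Topological spaces ($\mathfrak p$, $\mathfrak a$, $K$) are endowed with their Borel $\sigma$-algebras. *)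

theory Defs
  imports "HOL-Analysis.Analysis" "HOL-Algebra.Group"
begin

section \<open>Smooth manifolds\<close>

text \<open>
  A smooth manifold is given by a finite-dimensional model space (a linear subspace of a normed
  space, all norms on it being equivalent) and an atlas of charts \<open>(U, \<phi>)\<close>. Its points are the
  elements of the chart domains. Modelling on a subspace lets the dimension be any natural number,
  zero included, and lets it depend on other data of a statement.
\<close>

type_synonym ('p, 'e) chart = "'p set \<times> ('p \<Rightarrow> 'e)"

record ('p, 'e) manifold =
  model :: "'e set"
  atlas :: "('p, 'e) chart set"

definition finite_dim_subspace :: "'e::real_vector set \<Rightarrow> bool" where
  "finite_dim_subspace E \<longleftrightarrow> (\<exists>B. finite B \<and> span B = E)"

text \<open>
  \<open>Ck k E S f\<close>: the map \<open>f\<close> is of class \<open>C\<^sup>k\<close> on the relatively open subset \<open>S\<close> of the subspace \<open>E\<close>.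
  A derivative within \<open>E\<close> is determined only on \<open>E\<close>, hence the restriction to directions in \<open>E\<close>.
\<close>

primrec Ck :: "nat \<Rightarrow> 'e::real_normed_vector set \<Rightarrow> 'e set \<Rightarrow> ('e \<Rightarrow> 'f::real_normed_vector) \<Rightarrow> bool"
where
  "Ck 0 E S f \<longleftrightarrow> continuous_on S f"
| "Ck (Suc k) E S f \<longleftrightarrow>
     (\<exists>f'. (\<forall>x\<in>S. (f has_derivative f' x) (at x within E)) \<and>
           (\<forall>v\<in>E. Ck k E S (\<lambda>x. f' x v)))"

definition smooth_on :: "'e::real_normed_vector set \<Rightarrow> 'e set \<Rightarrow> ('e \<Rightarrow> 'f::real_normed_vector) \<Rightarrow> bool"
where
  "smooth_on E S f \<longleftrightarrow> (\<forall>k. Ck k E S f)"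

definition points :: "('p, 'e) manifold \<Rightarrow> 'p set" where
  "points M = (\<Union>(U, \<phi>)\<in>atlas M. U)"

definition manifold_topology :: "('p, 'e::real_normed_vector) manifold \<Rightarrow> 'p topology" where
  "manifold_topology M =
     topology_generated_by {U \<inter> \<phi> -` V | U \<phi> V. (U, \<phi>) \<in> atlas M \<and> open V}"

definition smooth_manifold :: "('p, 'e::real_normed_vector) manifold \<Rightarrow> bool" where
  "smooth_manifold M \<longleftrightarrow>
     finite_dim_subspace (model M) \<and>
     (\<forall>(U, \<phi>)\<in>atlas M. inj_on \<phi> U \<and> openin (top_of_set (model M)) (\<phi> ` U)) \<and>
     (\<forall>(U, \<phi>)\<in>atlas M. \<forall>(V, \<psi>)\<in>atlas M.
        openin (top_of_set (model M)) (\<phi> ` (U \<inter> V)) \<and>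
        smooth_on (model M) (\<phi> ` (U \<inter> V)) (\<psi> \<circ> inv_into U \<phi>)) \<and>
     Hausdorff_space (manifold_topology M) \<and>
     second_countable (manifold_topology M)"

definition prod_manifold ::
  "('p, 'e) manifold \<Rightarrow> ('q, 'f) manifold \<Rightarrow> ('p \<times> 'q, 'e \<times> 'f) manifold" where
  "prod_manifold M N =
     \<lparr>model = model M \<times> model N,
      atlas = {(U \<times> V, map_prod \<phi> \<psi>) | U \<phi> V \<psi>. (U, \<phi>) \<in> atlas M \<and> (V, \<psi>) \<in> atlas N}\<rparr>"

definition smooth_map ::
  "('p, 'e::real_normed_vector) manifold \<Rightarrow> ('q, 'f::real_normed_vector) manifold \<Rightarrow> ('p \<Rightarrow> 'q) \<Rightarrow> bool"
where
  "smooth_map M N f \<longleftrightarrow>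
     continuous_map (manifold_topology M) (manifold_topology N) f \<and>
     (\<forall>(U, \<phi>)\<in>atlas M. \<forall>(V, \<psi>)\<in>atlas N.
        smooth_on (model M) (\<phi> ` (U \<inter> f -` V)) (\<psi> \<circ> f \<circ> inv_into U \<phi>))"


subsection \<open>Tangent spaces\<close>

text \<open>
  A tangent vector at \<open>p\<close> is a family of coordinate vectors, one for each chart around \<open>p\<close>, related
  by the derivatives of the chart transitions. The value at all other charts is \<open>0\<close>, so that
  tangent vectors are determined by their coordinates, and the vector space operations on a tangent
  space are the pointwise ones.
\<close>

type_synonym ('p, 'e) tangent = "('p, 'e) chart \<Rightarrow> 'e"

definition tangent_space ::
  "('p, 'e::real_normed_vector) manifold \<Rightarrow> 'p \<Rightarrow> ('p, 'e) tangent set" where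
  "tangent_space M p =
     {v. (\<forall>c. if c \<in> atlas M \<and> p \<in> fst c then v c \<in> model M else v c = 0) \<and>
         (\<forall>(U, \<phi>)\<in>atlas M. \<forall>(V, \<psi>)\<in>atlas M. p \<in> U \<inter> V \<longrightarrow>
            v (V, \<psi>) =
              frechet_derivative (\<psi> \<circ> inv_into U \<phi>) (at (\<phi> p) within model M) (v (U, \<phi>)))}"

definition differential ::
  "('p, 'e::real_normed_vector) manifold \<Rightarrow> ('q, 'f::real_normed_vector) manifold \<Rightarrow>
   ('p \<Rightarrow> 'q) \<Rightarrow> 'p \<Rightarrow> ('p, 'e) tangent \<Rightarrow> ('q, 'f) tangent" where
  "differential M N f p v = (\<lambda>(V, \<psi>).
     if (V, \<psi>) \<in> atlas N \<and> f p \<in> V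
     then let (U, \<phi>) = (SOME c. c \<in> atlas M \<and> p \<in> fst c)
          in frechet_derivative (\<psi> \<circ> f \<circ> inv_into U \<phi>) (at (\<phi> p) within model M) (v (U, \<phi>))
     else 0)"

text \<open>
  The commutator of two vector fields at \<open>p\<close>, in coordinates \<open>DY(X) - DX(Y)\<close>. A vector field assigns
  to each point a tangent vector there.
\<close>

definition vector_field_bracket ::
  "('p, 'e::real_normed_vector) manifold \<Rightarrow> ('p \<Rightarrow> ('p, 'e) tangent) \<Rightarrow> ('p \<Rightarrow> ('p, 'e) tangent) \<Rightarrow>
   'p \<Rightarrow> ('p, 'e) tangent" where
  "vector_field_bracket M X Y p = (\<lambda>(U, \<phi>).
     if (U, \<phi>) \<in> atlas M \<and> p \<in> U
     then frechet_derivative (\<lambda>x. Y (inv_into U \<phi> x) (U, \<phi>)) (at (\<phi> p) within model M) (X p (U, \<phi>))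
        - frechet_derivative (\<lambda>x. X (inv_into U \<phi> x) (U, \<phi>)) (at (\<phi> p) within model M) (Y p (U, \<phi>))
     else 0)"


section \<open>Lie groups\<close>

record ('g, 'e) lie_group = "'g monoid" +
  mfd :: "('g, 'e) manifold"

abbreviation lie_topology :: "('g, 'e::real_normed_vector) lie_group \<Rightarrow> 'g topology" where
  "lie_topology G \<equiv> manifold_topology (mfd G)"

definition is_lie_group :: "('g, 'e::real_normed_vector) lie_group \<Rightarrow> bool" where
  "is_lie_group G \<longleftrightarrow>
     group G \<and>
     smooth_manifold (mfd G) \<and>
     points (mfd G) = carrier G \<and>
     smooth_map (prod_manifold (mfd G) (mfd G)) (mfd G) (\<lambda>(x, y). x \<otimes>\<^bsub>G\<^esub> y) \<and>
     smooth_map (mfd G) (mfd G) (\<lambda>x. inv\<^bsub>G\<^esub> x)"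

definition left_invariant_field ::
  "('g, 'e::real_normed_vector) lie_group \<Rightarrow> ('g, 'e) tangent \<Rightarrow> 'g \<Rightarrow> ('g, 'e) tangent" where
  "left_invariant_field G v g = differential (mfd G) (mfd G) (\<lambda>h. g \<otimes>\<^bsub>G\<^esub> h) \<one>\<^bsub>G\<^esub> v"

text \<open>The Lie bracket on the tangent space at the identity.\<close>

definition lie_group_bracket ::
  "('g, 'e::real_normed_vector) lie_group \<Rightarrow> ('g, 'e) tangent \<Rightarrow> ('g, 'e) tangent \<Rightarrow> ('g, 'e) tangent"
where
  "lie_group_bracket G v w =
     vector_field_bracket (mfd G) (left_invariant_field G v) (left_invariant_field G w) \<one>\<^bsub>G\<^esub>"

text \<open>
  Lie subgroups are immersed: \<open>K\<close> carries its own Lie group structure, whose topology may be finer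
  than the subspace topology. Embedded subgroups are the case in which the two agree.
\<close>

definition lie_subgroup ::
  "('g, 'f::real_normed_vector) lie_group \<Rightarrow> ('g, 'e::real_normed_vector) lie_group \<Rightarrow> bool" where
  "lie_subgroup K G \<longleftrightarrow>
     is_lie_group K \<and>
     subgroup (carrier K) G \<and>
     (\<forall>x\<in>carrier K. \<forall>y\<in>carrier K. x \<otimes>\<^bsub>K\<^esub> y = x \<otimes>\<^bsub>G\<^esub> y) \<and>
     smooth_map (mfd K) (mfd G) (\<lambda>x. x) \<and>
     (\<forall>x\<in>carrier K. inj_on (differential (mfd K) (mfd G) (\<lambda>x. x) x) (tangent_space (mfd K) x))"

text \<open>The Lie algebra of a Lie subgroup, as a subspace of the tangent space of \<open>G\<close> at the identity.\<close>

definition lie_algebra_of_subgroup ::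
  "('g, 'f::real_normed_vector) lie_group \<Rightarrow> ('g, 'e::real_normed_vector) lie_group \<Rightarrow>
   ('g, 'e) tangent set" where
  "lie_algebra_of_subgroup K G =
     differential (mfd K) (mfd G) (\<lambda>x. x) \<one>\<^bsub>K\<^esub> ` tangent_space (mfd K) \<one>\<^bsub>K\<^esub>"

text \<open>
  The general linear group of a finite-dimensional space: an open subset of the space of
  endomorphisms, with a single chart. \<open>GL_tangent\<close> identifies the endomorphisms with the tangent
  vectors at the identity.
\<close>

definition GL_carrier :: "('a::real_normed_vector \<Rightarrow>\<^sub>L 'a) set" where
  "GL_carrier = {f. \<exists>g. f o\<^sub>L g = id_blinfun \<and> g o\<^sub>L f = id_blinfun}"

definition GL :: "('a::real_normed_vector \<Rightarrow>\<^sub>L 'a, 'a \<Rightarrow>\<^sub>L 'a) lie_group" where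
  "GL = \<lparr>carrier = GL_carrier, mult = (o\<^sub>L), one = id_blinfun,
         mfd = \<lparr>model = UNIV, atlas = {(GL_carrier, \<lambda>f. f)}\<rparr>\<rparr>"

definition GL_tangent ::
  "('a::real_normed_vector \<Rightarrow>\<^sub>L 'a) \<Rightarrow> ('a \<Rightarrow>\<^sub>L 'a, 'a \<Rightarrow>\<^sub>L 'a) tangent" where
  "GL_tangent A = (\<lambda>c. if c = (GL_carrier, \<lambda>f. f) then A else 0)"


section \<open>Lie algebras\<close>

text \<open>
  Real finite-dimensional Lie algebras. The norm of the underlying type serves only to supply the
  canonical topology of a finite-dimensional space; dimension zero is allowed.
\<close>

definition lie_algebra :: "('a::real_normed_vector \<Rightarrow> 'a \<Rightarrow> 'a) \<Rightarrow> bool" where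
  "lie_algebra br \<longleftrightarrow>
     finite_dim_subspace (UNIV :: 'a set) \<and>
     bilinear br \<and>
     (\<forall>x. br x x = 0) \<and>
     (\<forall>x y z. br x (br y z) + br y (br z x) + br z (br x y) = 0)"

definition lie_ideal :: "('a::real_normed_vector \<Rightarrow> 'a \<Rightarrow> 'a) \<Rightarrow> 'a set \<Rightarrow> bool" where
  "lie_ideal br I \<longleftrightarrow> subspace I \<and> (\<forall>x. \<forall>y\<in>I. br x y \<in> I)"

primrec derived_series :: "('a::real_normed_vector \<Rightarrow> 'a \<Rightarrow> 'a) \<Rightarrow> 'a set \<Rightarrow> nat \<Rightarrow> 'a set" where
  "derived_series br I 0 = I"
| "derived_series br I (Suc n) =
     span {br x y | x y. x \<in> derived_series br I n \<and> y \<in> derived_series br I n}"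

definition solvable :: "('a::real_normed_vector \<Rightarrow> 'a \<Rightarrow> 'a) \<Rightarrow> 'a set \<Rightarrow> bool" where
  "solvable br I \<longleftrightarrow> (\<exists>n. derived_series br I n = {0})"

definition semisimple :: "('a::real_normed_vector \<Rightarrow> 'a \<Rightarrow> 'a) \<Rightarrow> bool" where
  "semisimple br \<longleftrightarrow> (\<forall>I. lie_ideal br I \<and> solvable br I \<longrightarrow> I = {0})"


subsection \<open>Symmetric Lie algebras\<close>

definition symmetric_lie_algebra ::
  "('a::real_normed_vector \<Rightarrow> 'a \<Rightarrow> 'a) \<Rightarrow> ('a \<Rightarrow> 'a) \<Rightarrow> bool" where
  "symmetric_lie_algebra br s \<longleftrightarrow>
     lie_algebra br \<and> linear s \<and> (\<forall>x y. s (br x y) = br (s x) (s y)) \<and> (\<forall>x. s (s x) = x)"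

definition k_part :: "('a::real_normed_vector \<Rightarrow> 'a) \<Rightarrow> 'a set" where
  "k_part s = {x. s x = x}"

definition p_part :: "('a::real_normed_vector \<Rightarrow> 'a) \<Rightarrow> 'a set" where
  "p_part s = {x. s x = - x}"

text \<open>
  The Lie group \<open>H\<close> below is \<open>Int\<^sub>k(g)\<close>: a connected Lie subgroup is determined by its Lie algebra.
  The type of its model space is large enough, as \<open>ad k\<close> is itself a subspace of it.
\<close>

definition orthogonal_symmetric ::
  "('a::real_normed_vector \<Rightarrow> 'a \<Rightarrow> 'a) \<Rightarrow> ('a \<Rightarrow> 'a) \<Rightarrow> bool" where
  "orthogonal_symmetric br s \<longleftrightarrow>
     (\<exists>H :: ('a \<Rightarrow>\<^sub>L 'a, 'a \<Rightarrow>\<^sub>L 'a) lie_group.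
        lie_subgroup H GL \<and>
        connected_space (lie_topology H) \<and>
        lie_algebra_of_subgroup H GL = (\<lambda>x. GL_tangent (Blinfun (br x))) ` k_part s \<and>
        compact_space (lie_topology H))"

text \<open>\<open>\<theta>\<close> identifies the Lie algebra with bracket \<open>br\<close> with the Lie algebra of \<open>G\<close>.\<close>

definition lie_algebra_identification ::
  "('a::real_normed_vector \<Rightarrow> 'a \<Rightarrow> 'a) \<Rightarrow> ('g, 'e::real_normed_vector) lie_group \<Rightarrow>
   ('a \<Rightarrow> ('g, 'e) tangent) \<Rightarrow> bool" where
  "lie_algebra_identification br G \<theta> \<longleftrightarrow>
     bij_betw \<theta> UNIV (tangent_space (mfd G) \<one>\<^bsub>G\<^esub>) \<and>
     (\<forall>x y c. \<theta> (x + y) c = \<theta> x c + \<theta> y c) \<and>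
     (\<forall>r x c. \<theta> (r *\<^sub>R x) c = r *\<^sub>R \<theta> x c) \<and>
     (\<forall>x y. \<theta> (br x y) = lie_group_bracket G (\<theta> x) (\<theta> y))"

definition associated_pair ::
  "('a::real_normed_vector \<Rightarrow> 'a \<Rightarrow> 'a) \<Rightarrow> ('a \<Rightarrow> 'a) \<Rightarrow> ('g, 'e::real_normed_vector) lie_group \<Rightarrow>
   ('a \<Rightarrow> ('g, 'e) tangent) \<Rightarrow> ('g, 'f::real_normed_vector) lie_group \<Rightarrow> bool" where
  "associated_pair br s G \<theta> K \<longleftrightarrow>
     is_lie_group G \<and>
     connected_space (lie_topology G) \<and>
     lie_algebra_identification br G \<theta> \<and>
     lie_subgroup K G \<and>
     lie_algebra_of_subgroup K G = \<theta> ` k_part s"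

text \<open>The adjoint action of \<open>G\<close>, transported to the Lie algebra along the identification \<open>\<theta>\<close>.\<close>

definition Ad ::
  "('g, 'e::real_normed_vector) lie_group \<Rightarrow> ('a \<Rightarrow> ('g, 'e) tangent) \<Rightarrow> 'g \<Rightarrow> 'a \<Rightarrow> 'a" where
  "Ad G \<theta> g x =
     inv_into UNIV \<theta> (differential (mfd G) (mfd G) (\<lambda>h. g \<otimes>\<^bsub>G\<^esub> h \<otimes>\<^bsub>G\<^esub> inv\<^bsub>G\<^esub> g) \<one>\<^bsub>G\<^esub> (\<theta> x))"

definition abelian_subspace ::
  "('a::real_normed_vector \<Rightarrow> 'a \<Rightarrow> 'a) \<Rightarrow> ('a \<Rightarrow> 'a) \<Rightarrow> 'a set \<Rightarrow> bool" where
  "abelian_subspace br s A \<longleftrightarrow> subspace A \<and> A \<subseteq> p_part s \<and> (\<forall>x\<in>A. \<forall>y\<in>A. br x y = 0)"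

definition maximal_abelian_subspace ::
  "('a::real_normed_vector \<Rightarrow> 'a \<Rightarrow> 'a) \<Rightarrow> ('a \<Rightarrow> 'a) \<Rightarrow> 'a set \<Rightarrow> bool" where
  "maximal_abelian_subspace br s A \<longleftrightarrow>
     abelian_subspace br s A \<and> (\<forall>B. abelian_subspace br s B \<and> A \<subseteq> B \<longrightarrow> B = A)"


section \<open>Borel spaces of abstract topologies\<close>

definition borel_of :: "'p topology \<Rightarrow> 'p measure" where
  "borel_of X = sigma (topspace X) {S. openin X S}"

end

theory Submission
  imports Defs
begin

text \<open>
  Let \<open>H\<close> be the compact group \<open>Int\<^sub>k(g)\<close>. Fix \<open>h\<close> in the maximal abelian subspace \<open>a\<close> whose
  centraliser in \<open>p\<close> is \<open>a\<close>, and let \<open>B(x, y) = tr(ad x ad y)\<close>. If \<open>g \<in> H\<close> minimises \<open>B(g x, h)\<close>, then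
  \<open>B(z, [g x, h]) = B([z, g x], h) = 0\<close> for all \<open>z \<in> k\<close>; as \<open>B\<close> is negative definite on \<open>k\<close> (operators
  \<open>ad z\<close> are skew for an \<open>H\<close>-invariant inner product and the centre of \<open>g\<close> is trivial), \<open>[g x, h] = 0\<close> and
  \<open>g x \<in> a\<close>.

  To replace \<open>g\<close> by an element of \<open>K\<close> one needs \<open>H \<subseteq> Ad(K)\<close>. No exponential map is required: an
  element of \<open>H\<close> near the identity is a product of \<open>n\<close> elements at distance \<open>O(1/n)\<close> from it. Replacing
  each factor by some \<open>Ad(k\<^sub>i)\<close> with the same first-order term changes the product by \<open>o(1)\<close>, while
  \<open>k\<^sub>1 \<cdots> k\<^sub>n\<close> stays in a compact part of a chart of \<open>K\<close>, so a limit point of these products is a preimage.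

  Finally \<open>{k \<in> K. Ad\<^sub>k (\<rho> \<omega>) \<in> a}\<close> is closed and nonempty, the set of \<open>\<omega>\<close> for which it meets a given compact
  set is measurable, and \<open>K\<close> is locally compact and second countable, so it has a measurable selector \<open>V\<close>; take
  \<open>U = V\<^sup>-\<^sup>1\<close> and \<open>\<lambda> = Ad\<^sub>V \<rho>\<close>.
\<close>

section \<open>Finite-dimensional normed spaces\<close>

text \<open>The groups are known only through immersions: \<open>H\<close> and \<open>K\<close>
  carry their own topologies, and what links \<open>H\<close> to \<open>Ad K\<close> is first-order
  information, namely that both have \<open>ad k\<close> as tangent space at the identity.
  Equalities in \<open>H\<close> are therefore proved by comparing first-order terms. If two
  operator-valued maps agree to first order at 0, products of n factors of size O(1/n) differ by n
  times o(1/n), provided that the partial products of one and the inverses of the other stay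
  bounded; compactness of \<open>H\<close> and a fixed ball in a chart of \<open>K\<close> ensure
  this. The same comparison, with conjugation by s in place of the lift, shows that \<open>H\<close>
  commutes with s and so preserves p. The invariant inner product is the minimiser of a strictly
  convex functional. The form B enters only through its invariance and its sign on k:
  \<open>[g x, h]\<close> is a bracket of elements of p, so it lies in k and may be taken for z. The
  element h exists because a spanning set of a can be merged, one vector at a time, into a single
  element with the same centraliser in p.\<close>

text \<open>Passing to a further subsequence keeps the limits already found, so the indices are
  treated one at a time.\<close>

lemma finite_family_subseq:
  fixes u :: "nat \<Rightarrow> 'i \<Rightarrow> real"
  assumes "finite I" "\<And>i. i \<in> I \<Longrightarrow> \<exists>C. \<forall>n. \<bar>u n i\<bar> \<le> C"
  shows "\<exists>r l. strict_mono (r::nat\<Rightarrow>nat) \<and> (\<forall>i\<in>I. (\<lambda>n. u (r n) i) \<longlonglongrightarrow> l i)"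
  using assms
proof (induction I rule: finite_induct)
  case empty
  show ?case by (intro exI[of _ id]) (auto simp: strict_mono_def)
next
  case (insert j I)
  then obtain r l where r: "strict_mono (r::nat\<Rightarrow>nat)" "\<forall>i\<in>I. (\<lambda>n. u (r n) i) \<longlonglongrightarrow> l i" by auto
  obtain C where "\<forall>n. \<bar>u n j\<bar> \<le> C" using insert.prems by blast
  then have "bounded (range (\<lambda>n. u (r n) j))"
    unfolding bounded_iff by auto
  then obtain c q where q: "strict_mono (q::nat\<Rightarrow>nat)" "((\<lambda>n. u (r n) j) \<circ> q) \<longlonglongrightarrow> c"
    using bounded_imp_convergent_subsequence by blast
  have "(\<lambda>n. u (r (q n)) i) \<longlonglongrightarrow> (l(j := c)) i" if "i \<in> insert j I" for i
  proof (cases "i = j")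
    case True then show ?thesis using q(2) by (simp add: o_def)
  next
    case False
    then have "(\<lambda>n. u (r n) i) \<longlonglongrightarrow> l i" using that r by auto
    from LIMSEQ_subseq_LIMSEQ[OF this q(1)] show ?thesis using False by (simp add: o_def)
  qed
  then show ?case using strict_mono_o[OF r(1) q(1)]
    by (intro exI[of _ "r \<circ> q"] exI[of _ "l(j := c)"]) (auto simp: o_def)
qed

text \<open>Otherwise there are normalised coefficients whose combinations tend to 0, and a limit
  point of them is a nontrivial vanishing combination.\<close>

lemma independent_lower_bound:
  fixes B :: "'e::real_normed_vector set"
  assumes B: "finite B" "independent B"
  shows "\<exists>c>0. \<forall>u. c * (\<Sum>b\<in>B. \<bar>u b\<bar>) \<le> norm (\<Sum>b\<in>B. u b *\<^sub>R b)"
proof (rule ccontr)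
  assume "\<not> ?thesis"
  then have "\<forall>n. \<exists>u. norm (\<Sum>b\<in>B. u b *\<^sub>R b) < (1 / real (Suc n)) * (\<Sum>b\<in>B. \<bar>u b\<bar>)"
    by (metis not_le of_nat_0_less_iff zero_less_Suc zero_less_divide_1_iff)
  then obtain u where u: "\<And>n. norm (\<Sum>b\<in>B. u n b *\<^sub>R b) < (1 / real (Suc n)) * (\<Sum>b\<in>B. \<bar>u n b\<bar>)"
    by metis
  define S where "S n = (\<Sum>b\<in>B. \<bar>u n b\<bar>)" for n
  have S: "S n > 0" for n
  proof (rule ccontr)
    assume "\<not> S n > 0"
    then have "(1 / real (Suc n)) * S n \<le> 0" by (intro mult_nonneg_nonpos) auto
    then show False using u[of n] norm_ge_zero[of "\<Sum>b\<in>B. u n b *\<^sub>R b"] unfolding S_def by linarith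
  qed
  \<comment> \<open>After division by \<open>S n\<close> the l1 norm is 1, which survives in the
    limit and forbids \<open>l = 0\<close>.\<close>
  define v where "v n b = u n b / S n" for n b
  have v1: "(\<Sum>b\<in>B. \<bar>v n b\<bar>) = 1" for n
    using S[of n] by (simp add: v_def abs_divide flip: sum_divide_distrib S_def)
  have v2: "norm (\<Sum>b\<in>B. v n b *\<^sub>R b) < 1 / real (Suc n)" for n
  proof -
    have "(\<Sum>b\<in>B. v n b *\<^sub>R b) = (1 / S n) *\<^sub>R (\<Sum>b\<in>B. u n b *\<^sub>R b)"
      by (simp add: v_def scaleR_sum_right)
    then show ?thesis using u[of n] S[of n] by (simp add: S_def field_simps)
  qed
  have "\<exists>C. \<forall>n. \<bar>v n b\<bar> \<le> C" if "b \<in> B" for b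
    using v1 member_le_sum[OF that, of "\<lambda>b. \<bar>v n b\<bar>" for n] B(1) by (metis abs_ge_zero)
  from finite_family_subseq[of B v, OF B(1) this] obtain r l where r: "strict_mono (r::nat\<Rightarrow>nat)"
    and l: "\<forall>b\<in>B. (\<lambda>n. v (r n) b) \<longlonglongrightarrow> l b" by blast
  have "(\<lambda>n. \<Sum>b\<in>B. \<bar>v (r n) b\<bar>) \<longlonglongrightarrow> (\<Sum>b\<in>B. \<bar>l b\<bar>)" using l by (intro tendsto_intros) auto
  then have l1: "(\<Sum>b\<in>B. \<bar>l b\<bar>) = 1" using v1 by (simp add: LIMSEQ_const_iff)
  have "(\<lambda>n. norm (\<Sum>b\<in>B. v (r n) b *\<^sub>R b)) \<longlonglongrightarrow> norm (\<Sum>b\<in>B. l b *\<^sub>R b)"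
    using l by (intro tendsto_intros) auto
  moreover have "(\<lambda>n. norm (\<Sum>b\<in>B. v (r n) b *\<^sub>R b)) \<longlonglongrightarrow> 0"
  proof (rule tendsto_sandwich[OF _ _ tendsto_const])
    have "((\<lambda>n. 1 / real (Suc n)) \<circ> r) \<longlonglongrightarrow> 0"
      using LIMSEQ_subseq_LIMSEQ[OF _ r] LIMSEQ_inverse_real_of_nat by (auto simp: inverse_eq_divide)
    then show "(\<lambda>n. 1 / real (Suc (r n))) \<longlonglongrightarrow> 0" by (simp add: o_def)
    show "\<forall>\<^sub>F n in sequentially. norm (\<Sum>b\<in>B. v (r n) b *\<^sub>R b) \<le> 1 / real (Suc (r n))"
      using v2 less_imp_le by (intro always_eventually allI) blast
  qed auto
  ultimately have "norm (\<Sum>b\<in>B. l b *\<^sub>R b) = 0" by (rule LIMSEQ_unique)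
  then have "(\<Sum>b\<in>B. l b *\<^sub>R b) = 0" by simp
  then have "\<forall>b\<in>B. l b = 0" using B independentD by blast
  then show False using l1 by simp
qed

lemma finite_dim_basis:
  fixes E :: "'e::real_vector set"
  assumes "finite_dim_subspace E"
  obtains B where "finite B" "independent B" "span B = E"
proof -
  from assms obtain T where T: "finite T" "span T = E" by (auto simp: finite_dim_subspace_def)
  obtain B where B: "B \<subseteq> T" "independent B" "T \<subseteq> span B" using maximal_independent_subset by blast
  have "span B = E" using B T by (metis span_eq span_superset subset_trans)
  with B T that show thesis using finite_subset by blast
qed

lemma finite_dim_subspaceD: "finite_dim_subspace E \<Longrightarrow> subspace E"
  by (auto simp: finite_dim_subspace_def)

text \<open>The spaces of interest are subspaces of arbitrary normed types, so coordinates come with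
  a subspace \<open>E\<close> and not from a type class. Their boundedness turns statements about
  finitely many basis vectors into uniform ones.\<close>

locale coordinate_basis =
  fixes E B :: "'e::real_normed_vector set" and C :: real and r :: "'e \<Rightarrow> 'e \<Rightarrow> real"
  assumes finite_B: "finite B"
    and independent_B: "independent B"
    and span_B: "span B = E"
    and C_pos: "C > 0"
    and expand: "x \<in> E \<Longrightarrow> (\<Sum>b\<in>B. r b x *\<^sub>R b) = x"
    and coord_le: "x \<in> E \<Longrightarrow> b \<in> B \<Longrightarrow> \<bar>r b x\<bar> \<le> C * norm x"
    and coord_add: "x \<in> E \<Longrightarrow> y \<in> E \<Longrightarrow> r b (x + y) = r b x + r b y"
    and coord_scale: "x \<in> E \<Longrightarrow> r b (a *\<^sub>R x) = a * r b x"
begin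

lemma B_subset: "b \<in> B \<Longrightarrow> b \<in> E"
  using span_B span_base by blast

end

lemma finite_dim_coords:
  fixes E :: "'e::real_normed_vector set"
  assumes "finite_dim_subspace E"
  obtains B C r where "coordinate_basis E B C r"
proof -
  from finite_dim_basis[OF assms] obtain B where B: "finite B" "independent B" "span B = E" by blast
  from independent_lower_bound[OF B(1,2)] obtain c where c: "c > 0"
    "\<And>u. c * (\<Sum>b\<in>B. \<bar>u b\<bar>) \<le> norm (\<Sum>b\<in>B. u b *\<^sub>R b)" by blast
  define r where "r b x = (if x \<in> E then representation B x b else 0)" for b x
  have sm: "(\<Sum>b\<in>B. r b x *\<^sub>R b) = x" if "x \<in> E" for x
    using that B by (simp add: r_def sum_representation_eq)
  show thesis
  \<comment> \<open>A single coordinate is at most the l1 norm of all, hence the reciprocal of the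
    lower bound.\<close>
  proof (rule that[of B "1/c" r], unfold_locales)
    show "\<bar>r b x\<bar> \<le> 1/c * norm x" if "x \<in> E" "b \<in> B" for x b
    proof -
      have "c * \<bar>r b x\<bar> \<le> c * (\<Sum>b\<in>B. \<bar>r b x\<bar>)"
        using c(1) B that by (intro mult_left_mono member_le_sum) auto
      also have "\<dots> \<le> norm x" using c(2)[of "\<lambda>b. r b x"] sm[OF that(1)] by simp
      finally show ?thesis using c(1) by (simp add: field_simps)
    qed
    have sE: "subspace E" using assms finite_dim_subspaceD by blast
    show "r b (x + y) = r b x + r b y" if "x \<in> E" "y \<in> E" for x y b
      using that B sE by (simp add: r_def representation_add subspace_add)
    show "r b (a *\<^sub>R x) = a * r b x" if "x \<in> E" for x a b
      using that B sE by (simp add: r_def representation_scale subspace_scale)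
  qed (use B c sm in auto)
qed

text \<open>\<open>f\<close> may be linear only on \<open>E\<close>, as maps built from coordinates
  are; so additivity and homogeneity on \<open>E\<close> are the premises.\<close>

lemma finite_dim_linear_bound:
  fixes f :: "'e::real_normed_vector \<Rightarrow> 'f::real_normed_vector"
  assumes E: "finite_dim_subspace E"
    and f: "\<And>x y. x \<in> E \<Longrightarrow> y \<in> E \<Longrightarrow> f (x + y) = f x + f y"
      "\<And>x a. x \<in> E \<Longrightarrow> f (a *\<^sub>R x) = a *\<^sub>R f x"
  shows "\<exists>C>0. \<forall>x\<in>E. norm (f x) \<le> C * norm x"
proof -
  obtain B C r where cb: "coordinate_basis E B C r" using finite_dim_coords[OF E] .
  interpret coordinate_basis E B C r by fact
  note B = finite_B independent_B span_B C_pos expand coord_le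
  have sE: "subspace E" using E finite_dim_subspaceD by blast
  have f0: "f 0 = 0" using f(2)[of 0 0] sE subspace_0 by auto
  have fs: "f (\<Sum>b\<in>A. c b *\<^sub>R b) = (\<Sum>b\<in>A. c b *\<^sub>R f b)" if "A \<subseteq> B" for A c
    using finite_subset[OF that B(1)] that
  proof (induction A rule: finite_induct)
    case (insert a A)
    have "a \<in> E" using insert B span_base by blast
    moreover have "(\<Sum>b\<in>A. c b *\<^sub>R b) \<in> E"
      using insert B sE by (intro subspace_sum subspace_scale) (auto intro: span_base)
    ultimately show ?case using insert f sE by (simp add: subspace_scale)
  qed (simp add: f0)
  \<comment> \<open>The summand 1 keeps the constant positive when all \<open>f b\<close>
    vanish.\<close>
  have "norm (f x) \<le> (C * (\<Sum>b\<in>B. norm (f b)) + 1) * norm x" if x: "x \<in> E" for x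
  proof -
    have "norm (f x) = norm (\<Sum>b\<in>B. r b x *\<^sub>R f b)" using fs[of B "\<lambda>b. r b x"] B(5)[OF x] by simp
    also have "\<dots> \<le> (\<Sum>b\<in>B. \<bar>r b x\<bar> * norm (f b))" by (rule order_trans[OF norm_sum]) simp
    also have "\<dots> \<le> (\<Sum>b\<in>B. (C * norm x) * norm (f b))"
      using B x by (intro sum_mono mult_right_mono) auto
    also have "\<dots> = C * (\<Sum>b\<in>B. norm (f b)) * norm x" by (simp add: sum_distrib_left sum_distrib_right mult_ac)
    finally show ?thesis unfolding distrib_right using norm_ge_zero[of x] by linarith
  qed
  moreover have "C * (\<Sum>b\<in>B. norm (f b)) + 1 > 0" using B(4)
    by (intro add_nonneg_pos mult_nonneg_nonneg sum_nonneg) auto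
  ultimately show ?thesis by blast
qed

lemma finite_dim_convergent_subsequence:
  fixes x :: "nat \<Rightarrow> 'e::real_normed_vector"
  assumes E: "finite_dim_subspace E" and x: "\<And>n. x n \<in> E" "\<And>n. norm (x n) \<le> M"
  obtains r l where "strict_mono (r::nat\<Rightarrow>nat)" "l \<in> E" "(\<lambda>n. x (r n)) \<longlonglongrightarrow> l"
proof -
  obtain B C r where cb: "coordinate_basis E B C r" using finite_dim_coords[OF E] .
  interpret coordinate_basis E B C r by fact
  note B = finite_B independent_B span_B C_pos expand coord_le
  have "\<exists>K. \<forall>n. \<bar>r b (x n)\<bar> \<le> K" if "b \<in> B" for b
  proof (intro exI allI)
    fix n show "\<bar>r b (x n)\<bar> \<le> C * M"
      using coord_le[OF x(1) that, of n] mult_left_mono[OF x(2)[of n], of C] C_pos by linarith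
  qed
  from finite_family_subseq[of B "\<lambda>n b. r b (x n)", OF B(1) this] obtain q l
    where q: "strict_mono (q::nat\<Rightarrow>nat)" "\<forall>b\<in>B. (\<lambda>n. r b (x (q n))) \<longlonglongrightarrow> l b" by blast
  have "(\<lambda>n. \<Sum>b\<in>B. r b (x (q n)) *\<^sub>R b) \<longlonglongrightarrow> (\<Sum>b\<in>B. l b *\<^sub>R b)"
    using q by (intro tendsto_intros) auto
  then have "(\<lambda>n. x (q n)) \<longlonglongrightarrow> (\<Sum>b\<in>B. l b *\<^sub>R b)" using B(5) x(1) by simp
  moreover have "(\<Sum>b\<in>B. l b *\<^sub>R b) \<in> E"
    unfolding span_B[symmetric] by (intro span_sum span_scale span_base)
  ultimately show thesis using that q by blast
qed

text \<open>A convergent sequence is bounded, so a subsequence converges to a point of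
  \<open>E\<close>; limits are unique.\<close>

lemma finite_dim_closed:
  fixes E :: "'e::real_normed_vector set"
  assumes E: "finite_dim_subspace E"
  shows "closed E"
  unfolding closed_sequential_limits
proof (intro allI impI, elim conjE)
  fix x l assume x: "\<forall>n. x n \<in> E" "x \<longlonglongrightarrow> l"
  obtain M where M: "\<And>n. norm (x n) \<le> M"
    using convergent_imp_bounded[OF x(2)] unfolding bounded_iff by auto
  have xE: "\<And>n. x n \<in> E" using x(1) by blast
  obtain r k where r: "strict_mono (r::nat\<Rightarrow>nat)" "k \<in> E" "(\<lambda>n. x (r n)) \<longlonglongrightarrow> k"
    using finite_dim_convergent_subsequence[OF E xE M] .
  have "(\<lambda>n. x (r n)) \<longlonglongrightarrow> l" using LIMSEQ_subseq_LIMSEQ[OF x(2) r(1)] by (simp add: o_def)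
  then show "l \<in> E" using r LIMSEQ_unique by blast
qed

lemma finite_dim_compact:
  fixes E :: "'e::real_normed_vector set"
  assumes E: "finite_dim_subspace E" and S: "S \<subseteq> E" "bounded S" "closed S"
  shows "compact S"
  unfolding compact_def
proof (intro allI impI)
  fix x :: "nat \<Rightarrow> 'e" assume x: "\<forall>n. x n \<in> S"
  obtain M where M: "\<And>n. norm (x n) \<le> M" using S(2) x unfolding bounded_iff by blast
  have xE: "\<And>n. x n \<in> E" using x S(1) by blast
  obtain r k where r: "strict_mono (r::nat\<Rightarrow>nat)" "k \<in> E" "(\<lambda>n. x (r n)) \<longlonglongrightarrow> k"
    using finite_dim_convergent_subsequence[OF E xE M] .
  have "k \<in> S" using closed_sequentially[OF S(3) _ r(3)] x by blast
  then show "\<exists>l\<in>S. \<exists>r. strict_mono r \<and> (x \<circ> r) \<longlonglongrightarrow> l" using r by (auto simp: o_def)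
qed

lemma finite_dim_compact_sphere:
  fixes E :: "'e::real_normed_vector set"
  assumes E: "finite_dim_subspace E"
  shows "compact (E \<inter> sphere 0 1)"
proof -
  have "sphere (0::'e) 1 = {x. norm x = 1}" by auto
  then have "closed (sphere (0::'e) 1)" by (simp add: closed_Collect_eq continuous_on_norm_id)
  then have "closed (E \<inter> sphere 0 1)" using finite_dim_closed[OF E] by (intro closed_Int)
  moreover have "bounded (E \<inter> sphere 0 1)" by (rule boundedI[of _ 1]) auto
  ultimately show ?thesis by (intro finite_dim_compact[OF E]) auto
qed

text \<open>The norm of \<open>f\<close> has a positive minimum on the compact unit sphere of
  \<open>E\<close>.\<close>

lemma finite_dim_injective_lower_bound:
  fixes f :: "'e::real_normed_vector \<Rightarrow> 'f::real_normed_vector"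
  assumes E: "finite_dim_subspace E"
    and f: "\<And>x y. x \<in> E \<Longrightarrow> y \<in> E \<Longrightarrow> f (x + y) = f x + f y"
      "\<And>x a. x \<in> E \<Longrightarrow> f (a *\<^sub>R x) = a *\<^sub>R f x"
    and inj: "\<And>x. x \<in> E \<Longrightarrow> f x = 0 \<Longrightarrow> x = 0"
  shows "\<exists>c>0. \<forall>x\<in>E. c * norm x \<le> norm (f x)"
proof -
  have sE: "subspace E" using E finite_dim_subspaceD by blast
  obtain C where C: "C > 0" "\<And>x. x \<in> E \<Longrightarrow> norm (f x) \<le> C * norm x"
    using finite_dim_linear_bound[OF E, of f] f by blast
  have fd: "f x - f y = f (x - y)" if "x \<in> E" "y \<in> E" for x y
    using f(1)[of "x - y" y] that sE by (simp add: subspace_diff)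
  let ?S = "E \<inter> sphere 0 1"
  note cS = finite_dim_compact_sphere[OF E]
  have cont: "continuous_on ?S (\<lambda>x. norm (f x))"
  proof (intro continuous_intros lipschitz_on_continuous_on[of C])
    show "C-lipschitz_on ?S f"
      using C fd sE by (intro lipschitz_onI) (auto simp: dist_norm subspace_diff)
  qed
  show ?thesis
  proof (cases "?S = {}")
    \<comment> \<open>An empty sphere means that \<open>E\<close> is zero, where any constant
      works.\<close>
    case True
    have "x = 0" if "x \<in> E" for x
    proof (rule ccontr)
      assume "x \<noteq> 0"
      then have "(1 / norm x) *\<^sub>R x \<in> ?S" using that sE by (auto simp: subspace_scale)
      then show False using True by blast
    qed
    then have "\<forall>x\<in>E. 1 * norm x \<le> norm (f x)" by (metis mult_1 norm_ge_zero norm_zero)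
    then show ?thesis by (intro exI[of _ 1]) auto
  next
    case False
    from continuous_attains_inf[OF cS False cont] obtain a where a: "a \<in> ?S"
      "\<And>y. y \<in> ?S \<Longrightarrow> norm (f a) \<le> norm (f y)" by blast
    have "norm (f a) * norm x \<le> norm (f x)" if x: "x \<in> E" for x
    proof (cases "x = 0")
      case False
      then have "norm (f a) \<le> norm (f ((1 / norm x) *\<^sub>R x))" using x sE by (intro a(2)) (auto simp: subspace_scale)
      then show ?thesis using False x f by (simp add: field_simps)
    qed simp
    moreover have "norm (f a) > 0" using a(1) inj[of a] by force
    ultimately show ?thesis by blast
  qed
qed

lemma finite_dim_linear_bounded:
  fixes f :: "'a::real_normed_vector \<Rightarrow> 'f::real_normed_vector"
  assumes E: "finite_dim_subspace (UNIV :: 'a set)" and f: "linear f"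
  shows "bounded_linear f"
proof -
  obtain C where "\<forall>x. norm (f x) \<le> C * norm x"
    using finite_dim_linear_bound[OF E, of f] linear_add[OF f] linear_scale[OF f] by auto
  then show ?thesis using f by (intro bounded_linear_intro[of f C]) (auto simp: linear_add linear_scale mult.commute)
qed

text \<open>Only the first argument is expanded in a basis; for each basis vector,
  \<open>h b\<close> is a bounded linear map with its own constant \<open>D b\<close>.\<close>

lemma finite_dim_bilinear_bounded:
  fixes h :: "'a::real_normed_vector \<Rightarrow> 'a \<Rightarrow> 'f::real_normed_vector"
  assumes E: "finite_dim_subspace (UNIV :: 'a set)" and h: "bilinear h"
  shows "bounded_bilinear h"
proof -
  obtain B C r where cb: "coordinate_basis (UNIV :: 'a set) B C r" using finite_dim_coords[OF E] .
  interpret coordinate_basis "UNIV :: 'a set" B C r by fact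
  note B = finite_B independent_B C_pos expand[OF UNIV_I] coord_le[OF UNIV_I]
  have "\<exists>D. \<forall>y. norm (h b y) \<le> D * norm y" for b
    using finite_dim_linear_bounded[OF E, of "h b"] h bounded_linear.bounded[of "h b"]
    by (auto simp: bilinear_def mult.commute)
  then obtain D where D: "\<And>b y. norm (h b y) \<le> D b * norm y" by metis
  have "norm (h x y) \<le> norm x * norm y * (\<Sum>b\<in>B. C * \<bar>D b\<bar>)" for x y
  proof -
    have "linear (\<lambda>x. h x y)" using h by (auto simp: bilinear_def)
    then have "h (\<Sum>b\<in>B. r b x *\<^sub>R b) y = (\<Sum>b\<in>B. r b x *\<^sub>R h b y)"
      by (simp add: linear_sum[of "\<lambda>x. h x y"] linear_scale[of "\<lambda>x. h x y"])
    then have "norm (h x y) \<le> (\<Sum>b\<in>B. \<bar>r b x\<bar> * norm (h b y))"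
      using B(4)[of x] by (metis (no_types, lifting) norm_scaleR norm_sum sum.cong)
    also have "\<dots> \<le> (\<Sum>b\<in>B. (C * norm x) * (\<bar>D b\<bar> * norm y))"
      using B(3,5) D by (intro sum_mono mult_mono) (auto intro!: order_trans[OF D] mult_right_mono)
    finally show ?thesis by (simp add: sum_distrib_left sum_distrib_right mult_ac)
  qed
  then show ?thesis using h
    by (unfold_locales) (auto simp: bilinear_ladd bilinear_radd bilinear_lmul bilinear_rmul)
qed

lemma finite_dim_subspace_mono:
  assumes "finite_dim_subspace E" "subspace F" "F \<subseteq> E"
  shows "finite_dim_subspace F"
proof -
  from assms(1) obtain T where T: "finite T" "span T = E" by (auto simp: finite_dim_subspace_def)
  obtain B where B: "B \<subseteq> F" "independent B" "F \<subseteq> span B" using maximal_independent_subset by blast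
  have "finite B" using independent_span_bound[OF T(1) B(2)] B(1) assms(3) T by auto
  moreover have "span B = F" using B assms(2) by (simp add: span_minimal subset_antisym)
  ultimately show ?thesis by (auto simp: finite_dim_subspace_def)
qed

lemma finite_dim_subspace_Times:
  fixes E :: "'e::real_vector set" and F :: "'f::real_vector set"
  assumes "finite_dim_subspace E" "finite_dim_subspace F"
  shows "finite_dim_subspace (E \<times> F)"
proof -
  obtain A B where A: "finite A" "span A = E" and B: "finite B" "span B = F"
    using assms by (auto simp: finite_dim_subspace_def)
  have l1: "linear (\<lambda>x::'e. (x, 0::'f))" and l2: "linear (\<lambda>y::'f. (0::'e, y))" by (auto intro!: linearI)
  have "span ((\<lambda>x. (x, 0::'f)) ` A \<union> (\<lambda>y. (0::'e, y)) ` B) = E \<times> F"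
    unfolding span_Un linear_span_image[OF l1] linear_span_image[OF l2] A B by (force simp: image_iff)
  then show ?thesis using A B by (auto simp: finite_dim_subspace_def intro!: exI[of _ "(\<lambda>x. (x, 0)) ` A \<union> (\<lambda>y. (0, y)) ` B"])
qed

section \<open>Derivatives within a subspace\<close>

text \<open>The decomposition of z is a premise, so that an identity between error terms can be
  combined with their bounds by resolution.\<close>

lemma norm_diff_le_add:
  fixes x y z :: "'a::real_normed_vector"
  shows "z = x - y \<Longrightarrow> norm x \<le> a \<Longrightarrow> norm y \<le> b \<Longrightarrow> norm z \<le> a + b"
  using norm_triangle_ineq4[of x y] by simp

lemma norm_add_le_add:
  fixes x y z :: "'a::real_normed_vector"
  shows "z = x + y \<Longrightarrow> norm x \<le> a \<Longrightarrow> norm y \<le> b \<Longrightarrow> norm z \<le> a + b"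
  using norm_triangle_ineq[of x y] by simp

text \<open>Restriction to the line through x in direction v reduces this to uniqueness in one real
  variable.\<close>

lemma has_derivative_within_subspace_unique:
  assumes E: "subspace E" "x \<in> E" "v \<in> E"
    and f: "(f has_derivative f') (at x within E)" "(f has_derivative f'') (at x within E)"
  shows "f' v = f'' v"
proof -
  have g: "((\<lambda>t. x + t *\<^sub>R v) has_derivative (\<lambda>t. t *\<^sub>R v)) (at 0)"
    by (auto intro!: derivative_eq_intros)
  have sub: "range (\<lambda>t. x + t *\<^sub>R v) \<subseteq> E" using E by (auto simp: subspace_add subspace_scale)
  have *: "((\<lambda>t. f (x + t *\<^sub>R v)) has_derivative (\<lambda>t. h (t *\<^sub>R v))) (at 0)"
    if "(f has_derivative h) (at x within E)" for h
    using has_derivative_in_compose[OF g, of f h] has_derivative_subset[OF that sub] by simp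
  from has_derivative_unique[OF *[OF f(1)] *[OF f(2)]] show ?thesis by (metis scaleR_one)
qed

lemma frechet_derivative_within_subspace:
  assumes "subspace E" "x \<in> E" "v \<in> E" "(f has_derivative f') (at x within E)"
  shows "frechet_derivative f (at x within E) v = f' v"
proof -
  have "f differentiable (at x within E)" using assms(4) by (auto simp: differentiable_def)
  then show ?thesis
    using has_derivative_within_subspace_unique[OF assms(1-3)] assms(4) frechet_derivative_works by blast
qed

text \<open>Difference quotients along v lie in \<open>F\<close>, and \<open>F\<close> is closed.
  This keeps coordinate derivatives inside the model space of the target.\<close>

lemma has_derivative_within_range:
  assumes E: "subspace E" "x \<in> E" "v \<in> E" and f: "(f has_derivative f') (at x within E)"
    and F: "subspace F" "closed F"
    and d: "d > 0" "\<And>y. y \<in> E \<Longrightarrow> dist y x < d \<Longrightarrow> f y \<in> F"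
  shows "f' v \<in> F"
proof -
  interpret f': bounded_linear f' using f has_derivative_bounded_linear by blast
  have "\<exists>y\<in>F. dist y (f' v) < e" if e: "e > 0" for e
  proof (cases "v = 0")
    case True then show ?thesis using F e by (auto intro!: bexI[of _ 0] simp: subspace_0 f'.zero)
  next
    case False
    then have nv: "norm v > 0" by simp
    obtain d' where d': "d' > 0" "\<And>y. y \<in> E \<Longrightarrow> norm (y - x) < d' \<Longrightarrow>
        norm (f y - f x - f' (y - x)) \<le> e / (2 * norm v) * norm (y - x)"
      using f e nv unfolding has_derivative_within_alt by (metis divide_pos_pos mult_pos_pos zero_less_numeral)
    \<comment> \<open>Half the admissible radius along v, so that both the range condition and the
      derivative estimate apply.\<close>
    define t where "t = min d d' / (2 * norm v)"
    have t: "t > 0" using d d' nv by (simp add: t_def)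
    have "norm (t *\<^sub>R v) = min d d' / 2" using nv t d d' by (simp add: t_def)
    then have tv: "norm (t *\<^sub>R v) < min d d'" using d d' by linarith
    have xE: "x + t *\<^sub>R v \<in> E" using E by (simp add: subspace_add subspace_scale)
    let ?y = "(1/t) *\<^sub>R (f (x + t *\<^sub>R v) - f x)"
    have "?y \<in> F" using d(2)[OF xE] d(2)[OF E(2)] d(1) tv F
      by (intro subspace_scale subspace_diff) (auto simp: dist_norm)
    moreover have "norm (f (x + t *\<^sub>R v) - f x - t *\<^sub>R f' v) \<le> t * (e / 2)"
      using d'(2)[OF xE] tv nv t by (simp add: f'.scale mult.commute)
    moreover have "?y - f' v = (1/t) *\<^sub>R (f (x + t *\<^sub>R v) - f x - t *\<^sub>R f' v)"
      using t by (simp add: scaleR_right_diff_distrib)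
    ultimately have "norm (?y - f' v) \<le> (1/t) * (t * (e/2))" using t mult_left_mono[of _ "t * (e/2)" "1/t"] by simp
    then have "dist ?y (f' v) < e" using t e by (simp add: dist_norm)
    then show ?thesis using \<open>?y \<in> F\<close> by blast
  qed
  then have "f' v \<in> closure F" unfolding closure_approachable by blast
  then show ?thesis using F(2) by simp
qed

text \<open>As a function of the step in direction a, the mixed second difference has as derivative
  the change of \<open>f' x a\<close> under the shift by t b. Differentiability of
  \<open>\<lambda>x. f' x a\<close> at p estimates that change, and the mean value inequality
  integrates the estimate.\<close>

lemma second_difference_estimate:
  fixes f :: "'e::real_normed_vector \<Rightarrow> 'f::real_normed_vector"
  assumes F: "subspace F" "p \<in> F" "a \<in> F" "b \<in> F"
    and r: "r > 0" "\<And>x. x \<in> F \<Longrightarrow> norm (x - p) < r \<Longrightarrow> (f has_derivative f' x) (at x within F)"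
    and A: "((\<lambda>x. f' x a) has_derivative A) (at p within F)"
    and e: "e > 0"
  shows "\<exists>d>0. \<forall>t. 0 < t \<and> t < d \<longrightarrow>
    norm (f (p + t *\<^sub>R a + t *\<^sub>R b) - f (p + t *\<^sub>R a) - f (p + t *\<^sub>R b) + f p - t\<^sup>2 *\<^sub>R A b) \<le> e * t\<^sup>2"
proof -
  interpret A: bounded_linear A using A has_derivative_bounded_linear by blast
  \<comment> \<open>Two error terms of size at most \<open>e / M * (t * (norm a + norm b))\<close>
    must add up to at most \<open>e * t\<close>; the 1 keeps \<open>M\<close> positive when a and b
    vanish.\<close>
  define M where "M = 2 * (norm a + norm b) + 1"
  have M: "M > 0" unfolding M_def by (intro add_nonneg_pos) auto
  obtain d where d: "d > 0" "\<And>y. y \<in> F \<Longrightarrow> norm (y - p) < d \<Longrightarrow>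
      norm (f' y a - f' p a - A (y - p)) \<le> e / M * norm (y - p)"
    using A e M unfolding has_derivative_within_alt by (metis divide_pos_pos)
  define d1 where "d1 = min d r / M"
  have d1: "d1 > 0" using d r M by (simp add: d1_def)
  show ?thesis
  proof (intro exI[of _ d1] conjI allI impI d1, elim conjE)
    fix t assume t: "0 < t" "t < d1"
    then have tM: "t * M < d" "t * M < r" using M by (auto simp: d1_def field_simps)
    have small: "norm (s *\<^sub>R a + q *\<^sub>R b) \<le> t * (norm a + norm b)" if "0 \<le> s" "s \<le> t" "0 \<le> q" "q \<le> t" for s q
    proof -
      have "norm (s *\<^sub>R a + q *\<^sub>R b) \<le> s * norm a + q * norm b"
        using that by (metis abs_of_nonneg norm_scaleR norm_triangle_ineq)
      also have "\<dots> \<le> t * norm a + t * norm b" using that by (intro add_mono mult_right_mono) auto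
      finally show ?thesis by (simp add: distrib_left)
    qed
    have "0 \<le> norm a + norm b" by (intro add_nonneg_nonneg) auto
    moreover have "M = (norm a + norm b) + (norm a + norm b) + 1" by (simp add: M_def)
    ultimately have "norm a + norm b < M" by linarith
    then have lM: "t * (norm a + norm b) < t * M" using t(1) by (rule mult_strict_left_mono)
    have inF: "p + s *\<^sub>R a + q *\<^sub>R b \<in> F" for s q using F by (simp add: subspace_add subspace_scale)
    have D: "((\<lambda>s. f (p + s *\<^sub>R a + q *\<^sub>R b)) has_derivative (\<lambda>h. h *\<^sub>R f' (p + s *\<^sub>R a + q *\<^sub>R b) a)) (at s)"
      and est: "norm (f' (p + s *\<^sub>R a + q *\<^sub>R b) a - f' p a - A (s *\<^sub>R a + q *\<^sub>R b)) \<le> e / M * (t * (norm a + norm b))"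
      if "0 \<le> s" "s \<le> t" "0 \<le> q" "q \<le> t" for s q
    proof -
      let ?x = "p + s *\<^sub>R a + q *\<^sub>R b"
      have eq: "?x - p = s *\<^sub>R a + q *\<^sub>R b" by simp
      have n: "norm (?x - p) \<le> t * (norm a + norm b)" unfolding eq by (rule small[OF that])
      then have fx: "(f has_derivative f' ?x) (at ?x within F)" using lM tM by (intro r inF) linarith
      interpret fx: bounded_linear "f' ?x" using fx has_derivative_bounded_linear by blast
      have g: "((\<lambda>s. p + s *\<^sub>R a + q *\<^sub>R b) has_derivative (\<lambda>h. h *\<^sub>R a)) (at s)"
        by (auto intro!: derivative_eq_intros)
      have sub: "range (\<lambda>s. p + s *\<^sub>R a + q *\<^sub>R b) \<subseteq> F" using inF by auto
      from has_derivative_in_compose[OF g has_derivative_subset[OF fx sub]]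
      show "((\<lambda>s. f (p + s *\<^sub>R a + q *\<^sub>R b)) has_derivative (\<lambda>h. h *\<^sub>R f' ?x a)) (at s)"
        by (simp add: fx.scale)
      have "norm (f' ?x a - f' p a - A (?x - p)) \<le> e / M * norm (?x - p)" using n lM tM by (intro d inF) linarith
      also have "\<dots> \<le> e / M * (t * (norm a + norm b))" using n e M by (intro mult_left_mono) auto
      finally show "norm (f' ?x a - f' p a - A (s *\<^sub>R a + q *\<^sub>R b)) \<le> e / M * (t * (norm a + norm b))"
        unfolding eq .
    qed
    \<comment> \<open>The term linear in s subtracts the expected main part, so that
      \<open>g t - g 0\<close> is the whole expression to be bounded and \<open>g'\<close> is
      small.\<close>
    define g where "g s = f (p + s *\<^sub>R a + t *\<^sub>R b) - f (p + s *\<^sub>R a) - s *\<^sub>R (t *\<^sub>R A b)" for s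
    define g' where "g' s = f' (p + s *\<^sub>R a + t *\<^sub>R b) a - f' (p + s *\<^sub>R a) a - t *\<^sub>R A b" for s
    have gd: "(g has_derivative (\<lambda>h. h *\<^sub>R g' s)) (at s within {0..t})" if "s \<in> {0..t}" for s
    proof -
      have "((\<lambda>s. f (p + s *\<^sub>R a)) has_derivative (\<lambda>h. h *\<^sub>R f' (p + s *\<^sub>R a) a)) (at s)"
        using D[of s 0] that t by simp
      moreover have "((\<lambda>s. s *\<^sub>R (t *\<^sub>R A b)) has_derivative (\<lambda>h. h *\<^sub>R (t *\<^sub>R A b))) (at s)"
        by (auto intro!: derivative_eq_intros)
      moreover have "((\<lambda>s. f (p + s *\<^sub>R a + t *\<^sub>R b)) has_derivative (\<lambda>h. h *\<^sub>R f' (p + s *\<^sub>R a + t *\<^sub>R b) a)) (at s)"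
        using D[of s t] that t by simp
      ultimately have "((\<lambda>s. f (p + s *\<^sub>R a + t *\<^sub>R b) - f (p + s *\<^sub>R a) - s *\<^sub>R (t *\<^sub>R A b)) has_derivative
          (\<lambda>h. h *\<^sub>R f' (p + s *\<^sub>R a + t *\<^sub>R b) a - h *\<^sub>R f' (p + s *\<^sub>R a) a - h *\<^sub>R (t *\<^sub>R A b))) (at s)"
        by (intro has_derivative_diff)
      then have "(g has_derivative (\<lambda>h. h *\<^sub>R g' s)) (at s)"
        unfolding g_def[abs_def] g'_def by (simp only: scaleR_right_diff_distrib)
      then show ?thesis by (rule has_derivative_at_withinI)
    qed
    have g'b: "norm (g' s) \<le> e * t" if "s \<in> {0..t}" for s
    proof -
      have "g' s = (f' (p + s *\<^sub>R a + t *\<^sub>R b) a - f' p a - A (s *\<^sub>R a + t *\<^sub>R b)) - (f' (p + s *\<^sub>R a + 0 *\<^sub>R b) a - f' p a - A (s *\<^sub>R a + 0 *\<^sub>R b))"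
        by (simp add: g'_def A.add A.scale)
      then have "norm (g' s) \<le> e / M * (t * (norm a + norm b)) + e / M * (t * (norm a + norm b))"
        by (rule norm_diff_le_add) (use est[of s t] est[of s 0] that t in auto)
      also have "\<dots> = e * t * ((2 * (norm a + norm b)) / M)" by (simp add: field_simps)
      also have "\<dots> \<le> e * t * 1" using e t M by (intro mult_left_mono) (auto simp: M_def)
      finally show ?thesis by simp
    qed
    have "norm (g t - g 0) \<le> e * t * norm (t - 0)"
    proof (rule differentiable_bound[OF _ gd])
      fix s assume "s \<in> {0..t}"
      then show "onorm (\<lambda>h. h *\<^sub>R g' s) \<le> e * t" using g'b[of s] t e
        by (intro onorm_le) (simp add: mult.commute mult_left_mono)
    qed (use t in auto)
    then show "norm (f (p + t *\<^sub>R a + t *\<^sub>R b) - f (p + t *\<^sub>R a) - f (p + t *\<^sub>R b) + f p - t\<^sup>2 *\<^sub>R A b) \<le> e * t\<^sup>2"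
      using t by (simp add: g_def power2_eq_square algebra_simps)
  qed
qed

text \<open>The second difference is symmetric in a and b, and divided by the square of t it tends
  to \<open>A b\<close> as well as to \<open>B a\<close>.\<close>

lemma symmetric_second_derivative:
  fixes f :: "'e::real_normed_vector \<Rightarrow> 'f::real_normed_vector"
  assumes F: "subspace F" "p \<in> F" "a \<in> F" "b \<in> F"
    and r: "r > 0" "\<And>x. x \<in> F \<Longrightarrow> norm (x - p) < r \<Longrightarrow> (f has_derivative f' x) (at x within F)"
    and A: "((\<lambda>x. f' x a) has_derivative A) (at p within F)"
    and B: "((\<lambda>x. f' x b) has_derivative B) (at p within F)"
  shows "A b = B a"
proof (rule ccontr)
  assume "A b \<noteq> B a"
  \<comment> \<open>The two estimates give a distance of at most \<open>2 * e\<close>, half of the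
    assumed positive distance.\<close>
  define e where "e = norm (A b - B a) / 4"
  have e: "e > 0" using \<open>A b \<noteq> B a\<close> by (simp add: e_def)
  obtain d1 where d1: "d1 > 0" "\<And>t. 0 < t \<Longrightarrow> t < d1 \<Longrightarrow>
    norm (f (p + t *\<^sub>R a + t *\<^sub>R b) - f (p + t *\<^sub>R a) - f (p + t *\<^sub>R b) + f p - t\<^sup>2 *\<^sub>R A b) \<le> e * t\<^sup>2"
    using second_difference_estimate[OF F r A e] by blast
  obtain d2 where d2: "d2 > 0" "\<And>t. 0 < t \<Longrightarrow> t < d2 \<Longrightarrow>
    norm (f (p + t *\<^sub>R b + t *\<^sub>R a) - f (p + t *\<^sub>R b) - f (p + t *\<^sub>R a) + f p - t\<^sup>2 *\<^sub>R B a) \<le> e * t\<^sup>2"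
    using second_difference_estimate[OF F(1,2,4,3) r B e] by blast
  define t where "t = min d1 d2 / 2"
  have t: "0 < t" "t < d1" "t < d2" using d1 d2 by (auto simp: t_def)
  let ?D = "f (p + t *\<^sub>R a + t *\<^sub>R b) - f (p + t *\<^sub>R a) - f (p + t *\<^sub>R b) + f p"
  have "norm (?D - t\<^sup>2 *\<^sub>R A b) \<le> e * t\<^sup>2" using d1(2) t by blast
  moreover have "norm (?D - t\<^sup>2 *\<^sub>R B a) \<le> e * t\<^sup>2" using d2(2)[of t] t by (simp add: algebra_simps)
  moreover have "t\<^sup>2 *\<^sub>R (A b - B a) = (?D - t\<^sup>2 *\<^sub>R B a) - (?D - t\<^sup>2 *\<^sub>R A b)" by (simp add: algebra_simps)
  ultimately have "norm (t\<^sup>2 *\<^sub>R (A b - B a)) \<le> e * t\<^sup>2 + e * t\<^sup>2" using norm_diff_le_add by blast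
  then have "t\<^sup>2 * norm (A b - B a) \<le> t\<^sup>2 * (2 * e)"
    by (simp only: norm_scaleR abs_power2) (simp only: algebra_simps mult_2)
  then have "norm (A b - B a) \<le> 2 * e" using t by (simp add: mult_le_cancel_left_pos)
  then show False using e by (simp add: e_def)
qed

lemma smooth_on_has_derivative:
  "smooth_on E S f \<Longrightarrow> x \<in> S \<Longrightarrow> \<exists>f'. (f has_derivative f') (at x within E)"
  unfolding smooth_on_def by (metis Ck.simps(2))

lemma smooth_on_continuous_on: "smooth_on E S f \<Longrightarrow> continuous_on S f"
  unfolding smooth_on_def by (metis Ck.simps(1))

lemma openin_subspace_ball:
  assumes "openin (top_of_set E) S" "p \<in> S"
  obtains r where "r > 0" "ball p r \<inter> E \<subseteq> S"
  using assms openin_contains_ball[of E S] by auto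

text \<open>\<open>Ck\<close> provides continuity of \<open>\<lambda>x. f' x v\<close> for each v
  separately. A basis makes the derivative uniformly bounded near p, and the segment between two
  points stays in the convex set \<open>ball p r \<inter> E\<close>.\<close>

lemma C1_locally_lipschitz:
  fixes f :: "'e::real_normed_vector \<Rightarrow> 'f::real_normed_vector"
  assumes E: "finite_dim_subspace E" and S: "openin (top_of_set E) S" "p \<in> S"
    and f: "Ck (Suc 0) E S f"
  obtains r C where "r > 0" "C > 0" "ball p r \<inter> E \<subseteq> S"
    "\<And>x y. x \<in> ball p r \<inter> E \<Longrightarrow> y \<in> ball p r \<inter> E \<Longrightarrow> norm (f x - f y) \<le> C * norm (x - y)"
proof -
  obtain f' where f': "\<And>x. x \<in> S \<Longrightarrow> (f has_derivative f' x) (at x within E)"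
    "\<And>v. v \<in> E \<Longrightarrow> continuous_on S (\<lambda>x. f' x v)" using f by auto
  obtain B C r where cb: "coordinate_basis E B C r" using finite_dim_coords[OF E] .
  interpret coordinate_basis E B C r by fact
  have sE: "subspace E" using E finite_dim_subspaceD by blast
  obtain r1 where r1: "r1 > 0" "ball p r1 \<inter> E \<subseteq> S" using openin_subspace_ball[OF S] .
  have "\<forall>\<^sub>F x in at p within S. \<forall>b\<in>B. dist (f' x b) (f' p b) < 1"
  proof (rule eventually_ball_finite[OF finite_B], rule ballI)
    fix b assume "b \<in> B"
    then have "((\<lambda>x. f' x b) \<longlongrightarrow> f' p b) (at p within S)"
      using f'(2)[OF B_subset] S(2) by (auto simp: continuous_on_def)
    then show "\<forall>\<^sub>F x in at p within S. dist (f' x b) (f' p b) < 1" by (rule tendstoD) simp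
  qed
  then obtain r2 where r2: "r2 > 0" "\<And>x b. x \<in> S \<Longrightarrow> x \<noteq> p \<Longrightarrow> dist x p < r2 \<Longrightarrow> b \<in> B \<Longrightarrow> dist (f' x b) (f' p b) < 1"
    unfolding eventually_at by blast
  \<comment> \<open>Coordinates contribute \<open>C\<close>, and on basis vectors the derivative
    exceeds its value at p by at most 1; the last 1 makes \<open>M\<close> positive.\<close>
  define M where "M = C * (\<Sum>b\<in>B. norm (f' p b) + 1) + 1"
  define q where "q = min r1 r2"
  have q: "q > 0" "ball p q \<inter> E \<subseteq> S" using r1 r2 by (auto simp: q_def)
  have M0: "M > 0" unfolding M_def using C_pos
    by (intro add_nonneg_pos mult_nonneg_nonneg sum_nonneg add_nonneg_nonneg) auto
  have f'b: "norm (f' x b) \<le> norm (f' p b) + 1" if "x \<in> ball p q \<inter> E" "b \<in> B" for x b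
  proof (cases "x = p")
    case False
    then have "dist (f' x b) (f' p b) < 1" using that r2(2)[of x b] q by (auto simp: q_def dist_commute)
    then show ?thesis using norm_triangle_ineq2[of "f' x b" "f' p b"] by (simp add: dist_norm)
  qed simp
  have onb: "norm (f' x v) \<le> M * norm v" if x: "x \<in> ball p q \<inter> E" and v: "v \<in> E" for x v
  proof -
    interpret fx: bounded_linear "f' x" using f'(1) x q has_derivative_bounded_linear by blast
    have "f' x v = (\<Sum>b\<in>B. r b v *\<^sub>R f' x b)"
      using expand[OF v] by (metis (no_types, lifting) fx.scale fx.sum sum.cong)
    then have "norm (f' x v) \<le> (\<Sum>b\<in>B. \<bar>r b v\<bar> * norm (f' x b))" by (simp add: sum_norm_le)
    also have "\<dots> \<le> (\<Sum>b\<in>B. (C * norm v) * (norm (f' p b) + 1))"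
      using coord_le[OF v] f'b[OF x] C_pos by (intro sum_mono mult_mono) auto
    also have "\<dots> = C * (\<Sum>b\<in>B. norm (f' p b) + 1) * norm v" by (simp add: sum_distrib_left mult_ac)
    also have "\<dots> \<le> M * norm v" by (intro mult_right_mono) (auto simp: M_def)
    finally show ?thesis .
  qed
  have "norm (f x - f y) \<le> M * norm (x - y)" if x: "x \<in> ball p q \<inter> E" and y: "y \<in> ball p q \<inter> E" for x y
  proof -
    have seg: "y + t *\<^sub>R (x - y) \<in> ball p q \<inter> E" if "t \<in> {0..1}" for t
    proof -
      have "(1 - t) *\<^sub>R y + t *\<^sub>R x \<in> ball p q"
        using that x y by (intro convexD[OF convex_ball]) auto
      then show ?thesis using x y sE by (auto simp: algebra_simps subspace_add subspace_diff subspace_scale)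
    qed
    have D: "((\<lambda>t. f (y + t *\<^sub>R (x - y))) has_derivative (\<lambda>h. h *\<^sub>R f' (y + t *\<^sub>R (x - y)) (x - y))) (at t within {0..1})"
      if t: "t \<in> {0..1}" for t
    proof -
      let ?z = "y + t *\<^sub>R (x - y)"
      have fz: "(f has_derivative f' ?z) (at ?z within E)" using seg[OF t] q f'(1) by blast
      interpret fz: bounded_linear "f' ?z" using fz has_derivative_bounded_linear by blast
      have g: "((\<lambda>s. y + s *\<^sub>R (x - y)) has_derivative (\<lambda>h. h *\<^sub>R (x - y))) (at t within {0..1})"
        by (auto intro!: derivative_eq_intros)
      have sub: "(\<lambda>s. y + s *\<^sub>R (x - y)) ` {0..1} \<subseteq> E" using seg by auto
      from has_derivative_in_compose[OF g has_derivative_subset[OF fz sub]] show ?thesis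
        by (simp only: fz.scale)
    qed
    have "norm (f (y + 1 *\<^sub>R (x - y)) - f (y + 0 *\<^sub>R (x - y))) \<le> (M * norm (x - y)) * norm (1 - 0 :: real)"
    proof (rule differentiable_bound[OF _ D])
      fix t :: real assume t: "t \<in> {0..1}"
      have "x - y \<in> E" using x y sE by (simp add: subspace_diff)
      from onb[OF seg[OF t] this]
      show "onorm (\<lambda>h. h *\<^sub>R f' (y + t *\<^sub>R (x - y)) (x - y)) \<le> M * norm (x - y)"
        by (intro onorm_le) (simp add: mult.commute mult_left_mono)
    qed auto
    then show ?thesis by simp
  qed
  with that q M0 show thesis by blast
qed

text \<open>The constant depends on the space and not on \<open>T\<close>, so finitely many
  pointwise estimates control an operator norm.\<close>

lemma blinfun_norm_le_basis:
  assumes "finite_dim_subspace (UNIV :: 'a::real_normed_vector set)"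
  obtains B :: "'a::real_normed_vector set" and C where "finite B" "C > 0"
    "\<And>(T :: 'a::real_normed_vector \<Rightarrow>\<^sub>L 'b::real_normed_vector) e. e \<ge> 0 \<Longrightarrow> (\<And>b. b \<in> B \<Longrightarrow> norm (blinfun_apply T b) \<le> e) \<Longrightarrow> norm T \<le> C * e"
proof -
  obtain B C r where cb: "coordinate_basis (UNIV :: 'a set) B C r" using finite_dim_coords[OF assms] .
  interpret coordinate_basis "UNIV :: 'a set" B C r by fact
  have "norm T \<le> (C * real (card B) + 1) * e"
    if e: "e \<ge> 0" "\<And>b. b \<in> B \<Longrightarrow> norm (blinfun_apply T b) \<le> e" for T :: "'a \<Rightarrow>\<^sub>L 'b" and e
  proof (rule norm_blinfun_bound)
    fix x :: 'a
    have "T x = (\<Sum>b\<in>B. r b x *\<^sub>R T b)"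
      using expand[of x] by (metis (no_types, lifting) UNIV_I blinfun.scaleR_right blinfun.sum_right sum.cong)
    then have "norm (T x) \<le> (\<Sum>b\<in>B. \<bar>r b x\<bar> * norm (T b))" by (simp add: sum_norm_le)
    also have "\<dots> \<le> (\<Sum>b\<in>B. (C * norm x) * e)"
      using coord_le e C_pos by (intro sum_mono mult_mono) auto
    also have "\<dots> = (C * real (card B)) * e * norm x" by simp
    also have "\<dots> \<le> (C * real (card B) + 1) * e * norm x" using e by (intro mult_right_mono) auto
    finally show "norm (T x) \<le> (C * real (card B) + 1) * e * norm x" .
  qed (use e C_pos in auto)
  moreover have "C * real (card B) + 1 > 0" using C_pos by (intro add_nonneg_pos) auto
  ultimately show thesis using that finite_B by blast
qed

section \<open>Charts and tangent spaces\<close>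

text \<open>A product atlas inherits this part of \<open>smooth_manifold\<close> factor by factor,
  so the chart lemmas below apply to products without a proof that these are smooth
  manifolds.\<close>

definition topological_atlas :: "('p, 'e::real_normed_vector) manifold \<Rightarrow> bool" where
  "topological_atlas M \<longleftrightarrow>
     (\<forall>U \<phi>. (U, \<phi>) \<in> atlas M \<longrightarrow> inj_on \<phi> U) \<and>
     (\<forall>U \<phi> V \<psi>. (U, \<phi>) \<in> atlas M \<longrightarrow> (V, \<psi>) \<in> atlas M \<longrightarrow>
        openin (top_of_set (model M)) (\<phi> ` (U \<inter> V)) \<and>
        continuous_on (\<phi> ` (U \<inter> V)) (\<psi> \<circ> inv_into U \<phi>))"

lemma smooth_manifold_topological_atlas: "smooth_manifold M \<Longrightarrow> topological_atlas M"
  unfolding smooth_manifold_def topological_atlas_def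
  by (fastforce intro: smooth_on_continuous_on)

lemma topological_atlas_inj: "topological_atlas M \<Longrightarrow> (U, \<phi>) \<in> atlas M \<Longrightarrow> inj_on \<phi> U"
  unfolding topological_atlas_def by blast

lemma topological_atlas_overlap:
  assumes "topological_atlas M" "(U, \<phi>) \<in> atlas M" "(V, \<psi>) \<in> atlas M"
  shows "openin (top_of_set (model M)) (\<phi> ` (U \<inter> V))" "continuous_on (\<phi> ` (U \<inter> V)) (\<psi> \<circ> inv_into U \<phi>)"
  using assms unfolding topological_atlas_def by blast+

lemma topological_atlas_chart_image:
  assumes "topological_atlas M" "(U, \<phi>) \<in> atlas M"
  shows "openin (top_of_set (model M)) (\<phi> ` U)" "\<phi> ` U \<subseteq> model M"
proof -
  show "openin (top_of_set (model M)) (\<phi> ` U)" using topological_atlas_overlap(1)[OF assms assms(2)] by simp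
  then show "\<phi> ` U \<subseteq> model M" using openin_imp_subset by blast
qed

lemma topological_atlas_prod:
  assumes M: "topological_atlas M" and N: "topological_atlas N"
  shows "topological_atlas (prod_manifold M N)"
  unfolding topological_atlas_def
proof (intro conjI allI impI)
  fix U \<phi> assume "(U, \<phi>) \<in> atlas (prod_manifold M N)"
  then show "inj_on \<phi> U" using topological_atlas_inj[OF M] topological_atlas_inj[OF N]
    by (auto simp: prod_manifold_def intro!: map_prod_inj_on)
next
  fix U \<phi> V \<psi> assume "(U, \<phi>) \<in> atlas (prod_manifold M N)" "(V, \<psi>) \<in> atlas (prod_manifold M N)"
  then obtain U1 \<phi>1 U2 \<phi>2 V1 \<psi>1 V2 \<psi>2 where
    U: "U = U1 \<times> U2" "\<phi> = map_prod \<phi>1 \<phi>2" "(U1, \<phi>1) \<in> atlas M" "(U2, \<phi>2) \<in> atlas N" and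
    V: "V = V1 \<times> V2" "\<psi> = map_prod \<psi>1 \<psi>2" "(V1, \<psi>1) \<in> atlas M" "(V2, \<psi>2) \<in> atlas N"
    by (auto simp: prod_manifold_def)
  note inj = topological_atlas_inj[OF M U(3)] topological_atlas_inj[OF N U(4)]
  have injp: "inj_on (map_prod \<phi>1 \<phi>2) (U1 \<times> U2)" using inj by (rule map_prod_inj_on)
  have im: "\<phi> ` (U \<inter> V) = \<phi>1 ` (U1 \<inter> V1) \<times> \<phi>2 ` (U2 \<inter> V2)"
    by (auto simp: U V)
  show "openin (top_of_set (model (prod_manifold M N))) (\<phi> ` (U \<inter> V))"
    unfolding im using topological_atlas_overlap(1)[OF M U(3) V(3)] topological_atlas_overlap(1)[OF N U(4) V(4)]
    by (auto simp: prod_manifold_def intro: openin_Times)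
  \<comment> \<open>\<open>inv_into\<close> of the product map is a choice of pairs; injectivity in
    each factor makes it split.\<close>
  have inv: "inv_into U \<phi> z = (inv_into U1 \<phi>1 (fst z), inv_into U2 \<phi>2 (snd z))" if z: "z \<in> \<phi> ` (U \<inter> V)" for z
  proof -
    obtain x y where "z = \<phi> (x, y)" "x \<in> U1" "y \<in> U2" using z by (auto simp: U)
    then show ?thesis using inv_into_f_f[OF injp, of "(x, y)"] inj by (simp add: U)
  qed
  have "continuous_on (\<phi> ` (U \<inter> V)) (\<lambda>z. ((\<psi>1 \<circ> inv_into U1 \<phi>1) (fst z), (\<psi>2 \<circ> inv_into U2 \<phi>2) (snd z)))"
    unfolding im
  proof (rule continuous_on_Pair)
    show "continuous_on (\<phi>1 ` (U1 \<inter> V1) \<times> \<phi>2 ` (U2 \<inter> V2)) (\<lambda>z. (\<psi>1 \<circ> inv_into U1 \<phi>1) (fst z))"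
      by (rule continuous_on_compose2[OF topological_atlas_overlap(2)[OF M U(3) V(3)] continuous_on_fst[OF continuous_on_id]]) auto
    show "continuous_on (\<phi>1 ` (U1 \<inter> V1) \<times> \<phi>2 ` (U2 \<inter> V2)) (\<lambda>z. (\<psi>2 \<circ> inv_into U2 \<phi>2) (snd z))"
      by (rule continuous_on_compose2[OF topological_atlas_overlap(2)[OF N U(4) V(4)] continuous_on_snd[OF continuous_on_id]]) auto
  qed
  then show "continuous_on (\<phi> ` (U \<inter> V)) (\<psi> \<circ> inv_into U \<phi>)"
    by (rule continuous_on_eq) (simp add: inv V)
qed

lemma openin_manifold_topology_chart:
  "(U, \<phi>) \<in> atlas M \<Longrightarrow> open V \<Longrightarrow> openin (manifold_topology M) (U \<inter> \<phi> -` V)"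
  unfolding manifold_topology_def by (rule topology_generated_by_Basis) blast

lemma openin_chart_domain: "(U, \<phi>) \<in> atlas M \<Longrightarrow> openin (manifold_topology M) U"
  using openin_manifold_topology_chart[of U \<phi> M UNIV] by simp

lemma topspace_manifold_topology: "topspace (manifold_topology M) = points M"
proof
  show "topspace (manifold_topology M) \<subseteq> points M"
    unfolding manifold_topology_def topology_generated_by_topspace points_def by fastforce
  show "points M \<subseteq> topspace (manifold_topology M)"
  proof
    fix x assume "x \<in> points M"
    then obtain U \<phi> where "(U, \<phi>) \<in> atlas M" "x \<in> U" by (auto simp: points_def)
    then show "x \<in> topspace (manifold_topology M)"
      using openin_subset[OF openin_chart_domain] by blast
  qed
qed

text \<open>Chart maps are continuous by the definition of the topology; this is their openness. In
  the induction over the generated topology, injectivity settles intersections, and continuous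
  transition maps settle the generators coming from other charts.\<close>

lemma chart_open_image:
  assumes M: "topological_atlas M" and c: "(U, \<phi>) \<in> atlas M" and W: "openin (manifold_topology M) W"
  shows "openin (top_of_set (model M)) (\<phi> ` (U \<inter> W))"
proof -
  have inj: "inj_on \<phi> U" using M c topological_atlas_inj by blast
  have "generate_topology_on {U \<inter> \<phi> -` V | U \<phi> V. (U, \<phi>) \<in> atlas M \<and> open V} W"
    using W unfolding manifold_topology_def by (rule openin_topology_generated_by)
  then show ?thesis
  proof induction
    case (Int a b)
    have "\<phi> ` (U \<inter> (a \<inter> b)) = \<phi> ` (U \<inter> a) \<inter> \<phi> ` (U \<inter> b)"
      using inj_on_image_Int[OF inj, of "U \<inter> a" "U \<inter> b"] by (simp add: Int_ac)
    then show ?case using Int by auto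
  next
    case (UN K)
    have "\<phi> ` (U \<inter> \<Union>K) = (\<Union>k\<in>K. \<phi> ` (U \<inter> k))" by auto
    then show ?case using UN by auto
  next
    case (Basis s)
    then obtain V \<psi> O' where s: "s = V \<inter> \<psi> -` O'" "(V, \<psi>) \<in> atlas M" "open O'" by blast
    have "\<phi> ` (U \<inter> s) = \<phi> ` (U \<inter> V) \<inter> (\<psi> \<circ> inv_into U \<phi>) -` O'"
      using inj by (auto simp: s)
    moreover have "openin (top_of_set (\<phi> ` (U \<inter> V))) (\<phi> ` (U \<inter> V) \<inter> (\<psi> \<circ> inv_into U \<phi>) -` O')"
      using topological_atlas_overlap(2)[OF M c s(2)] s(3) by (rule continuous_openin_preimage_gen)
    ultimately show ?case using topological_atlas_overlap(1)[OF M c s(2)] by (metis openin_trans)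
  qed simp
qed

text \<open>Open sets enter derivative arguments in this form: every vector of the model close to
  the coordinate of p is the coordinate of a point of \<open>W\<close>.\<close>

lemma chart_ball:
  assumes M: "topological_atlas M" and c: "(U, \<phi>) \<in> atlas M" and W: "openin (manifold_topology M) W" "p \<in> U" "p \<in> W"
  obtains r where "r > 0" "\<And>x. x \<in> model M \<Longrightarrow> dist x (\<phi> p) < r \<Longrightarrow> inv_into U \<phi> x \<in> U \<inter> W \<and> \<phi> (inv_into U \<phi> x) = x"
proof -
  have inj: "inj_on \<phi> U" using M c topological_atlas_inj by blast
  have "\<phi> p \<in> \<phi> ` (U \<inter> W)" using W by blast
  then obtain r where r: "r > 0" "ball (\<phi> p) r \<inter> model M \<subseteq> \<phi> ` (U \<inter> W)"
    using openin_subspace_ball[OF chart_open_image[OF M c W(1)]] by blast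
  show thesis
  proof (rule that[OF r(1)])
    fix x assume "x \<in> model M" "dist x (\<phi> p) < r"
    then have "x \<in> \<phi> ` (U \<inter> W)" using r(2) by (auto simp: dist_commute)
    then show "inv_into U \<phi> x \<in> U \<inter> W \<and> \<phi> (inv_into U \<phi> x) = x" using inj by auto
  qed
qed

lemma chart_inverse_continuous:
  assumes M: "topological_atlas M" and c: "(U, \<phi>) \<in> atlas M"
  shows "continuous_map (top_of_set (\<phi> ` U)) (manifold_topology M) (inv_into U \<phi>)"
  unfolding continuous_map
proof (intro conjI allI impI)
  have inj: "inj_on \<phi> U" using M c topological_atlas_inj by blast
  show "inv_into U \<phi> ` topspace (top_of_set (\<phi> ` U)) \<subseteq> topspace (manifold_topology M)"
    using inj c by (force simp: topspace_manifold_topology points_def)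
  fix W assume W: "openin (manifold_topology M) W"
  have "{x \<in> topspace (top_of_set (\<phi> ` U)). inv_into U \<phi> x \<in> W} = \<phi> ` (U \<inter> W)"
    using inj by auto
  then show "openin (top_of_set (\<phi> ` U)) {x \<in> topspace (top_of_set (\<phi> ` U)). inv_into U \<phi> x \<in> W}"
    using openin_subset_trans[OF chart_open_image[OF M c W] image_mono[OF Int_lower1] topological_atlas_chart_image(2)[OF M c]]
    by simp
qed

text \<open>A closed ball of half the radius, cut with the model, is compact in coordinates; the
  continuous inverse chart carries it over.\<close>

lemma manifold_compact_neighbourhood:
  assumes M: "topological_atlas M" and E: "finite_dim_subspace (model M)"
    and W: "openin (manifold_topology M) W" "x \<in> W"
  obtains V C where "openin (manifold_topology M) V" "x \<in> V" "V \<subseteq> C" "C \<subseteq> W" "compactin (manifold_topology M) C"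
proof -
  have "x \<in> points M" using W openin_subset topspace_manifold_topology by (metis subsetD)
  then obtain U \<phi> where c: "(U, \<phi>) \<in> atlas M" "x \<in> U" by (auto simp: points_def)
  have inj: "inj_on \<phi> U" using M c topological_atlas_inj by blast
  obtain r where r: "r > 0" "ball (\<phi> x) r \<inter> model M \<subseteq> \<phi> ` (U \<inter> W)"
    using openin_subspace_ball[OF chart_open_image[OF M c(1) W(1)]] c W by blast
  let ?B = "cball (\<phi> x) (r/2) \<inter> model M"
  have B: "?B \<subseteq> \<phi> ` (U \<inter> W)" using r by (force intro: subsetD[OF r(2)])
  have "compact ?B"
    using finite_dim_closed[OF E] by (intro finite_dim_compact[OF E] closed_Int bounded_Int) auto
  then have "compactin (top_of_set (\<phi> ` U)) ?B" using B by (auto simp: compactin_subtopology)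
  then have "compactin (manifold_topology M) (inv_into U \<phi> ` ?B)"
    using chart_inverse_continuous[OF M c(1)] image_compactin by blast
  moreover have "inv_into U \<phi> ` ?B \<subseteq> W" using B inj by force
  moreover have "U \<inter> \<phi> -` ball (\<phi> x) (r/2) \<subseteq> inv_into U \<phi> ` ?B"
  proof
    fix y assume y: "y \<in> U \<inter> \<phi> -` ball (\<phi> x) (r/2)"
    then have "\<phi> y \<in> ?B" using topological_atlas_chart_image(2)[OF M c(1)] by auto
    moreover have "inv_into U \<phi> (\<phi> y) = y" using y inj by auto
    ultimately show "y \<in> inv_into U \<phi> ` ?B" by (metis imageI)
  qed
  moreover have "openin (manifold_topology M) (U \<inter> \<phi> -` ball (\<phi> x) (r/2))"
    using c by (intro openin_manifold_topology_chart) auto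
  moreover have "x \<in> U \<inter> \<phi> -` ball (\<phi> x) (r/2)" using c r by auto
  ultimately show thesis using that by blast
qed

text \<open>The chain rule through an intermediate chart. The factorisation through
  \<open>\<psi>\<close> is valid only where f lands in \<open>V\<close>, so it is differentiated on
  a ball whose points come from \<open>W\<close>; the derivative at the centre does not see this
  restriction.\<close>

lemma chart_compose_has_derivative:
  fixes M :: "('p, 'e::real_normed_vector) manifold" and N :: "('q, 'f::real_normed_vector) manifold"
    and h :: "'q \<Rightarrow> 'x::real_normed_vector"
  assumes M: "topological_atlas M" and c: "(U, \<phi>) \<in> atlas M" "p \<in> U"
    and N: "topological_atlas N" and d: "(V, \<psi>) \<in> atlas N"
    and W: "openin (manifold_topology M) W" "p \<in> W" "f ` W \<subseteq> V"
    and D: "((\<psi> \<circ> f \<circ> inv_into U \<phi>) has_derivative D) (at (\<phi> p) within model M)"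
    and T: "((h \<circ> inv_into V \<psi>) has_derivative T) (at (\<psi> (f p)) within model N)"
  shows "((h \<circ> f \<circ> inv_into U \<phi>) has_derivative (\<lambda>v. T (D v))) (at (\<phi> p) within model M)"
proof -
  obtain r where r: "r > 0" "\<And>x. x \<in> model M \<Longrightarrow> dist x (\<phi> p) < r \<Longrightarrow> inv_into U \<phi> x \<in> U \<inter> W \<and> \<phi> (inv_into U \<phi> x) = x"
    using chart_ball[OF M c(1) W(1) c(2) W(2)] by blast
  have injM: "inj_on \<phi> U" using M c topological_atlas_inj by blast
  have injN: "inj_on \<psi> V" using N d topological_atlas_inj by blast
  let ?S = "model M \<inter> ball (\<phi> p) r"
  let ?F = "\<psi> \<circ> f \<circ> inv_into U \<phi>"
  have pE: "\<phi> p \<in> model M" using topological_atlas_chart_image(2)[OF M c(1)] c(2) by blast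
  have Fp: "?F (\<phi> p) = \<psi> (f p)" using c injM by simp
  have inV: "f (inv_into U \<phi> x) \<in> V" if "x \<in> ?S" for x
    using that r(2)[of x] W(3) by (auto simp: dist_commute)
  have sub: "?F ` ?S \<subseteq> model N"
    using inV topological_atlas_chart_image(2)[OF N d] by auto
  have "((h \<circ> inv_into V \<psi>) has_derivative T) (at (?F (\<phi> p)) within ?F ` ?S)"
    using T sub Fp by (metis has_derivative_subset)
  then have "((\<lambda>x. (h \<circ> inv_into V \<psi>) (?F x)) has_derivative (\<lambda>v. T (D v))) (at (\<phi> p) within ?S)"
    by (rule has_derivative_in_compose[OF has_derivative_subset[OF D Int_lower1]])
  moreover have "at (\<phi> p) within ?S = at (\<phi> p) within model M"
    using r(1) by (intro at_within_nhd[of _ "ball (\<phi> p) r"]) auto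
  ultimately have *: "((\<lambda>x. (h \<circ> inv_into V \<psi>) (?F x)) has_derivative (\<lambda>v. T (D v))) (at (\<phi> p) within model M)"
    by simp
  show ?thesis
  proof (rule has_derivative_transform_within[OF * r(1) pE])
    fix x assume "x \<in> model M" "dist x (\<phi> p) < r"
    then have "f (inv_into U \<phi> x) \<in> V" by (intro inV) (auto simp: dist_commute)
    then show "(h \<circ> inv_into V \<psi>) (?F x) = (h \<circ> f \<circ> inv_into U \<phi>) x" using injN by simp
  qed
qed

section \<open>Tangent vectors and differentials in charts\<close>

lemma smooth_map_chart_has_derivative:
  assumes "smooth_map M N f" "(U, \<phi>) \<in> atlas M" "p \<in> U" "(V, \<psi>) \<in> atlas N" "f p \<in> V"
  obtains D where "((\<psi> \<circ> f \<circ> inv_into U \<phi>) has_derivative D) (at (\<phi> p) within model M)"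
proof -
  have "smooth_on (model M) (\<phi> ` (U \<inter> f -` V)) (\<psi> \<circ> f \<circ> inv_into U \<phi>)"
    using assms unfolding smooth_map_def by blast
  moreover have "\<phi> p \<in> \<phi> ` (U \<inter> f -` V)" using assms by blast
  ultimately show thesis using smooth_on_has_derivative that by blast
qed

lemma smooth_manifold_transition_has_derivative:
  assumes M: "smooth_manifold M" and c: "(U, \<phi>) \<in> atlas M" "p \<in> U" and d: "(V, \<psi>) \<in> atlas M" "p \<in> V"
  obtains D where "((\<psi> \<circ> inv_into U \<phi>) has_derivative D) (at (\<phi> p) within model M)"
    "\<And>v. v \<in> model M \<Longrightarrow> D v \<in> model M"
proof -
  have tM: "topological_atlas M" using M smooth_manifold_topological_atlas by blast
  have E: "finite_dim_subspace (model M)" using M by (simp add: smooth_manifold_def)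
  have "smooth_on (model M) (\<phi> ` (U \<inter> V)) (\<psi> \<circ> inv_into U \<phi>)"
    using M c d unfolding smooth_manifold_def by blast
  moreover have "\<phi> p \<in> \<phi> ` (U \<inter> V)" using c d by blast
  ultimately obtain D where D: "((\<psi> \<circ> inv_into U \<phi>) has_derivative D) (at (\<phi> p) within model M)"
    using smooth_on_has_derivative by blast
  obtain r where r: "r > 0" "\<And>x. x \<in> model M \<Longrightarrow> dist x (\<phi> p) < r \<Longrightarrow> inv_into U \<phi> x \<in> U \<inter> V \<and> \<phi> (inv_into U \<phi> x) = x"
    using chart_ball[OF tM c(1) openin_chart_domain[OF d(1)] c(2) d(2)] by blast
  have "D v \<in> model M" if "v \<in> model M" for v
  proof (rule has_derivative_within_range[OF _ _ that D _ _ r(1)])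
    show "\<phi> p \<in> model M" using topological_atlas_chart_image(2)[OF tM c(1)] c(2) by blast
    show "(\<psi> \<circ> inv_into U \<phi>) y \<in> model M" if "y \<in> model M" "dist y (\<phi> p) < r" for y
      using r(2)[OF that] topological_atlas_chart_image(2)[OF tM d(1)] by auto
  qed (use E finite_dim_subspaceD finite_dim_closed in auto)
  with D that show thesis by blast
qed

text \<open>Inverse to reading off the coordinate in the chart c (\<open>tangent_of_chart\<close>,
  \<open>tangent_space_eq_tangent_of\<close>); any chart around p thus identifies the tangent space
  with the model.\<close>

definition tangent_of :: "('p, 'e::real_normed_vector) manifold \<Rightarrow> 'p \<Rightarrow> ('p, 'e) chart \<Rightarrow> 'e \<Rightarrow> ('p, 'e) tangent" where
  "tangent_of M p c e = (\<lambda>(V, \<psi>). if (V, \<psi>) \<in> atlas M \<and> p \<in> V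
     then frechet_derivative (\<psi> \<circ> inv_into (fst c) (snd c)) (at (snd c p) within model M) e else 0)"

lemma chart_identity_has_derivative:
  assumes M: "topological_atlas M" and c: "(U, \<phi>) \<in> atlas M" "p \<in> U"
  shows "((\<phi> \<circ> inv_into U \<phi>) has_derivative (\<lambda>v. v)) (at (\<phi> p) within model M)"
proof -
  obtain r where r: "r > 0" "\<And>x. x \<in> model M \<Longrightarrow> dist x (\<phi> p) < r \<Longrightarrow> inv_into U \<phi> x \<in> U \<inter> U \<and> \<phi> (inv_into U \<phi> x) = x"
    using chart_ball[OF M c(1) openin_chart_domain[OF c(1)] c(2) c(2)] by blast
  show ?thesis
    by (rule has_derivative_transform_within[OF has_derivative_ident r(1)])
      (use topological_atlas_chart_image(2)[OF M c(1)] c(2) r(2) in auto)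
qed

lemma tangent_of_chart:
  assumes M: "topological_atlas M" and E: "subspace (model M)" and c: "c \<in> atlas M" "p \<in> fst c" and e: "e \<in> model M"
  shows "tangent_of M p c e c = e"
proof -
  obtain U \<phi> where [simp]: "c = (U, \<phi>)" by fastforce
  have "\<phi> p \<in> model M" using topological_atlas_chart_image(2)[OF M, of U \<phi>] c by auto
  then show ?thesis
    using frechet_derivative_within_subspace[OF E _ e chart_identity_has_derivative[OF M, of U \<phi> p]] c
    by (simp add: tangent_of_def)
qed

lemma tangent_of_in_tangent_space:
  assumes M: "smooth_manifold M" and c: "c \<in> atlas M" "p \<in> fst c" and e: "e \<in> model M"
  shows "tangent_of M p c e \<in> tangent_space M p"
proof -
  obtain U \<phi> where cU: "c = (U, \<phi>)" by fastforce
  have tM: "topological_atlas M" using M smooth_manifold_topological_atlas by blast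
  have E: "subspace (model M)" using M by (simp add: smooth_manifold_def finite_dim_subspaceD)
  have cc: "(U, \<phi>) \<in> atlas M" "p \<in> U" using c cU by auto
  have pE: "\<phi> p \<in> model M" using topological_atlas_chart_image(2)[OF tM cc(1)] cc(2) by blast
  have fd: "frechet_derivative (\<psi> \<circ> inv_into U \<phi>) (at (\<phi> p) within model M) e = D e"
    if "((\<psi> \<circ> inv_into U \<phi>) has_derivative D) (at (\<phi> p) within model M)" for \<psi> :: "'a \<Rightarrow> 'b" and D
    using frechet_derivative_within_subspace[OF E pE e that] .
  have 1: "tangent_of M p c e (V, \<psi>) \<in> model M" if V: "(V, \<psi>) \<in> atlas M" "p \<in> V" for V \<psi>
  proof -
    obtain D where "((\<psi> \<circ> inv_into U \<phi>) has_derivative D) (at (\<phi> p) within model M)"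
      "\<And>v. v \<in> model M \<Longrightarrow> D v \<in> model M"
      using smooth_manifold_transition_has_derivative[OF M cc V] by blast
    then show ?thesis using fd[of \<psi> D] e V by (simp add: tangent_of_def cU)
  qed
  have 2: "tangent_of M p c e (W, \<eta>) = frechet_derivative (\<eta> \<circ> inv_into V \<psi>) (at (\<psi> p) within model M) (tangent_of M p c e (V, \<psi>))"
    if V: "(V, \<psi>) \<in> atlas M" "p \<in> V" and W: "(W, \<eta>) \<in> atlas M" "p \<in> W" for V \<psi> W \<eta>
  proof -
    obtain D where D: "((\<psi> \<circ> inv_into U \<phi>) has_derivative D) (at (\<phi> p) within model M)" "D e \<in> model M"
      using smooth_manifold_transition_has_derivative[OF M cc V] e by blast
    obtain T where T: "((\<eta> \<circ> inv_into V \<psi>) has_derivative T) (at (\<psi> p) within model M)"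
      using smooth_manifold_transition_has_derivative[OF M V W] by blast
    \<comment> \<open>The chain rule with the identity as middle map composes the two
      transitions.\<close>
    have "((\<eta> \<circ> (\<lambda>x. x) \<circ> inv_into U \<phi>) has_derivative (\<lambda>v. T (D v))) (at (\<phi> p) within model M)"
      by (rule chart_compose_has_derivative[OF tM cc tM V(1) openin_chart_domain[OF V(1)] V(2)])
        (use D T in \<open>auto simp: o_def\<close>)
    then have "frechet_derivative (\<eta> \<circ> inv_into U \<phi>) (at (\<phi> p) within model M) e = T (D e)"
      by (intro fd) (simp add: o_def)
    moreover have "\<psi> p \<in> model M" using topological_atlas_chart_image(2)[OF tM V(1)] V(2) by blast
    ultimately show ?thesis
      using V W fd[OF D(1)] frechet_derivative_within_subspace[OF E _ D(2) T] by (simp add: tangent_of_def cU)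
  qed
  show ?thesis unfolding tangent_space_def mem_Collect_eq
  proof (intro conjI allI ballI)
    fix x :: "('a, 'b) chart"
    obtain V \<psi> where x: "x = (V, \<psi>)" by fastforce
    show "if x \<in> atlas M \<and> p \<in> fst x then tangent_of M p c e x \<in> model M else tangent_of M p c e x = 0"
    proof (cases "(V, \<psi>) \<in> atlas M \<and> p \<in> V")
      case True then show ?thesis using 1 by (simp add: x)
    next
      case False then show ?thesis unfolding x tangent_of_def by auto
    qed
  qed (use 2 in auto)
qed

lemma tangent_space_in_model: "v \<in> tangent_space M p \<Longrightarrow> c \<in> atlas M \<Longrightarrow> p \<in> fst c \<Longrightarrow> v c \<in> model M"
  unfolding tangent_space_def by (metis (mono_tags, lifting) mem_Collect_eq)

lemma tangent_space_eq_tangent_of: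
  assumes v: "v \<in> tangent_space M p" and c: "c \<in> atlas M" "p \<in> fst c"
  shows "v = tangent_of M p c (v c)"
proof
  fix x :: "('a, 'b) chart"
  obtain U \<phi> where cU: "c = (U, \<phi>)" by fastforce
  obtain V \<psi> where x: "x = (V, \<psi>)" by fastforce
  show "v x = tangent_of M p c (v c) x"
  proof (cases "(V, \<psi>) \<in> atlas M \<and> p \<in> V")
    case True
    then have "v (V, \<psi>) = frechet_derivative (\<psi> \<circ> inv_into U \<phi>) (at (\<phi> p) within model M) (v (U, \<phi>))"
      using v c unfolding tangent_space_def cU by auto
    then show ?thesis using True by (simp add: tangent_of_def cU x)
  next
    case False
    then have "\<not> (x \<in> atlas M \<and> p \<in> fst x)" by (simp add: x)
    then have "v x = 0" using v unfolding tangent_space_def by (metis (mono_tags, lifting) mem_Collect_eq)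
    then show ?thesis using False unfolding tangent_of_def x by auto
  qed
qed

text \<open>The chart in which \<open>differential\<close> reads its argument, written with the same
  choice term so that unfolding makes the two agree.\<close>

definition some_chart :: "('p, 'e) manifold \<Rightarrow> 'p \<Rightarrow> ('p, 'e) chart" where
  "some_chart M p = (SOME c. c \<in> atlas M \<and> p \<in> fst c)"

lemma some_chart:
  assumes "p \<in> points M"
  shows "some_chart M p \<in> atlas M" "p \<in> fst (some_chart M p)"
proof -
  have "\<exists>c. c \<in> atlas M \<and> p \<in> fst c" using assms by (force simp: points_def)
  then have "some_chart M p \<in> atlas M \<and> p \<in> fst (some_chart M p)"
    unfolding some_chart_def by (rule someI_ex)
  then show "some_chart M p \<in> atlas M" "p \<in> fst (some_chart M p)" by auto
qed

text \<open>One coordinate expression of f near p determines the whole differential: the values in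
  the other charts of \<open>N\<close> follow by the chain rule through \<open>V\<close>.\<close>

lemma differential_eq_tangent_of:
  fixes M :: "('p, 'e::real_normed_vector) manifold" and N :: "('q, 'f::real_normed_vector) manifold"
  assumes M: "smooth_manifold M" and N: "smooth_manifold N" and p: "p \<in> points M"
    and c: "some_chart M p = (U, \<phi>)"
    and d: "(V, \<psi>) \<in> atlas N"
    and W: "openin (manifold_topology M) W" "p \<in> W" "f ` W \<subseteq> V"
    and D: "((\<psi> \<circ> f \<circ> inv_into U \<phi>) has_derivative D) (at (\<phi> p) within model M)"
    and v: "v (U, \<phi>) \<in> model M"
  shows "differential M N f p v = tangent_of N (f p) (V, \<psi>) (D (v (U, \<phi>)))" "D (v (U, \<phi>)) \<in> model N"
proof -
  have cc: "(U, \<phi>) \<in> atlas M" "p \<in> U" using some_chart[OF p] c by auto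
  have tM: "topological_atlas M" and tN: "topological_atlas N" using M N smooth_manifold_topological_atlas by blast+
  have EM: "subspace (model M)" and EN: "subspace (model N)" "closed (model N)"
    using M N by (simp_all add: smooth_manifold_def finite_dim_subspaceD finite_dim_closed)
  have pE: "\<phi> p \<in> model M" using topological_atlas_chart_image(2)[OF tM cc(1)] cc(2) by blast
  have fp: "f p \<in> V" using W by blast
  have qE: "\<psi> (f p) \<in> model N" using topological_atlas_chart_image(2)[OF tN d] fp by blast
  obtain r where r: "r > 0" "\<And>x. x \<in> model M \<Longrightarrow> dist x (\<phi> p) < r \<Longrightarrow> inv_into U \<phi> x \<in> U \<inter> W \<and> \<phi> (inv_into U \<phi> x) = x"
    using chart_ball[OF tM cc(1) W(1) cc(2) W(2)] by blast
  show DE: "D (v (U, \<phi>)) \<in> model N"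
  proof (rule has_derivative_within_range[OF EM pE v D EN r(1)])
    show "(\<psi> \<circ> f \<circ> inv_into U \<phi>) y \<in> model N" if "y \<in> model M" "dist y (\<phi> p) < r" for y
      using r(2)[OF that] W(3) topological_atlas_chart_image(2)[OF tN d] by auto
  qed
  show "differential M N f p v = tangent_of N (f p) (V, \<psi>) (D (v (U, \<phi>)))"
  proof
    fix x :: "('q, 'f) chart"
    obtain X \<eta> where x: "x = (X, \<eta>)" by fastforce
    show "differential M N f p v x = tangent_of N (f p) (V, \<psi>) (D (v (U, \<phi>))) x"
    proof (cases "(X, \<eta>) \<in> atlas N \<and> f p \<in> X")
      case True
      obtain T where T: "((\<eta> \<circ> inv_into V \<psi>) has_derivative T) (at (\<psi> (f p)) within model N)"
        using smooth_manifold_transition_has_derivative[OF N d fp, of X \<eta>] True by blast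
      have "((\<eta> \<circ> f \<circ> inv_into U \<phi>) has_derivative (\<lambda>v. T (D v))) (at (\<phi> p) within model M)"
        by (rule chart_compose_has_derivative[OF tM cc tN d W D T])
      from frechet_derivative_within_subspace[OF EM pE v this]
      show ?thesis using True frechet_derivative_within_subspace[OF EN(1) qE DE T] c[unfolded some_chart_def]
        by (simp add: differential_def tangent_of_def x)
    next
      case False
      then show ?thesis by (auto simp: differential_def tangent_of_def x)
    qed
  qed
qed

section \<open>Lie groups in a chart at the identity\<close>

lemma points_prod_manifold: "x \<in> points M \<Longrightarrow> y \<in> points N \<Longrightarrow> (x, y) \<in> points (prod_manifold M N)"
proof -
  assume "x \<in> points M" "y \<in> points N"
  then obtain U \<phi> V \<psi> where "(U, \<phi>) \<in> atlas M" "x \<in> U" "(V, \<psi>) \<in> atlas N" "y \<in> V"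
    unfolding points_def by blast
  then have "(U \<times> V, map_prod \<phi> \<psi>) \<in> atlas (prod_manifold M N)" "(x, y) \<in> U \<times> V"
    by (auto simp: prod_manifold_def)
  then show ?thesis unfolding points_def by blast
qed

text \<open>Preimages of the generating sets of the product atlas are tested directly, so the
  topology of a product manifold is never compared with a product topology.\<close>

lemma continuous_map_into_prod_manifold:
  assumes im: "\<And>y. y \<in> topspace T \<Longrightarrow> f y \<in> points (prod_manifold M N)"
    and op: "\<And>U \<phi> V \<psi> W. (U, \<phi>) \<in> atlas M \<Longrightarrow> (V, \<psi>) \<in> atlas N \<Longrightarrow> open W \<Longrightarrow>
      openin T {y \<in> topspace T. f y \<in> U \<times> V \<and> map_prod \<phi> \<psi> (f y) \<in> W}"
  shows "continuous_map T (manifold_topology (prod_manifold M N)) f"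
  unfolding manifold_topology_def
proof (rule continuous_on_generated_topo)
  fix S assume "S \<in> {U \<inter> \<phi> -` V |U \<phi> V. (U, \<phi>) \<in> atlas (prod_manifold M N) \<and> open V}"
  then obtain U \<phi> W where S: "S = U \<inter> \<phi> -` W" "(U, \<phi>) \<in> atlas (prod_manifold M N)" "open W" by blast
  from S(2) obtain U1 \<phi>1 U2 \<phi>2 where U: "U = U1 \<times> U2" "\<phi> = map_prod \<phi>1 \<phi>2" "(U1, \<phi>1) \<in> atlas M" "(U2, \<phi>2) \<in> atlas N"
    by (auto simp: prod_manifold_def)
  have "f -` S \<inter> topspace T = {y \<in> topspace T. f y \<in> U1 \<times> U2 \<and> map_prod \<phi>1 \<phi>2 (f y) \<in> W}"
    by (auto simp: S(1) U(1,2))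
  then show "openin T (f -` S \<inter> topspace T)" using op[OF U(3,4) S(3)] by simp
next
  have "\<Union>{U \<inter> \<phi> -` V |U \<phi> V. (U, \<phi>) \<in> atlas (prod_manifold M N) \<and> open V} = points (prod_manifold M N)"
    using topspace_manifold_topology[of "prod_manifold M N"]
    by (simp only: manifold_topology_def topology_generated_by_topspace)
  then show "f ` topspace T \<subseteq> \<Union>{U \<inter> \<phi> -` V |U \<phi> V. (U, \<phi>) \<in> atlas (prod_manifold M N) \<and> open V}"
    using im by auto
qed

lemma continuous_map_Pair_prod_manifold:
  assumes a: "a \<in> points M"
  shows "continuous_map (manifold_topology N) (manifold_topology (prod_manifold M N)) (\<lambda>y. (a, y))"
    and "continuous_map (manifold_topology N) (manifold_topology (prod_manifold N M)) (\<lambda>y. (y, a))"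
proof (rule_tac [!] continuous_map_into_prod_manifold)
  fix U \<phi> V \<psi> and W :: "('b \<times> 'd) set" assume c: "(V, \<psi>) \<in> atlas N" "open W"
  have "openin (manifold_topology N) (V \<inter> \<psi> -` ((\<lambda>y. (\<phi> a, y)) -` W))"
    using c by (intro openin_manifold_topology_chart open_vimage continuous_intros)
  moreover have "{y \<in> topspace (manifold_topology N). (a, y) \<in> U \<times> V \<and> map_prod \<phi> \<psi> (a, y) \<in> W}
      = (if a \<in> U then V \<inter> \<psi> -` ((\<lambda>y. (\<phi> a, y)) -` W) else {})"
    using openin_subset[OF openin_chart_domain[OF c(1)]] by auto
  ultimately show "openin (manifold_topology N) {y \<in> topspace (manifold_topology N). (a, y) \<in> U \<times> V \<and> map_prod \<phi> \<psi> (a, y) \<in> W}"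
    by simp
next
  fix U \<phi> V \<psi> and W :: "('d \<times> 'b) set" assume c: "(U, \<phi>) \<in> atlas N" "open W"
  have "openin (manifold_topology N) (U \<inter> \<phi> -` ((\<lambda>y. (y, \<psi> a)) -` W))"
    using c by (intro openin_manifold_topology_chart open_vimage continuous_intros)
  moreover have "{y \<in> topspace (manifold_topology N). (y, a) \<in> U \<times> V \<and> map_prod \<phi> \<psi> (y, a) \<in> W}
      = (if a \<in> V then U \<inter> \<phi> -` ((\<lambda>y. (y, \<psi> a)) -` W) else {})"
    using openin_subset[OF openin_chart_domain[OF c(1)]] by auto
  ultimately show "openin (manifold_topology N) {y \<in> topspace (manifold_topology N). (y, a) \<in> U \<times> V \<and> map_prod \<phi> \<psi> (y, a) \<in> W}"
    by simp
qed (use a in \<open>auto simp: topspace_manifold_topology intro: points_prod_manifold\<close>)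

locale lie_grp = group G for G :: "('g, 'e::real_normed_vector) lie_group" (structure) +
  assumes lie: "is_lie_group G"
begin

abbreviation E :: "'e set" where "E \<equiv> model (mfd G)"
abbreviation mul :: "'g \<times> 'g \<Rightarrow> 'g" where "mul \<equiv> \<lambda>(x, y). x \<otimes> y"

text \<open>\<open>differential\<close> takes coordinates at the identity in the chart \<open>some_chart (mfd G) \<one>\<close>, so all
  computations are done in that chart.\<close>

definition "U0 = fst (some_chart (mfd G) \<one>)"
definition "\<phi>0 = snd (some_chart (mfd G) \<one>)"
definition "e0 = \<phi>0 \<one>"
definition "inv0 = inv_into U0 \<phi>0"

lemma manifold: "smooth_manifold (mfd G)" and points: "points (mfd G) = carrier G"
  and mult_smooth: "smooth_map (prod_manifold (mfd G) (mfd G)) (mfd G) mul"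
  and inv_smooth: "smooth_map (mfd G) (mfd G) (\<lambda>x. inv x)"
  using lie unfolding is_lie_group_def by auto

lemma top_atlas: "topological_atlas (mfd G)"
  using manifold smooth_manifold_topological_atlas by blast

lemma finite_dim_E: "finite_dim_subspace E"
  using manifold by (simp add: smooth_manifold_def)

lemma subspace_E: "subspace E"
  using finite_dim_E finite_dim_subspaceD by blast

lemma topspace: "topspace (lie_topology G) = carrier G"
  by (simp add: topspace_manifold_topology points)

lemma chart_subset: "(U, \<phi>) \<in> atlas (mfd G) \<Longrightarrow> U \<subseteq> carrier G"
  using points by (auto simp: points_def)

lemma chart_at:
  assumes "g \<in> carrier G"
  obtains U \<phi> where "(U, \<phi>) \<in> atlas (mfd G)" "g \<in> U"
proof -
  have "g \<in> points (mfd G)" using assms points by simp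
  then show thesis using that unfolding points_def by blast
qed

lemma chart0: "(U0, \<phi>0) \<in> atlas (mfd G)" "\<one> \<in> U0" "some_chart (mfd G) \<one> = (U0, \<phi>0)"
  using some_chart[of \<one> "mfd G"] points by (simp_all add: U0_def \<phi>0_def)

lemma U0_carrier: "x \<in> U0 \<Longrightarrow> x \<in> carrier G"
  using chart_subset chart0 by blast

lemma inj0: "inj_on \<phi>0 U0"
  using topological_atlas_inj[OF top_atlas chart0(1)] .

lemma inv0 [simp]: "x \<in> U0 \<Longrightarrow> inv0 (\<phi>0 x) = x"
  using inj0 by (simp add: inv0_def)

lemma \<phi>0_in_E: "x \<in> U0 \<Longrightarrow> \<phi>0 x \<in> E"
  using topological_atlas_chart_image(2)[OF top_atlas chart0(1)] by blast

lemma e0_in_E: "e0 \<in> E"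
  unfolding e0_def using \<phi>0_in_E chart0 by blast

lemma openin_U0: "openin (lie_topology G) U0"
  using openin_chart_domain chart0 by blast

lemma chart0_ball:
  assumes W: "openin (lie_topology G) W" "\<one> \<in> W"
  obtains r where "r > 0"
    "\<And>v. v \<in> E \<Longrightarrow> norm v < r \<Longrightarrow> inv0 (e0 + v) \<in> U0 \<inter> W \<and> \<phi>0 (inv0 (e0 + v)) = e0 + v"
proof -
  obtain r where r: "r > 0" "\<And>x. x \<in> E \<Longrightarrow> dist x (\<phi>0 \<one>) < r \<Longrightarrow> inv_into U0 \<phi>0 x \<in> U0 \<inter> W \<and> \<phi>0 (inv_into U0 \<phi>0 x) = x"
    using chart_ball[OF top_atlas chart0(1) W(1) chart0(2) W(2)] by blast
  show thesis
    by (rule that[OF r(1)]) (use r(2) e0_in_E subspace_E in \<open>auto simp: inv0_def e0_def dist_norm subspace_add\<close>)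
qed

text \<open>Near \<open>e0\<close> every vector of \<open>E\<close> is the coordinate of a group
  element, so maps may be compared as maps on the group.\<close>

lemma has_derivative_chart0_cong:
  assumes f: "(f has_derivative D) (at e0 within E)" and eq: "\<And>a. a \<in> U0 \<Longrightarrow> f (\<phi>0 a) = g (\<phi>0 a)"
  shows "(g has_derivative D) (at e0 within E)"
proof -
  obtain r where r: "r > 0" "\<And>v. v \<in> E \<Longrightarrow> norm v < r \<Longrightarrow> inv0 (e0 + v) \<in> U0 \<inter> U0 \<and> \<phi>0 (inv0 (e0 + v)) = e0 + v"
    using chart0_ball[OF openin_U0 chart0(2)] by blast
  show ?thesis
  proof (rule has_derivative_transform_within[OF f r(1) e0_in_E])
    fix y assume "y \<in> E" "dist y e0 < r"
    then have "inv0 y \<in> U0" "\<phi>0 (inv0 y) = y"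
      using r(2)[of "y - e0"] subspace_E e0_in_E by (auto simp: dist_norm subspace_diff)
    then show "f y = g y" using eq[of "inv0 y"] by simp
  qed
qed

lemma chart0_id_has_derivative: "((\<phi>0 \<circ> inv0) has_derivative (\<lambda>v. v)) (at e0 within E)"
  using chart_identity_has_derivative[OF top_atlas chart0(1,2)] by (simp add: inv0_def e0_def)

section \<open>Translations and conjugations in coordinates\<close>

lemma mult_continuous: "continuous_map (manifold_topology (prod_manifold (mfd G) (mfd G))) (lie_topology G) mul"
  using mult_smooth by (simp add: smooth_map_def)

lemma left_mult_continuous:
  assumes "g \<in> carrier G" shows "continuous_map (lie_topology G) (lie_topology G) (\<lambda>h. g \<otimes> h)"
  using continuous_map_compose[OF continuous_map_Pair_prod_manifold(1)[of g "mfd G"] mult_continuous] assms points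
  by (simp add: o_def)

lemma right_mult_continuous:
  assumes "g \<in> carrier G" shows "continuous_map (lie_topology G) (lie_topology G) (\<lambda>h. h \<otimes> g)"
  using continuous_map_compose[OF continuous_map_Pair_prod_manifold(2)[of g "mfd G"] mult_continuous] assms points
  by (simp add: o_def)

lemma inv_continuous: "continuous_map (lie_topology G) (lie_topology G) (\<lambda>x. inv x)"
  using inv_smooth by (simp add: smooth_map_def)

text \<open>Domain and expression follow the pattern of \<open>smooth_map\<close> for the product
  atlas, so that smoothness of \<open>mul_rep\<close> is an instance of the smoothness of the
  multiplication.\<close>

definition mul_dom :: "('g, 'e) chart \<Rightarrow> ('g, 'e) chart \<Rightarrow> ('g, 'e) chart \<Rightarrow> ('e \<times> 'e) set" where
  "mul_dom c d f = map_prod (snd c) (snd d) ` ((fst c \<times> fst d) \<inter> mul -` fst f)"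
definition mul_rep :: "('g, 'e) chart \<Rightarrow> ('g, 'e) chart \<Rightarrow> ('g, 'e) chart \<Rightarrow> ('e \<times> 'e) \<Rightarrow> 'e" where
  "mul_rep c d f = snd f \<circ> mul \<circ> inv_into (fst c \<times> fst d) (map_prod (snd c) (snd d))"

lemma mul_rep_smooth:
  assumes "c \<in> atlas (mfd G)" "d \<in> atlas (mfd G)" "f \<in> atlas (mfd G)"
  shows "smooth_on (E \<times> E) (mul_dom c d f) (mul_rep c d f)"
proof -
  obtain U \<phi> V \<psi> W \<eta> where [simp]: "c = (U, \<phi>)" "d = (V, \<psi>)" "f = (W, \<eta>)" by (metis surj_pair)
  have "(U \<times> V, map_prod \<phi> \<psi>) \<in> atlas (prod_manifold (mfd G) (mfd G))"
    using assms by (auto simp: prod_manifold_def)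
  then have "smooth_on (model (prod_manifold (mfd G) (mfd G))) (map_prod \<phi> \<psi> ` ((U \<times> V) \<inter> mul -` W)) (\<eta> \<circ> mul \<circ> inv_into (U \<times> V) (map_prod \<phi> \<psi>))"
    using mult_smooth assms unfolding smooth_map_def by fastforce
  then show ?thesis by (simp add: mul_dom_def mul_rep_def prod_manifold_def)
qed

lemma mul_dom_open:
  assumes c: "c \<in> atlas (mfd G)" "d \<in> atlas (mfd G)" "f \<in> atlas (mfd G)"
  shows "openin (top_of_set (E \<times> E)) (mul_dom c d f)"
proof -
  obtain U \<phi> V \<psi> W \<eta> where [simp]: "c = (U, \<phi>)" "d = (V, \<psi>)" "f = (W, \<eta>)" by (metis surj_pair)
  let ?P = "prod_manifold (mfd G) (mfd G)"
  have UV: "(U \<times> V, map_prod \<phi> \<psi>) \<in> atlas ?P" using c by (auto simp: prod_manifold_def)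
  have "openin (manifold_topology ?P) {z \<in> topspace (manifold_topology ?P). mul z \<in> W}"
    using mult_continuous openin_chart_domain[of W \<eta> "mfd G"] c by (auto intro: openin_continuous_map_preimage)
  from chart_open_image[OF topological_atlas_prod[OF top_atlas top_atlas] UV this]
  have "openin (top_of_set (model ?P)) (map_prod \<phi> \<psi> ` (U \<times> V \<inter> {z \<in> topspace (manifold_topology ?P). mul z \<in> W}))" .
  moreover have "U \<times> V \<inter> {z \<in> topspace (manifold_topology ?P). mul z \<in> W} = (U \<times> V) \<inter> mul -` W"
    using openin_subset[OF openin_chart_domain[OF UV]] by auto
  ultimately show ?thesis by (simp add: mul_dom_def prod_manifold_def)
qed

lemma mul_rep_eq:
  assumes "(U, \<phi>) \<in> atlas (mfd G)" "(V, \<psi>) \<in> atlas (mfd G)" "x \<in> U" "y \<in> V"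
  shows "mul_rep (U, \<phi>) (V, \<psi>) (W, \<eta>) (\<phi> x, \<psi> y) = \<eta> (x \<otimes> y)"
proof -
  have "inj_on (map_prod \<phi> \<psi>) (U \<times> V)"
    using assms topological_atlas_inj[OF top_atlas] by (intro map_prod_inj_on)
  from inv_into_f_f[OF this, of "(x, y)"] assms show ?thesis by (simp add: mul_rep_def)
qed

text \<open>A partial derivative of the multiplication: the first argument is frozen, so the full
  derivative is evaluated on vectors \<open>(0, v)\<close>.\<close>

lemma left_mult_has_derivative:
  assumes c: "(U, \<phi>) \<in> atlas (mfd G)" "g \<in> U" and d: "(V, \<psi>) \<in> atlas (mfd G)" "h \<in> V"
    and D: "(mul_rep (U, \<phi>) (V, \<psi>) (W, \<eta>) has_derivative D) (at (\<phi> g, \<psi> h) within E \<times> E)"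
  shows "((\<eta> \<circ> (\<lambda>h. g \<otimes> h) \<circ> inv_into V \<psi>) has_derivative (\<lambda>v. D (0, v))) (at (\<psi> h) within E)"
proof -
  have gE: "\<phi> g \<in> E" and hE: "\<psi> h \<in> E"
    using topological_atlas_chart_image(2)[OF top_atlas c(1)] c(2) topological_atlas_chart_image(2)[OF top_atlas d(1)] d(2) by auto
  obtain r where r: "r > 0" "\<And>x. x \<in> E \<Longrightarrow> dist x (\<psi> h) < r \<Longrightarrow> inv_into V \<psi> x \<in> V \<inter> V \<and> \<psi> (inv_into V \<psi> x) = x"
    using chart_ball[OF top_atlas d(1) openin_chart_domain[OF d(1)] d(2) d(2)] by blast
  have p: "((\<lambda>y. (\<phi> g, y)) has_derivative (\<lambda>v. (0, v))) (at (\<psi> h) within E)"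
    by (auto intro!: derivative_eq_intros)
  have "((\<lambda>y. mul_rep (U, \<phi>) (V, \<psi>) (W, \<eta>) (\<phi> g, y)) has_derivative (\<lambda>v. D (0, v))) (at (\<psi> h) within E)"
    using has_derivative_in_compose[OF p has_derivative_subset[OF D]] gE by auto
  then show ?thesis
  proof (rule has_derivative_transform_within[OF _ r(1) hE])
    fix x assume "x \<in> E" "dist x (\<psi> h) < r"
    from r(2)[OF this] show "mul_rep (U, \<phi>) (V, \<psi>) (W, \<eta>) (\<phi> g, x) = (\<eta> \<circ> (\<lambda>h. g \<otimes> h) \<circ> inv_into V \<psi>) x"
      using mul_rep_eq[OF c(1) d(1) c(2), of "inv_into V \<psi> x" W \<eta>] by simp
  qed
qed

lemma right_mult_has_derivative:
  assumes c: "(U, \<phi>) \<in> atlas (mfd G)" "g \<in> U" and d: "(V, \<psi>) \<in> atlas (mfd G)" "h \<in> V"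
    and D: "(mul_rep (U, \<phi>) (V, \<psi>) (W, \<eta>) has_derivative D) (at (\<phi> g, \<psi> h) within E \<times> E)"
  shows "((\<eta> \<circ> (\<lambda>g. g \<otimes> h) \<circ> inv_into U \<phi>) has_derivative (\<lambda>v. D (v, 0))) (at (\<phi> g) within E)"
proof -
  have gE: "\<phi> g \<in> E" and hE: "\<psi> h \<in> E"
    using topological_atlas_chart_image(2)[OF top_atlas c(1)] c(2) topological_atlas_chart_image(2)[OF top_atlas d(1)] d(2) by auto
  obtain r where r: "r > 0" "\<And>x. x \<in> E \<Longrightarrow> dist x (\<phi> g) < r \<Longrightarrow> inv_into U \<phi> x \<in> U \<inter> U \<and> \<phi> (inv_into U \<phi> x) = x"
    using chart_ball[OF top_atlas c(1) openin_chart_domain[OF c(1)] c(2) c(2)] by blast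
  have p: "((\<lambda>x. (x, \<psi> h)) has_derivative (\<lambda>v. (v, 0))) (at (\<phi> g) within E)"
    by (auto intro!: derivative_eq_intros)
  have "((\<lambda>x. mul_rep (U, \<phi>) (V, \<psi>) (W, \<eta>) (x, \<psi> h)) has_derivative (\<lambda>v. D (v, 0))) (at (\<phi> g) within E)"
    using has_derivative_in_compose[OF p has_derivative_subset[OF D]] hE by auto
  then show ?thesis
  proof (rule has_derivative_transform_within[OF _ r(1) gE])
    fix x assume "x \<in> E" "dist x (\<phi> g) < r"
    from r(2)[OF this] show "mul_rep (U, \<phi>) (V, \<psi>) (W, \<eta>) (x, \<psi> h) = (\<eta> \<circ> (\<lambda>g. g \<otimes> h) \<circ> inv_into U \<phi>) x"
      using mul_rep_eq[OF c(1) d(1) _ d(2), of "inv_into U \<phi> x" W \<eta>] by simp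
  qed
qed

lemma mul_rep_has_derivative:
  assumes c: "(U, \<phi>) \<in> atlas (mfd G)" "g \<in> U" and d: "(V, \<psi>) \<in> atlas (mfd G)" "h \<in> V"
    and f: "(W, \<eta>) \<in> atlas (mfd G)" "g \<otimes> h \<in> W"
  obtains D where "(mul_rep (U, \<phi>) (V, \<psi>) (W, \<eta>) has_derivative D) (at (\<phi> g, \<psi> h) within E \<times> E)"
proof -
  have "(\<phi> g, \<psi> h) \<in> mul_dom (U, \<phi>) (V, \<psi>) (W, \<eta>)"
    using c d f by (force simp: mul_dom_def)
  then show thesis using smooth_on_has_derivative[OF mul_rep_smooth[OF c(1) d(1) f(1)]] that by blast
qed

text \<open>The same abstraction as in \<open>Ad\<close>, whose differential at the identity defines
  the adjoint action.\<close>

definition cj :: "'g \<Rightarrow> 'g \<Rightarrow> 'g" where "cj g = (\<lambda>h. g \<otimes> h \<otimes> inv g)"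

lemma cj_one [simp]: "g \<in> carrier G \<Longrightarrow> cj g \<one> = \<one>"
  by (simp add: cj_def)

lemma cj_mult: "g \<in> carrier G \<Longrightarrow> g' \<in> carrier G \<Longrightarrow> h \<in> carrier G \<Longrightarrow> cj (g \<otimes> g') h = cj g (cj g' h)"
  by (simp add: cj_def m_assoc inv_mult_group)

lemma cj_continuous:
  assumes "g \<in> carrier G" shows "continuous_map (lie_topology G) (lie_topology G) (cj g)"
  using continuous_map_compose[OF left_mult_continuous[OF assms] right_mult_continuous[OF inv_closed[OF assms]]]
  by (simp add: o_def cj_def)

lemma preimage_open:
  assumes "continuous_map (lie_topology G) (lie_topology G) f" "openin (lie_topology G) W"
  shows "openin (lie_topology G) {h \<in> carrier G. f h \<in> W}"
  using openin_continuous_map_preimage[OF assms] by (simp add: topspace)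

text \<open>g may lie outside \<open>U0\<close>. Left translation leads from near the identity into
  a chart around g, and right translation by the inverse leads back into \<open>U0\<close>.\<close>

lemma cj_has_derivative:
  assumes g: "g \<in> carrier G"
  obtains D where "((\<phi>0 \<circ> cj g \<circ> inv0) has_derivative D) (at e0 within E)"
proof -
  obtain V \<psi> where d: "(V, \<psi>) \<in> atlas (mfd G)" "g \<in> V" using chart_at[OF g] .
  have g1: "g \<otimes> \<one> \<in> V" using g d by simp
  obtain D1 where D1: "(mul_rep (V, \<psi>) (U0, \<phi>0) (V, \<psi>) has_derivative D1) (at (\<psi> g, \<phi>0 \<one>) within E \<times> E)"
    using mul_rep_has_derivative[OF d chart0(1,2) d(1) g1] .
  obtain V' \<psi>' where d': "(V', \<psi>') \<in> atlas (mfd G)" "inv g \<in> V'" using chart_at[OF inv_closed[OF g]] .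
  have g2: "g \<otimes> inv g \<in> U0" using g chart0 by simp
  obtain D2 where D2: "(mul_rep (V, \<psi>) (V', \<psi>') (U0, \<phi>0) has_derivative D2) (at (\<psi> g, \<psi>' (inv g)) within E \<times> E)"
    using mul_rep_has_derivative[OF d d' chart0(1) g2] .
  have W: "openin (lie_topology G) {h \<in> carrier G. g \<otimes> h \<in> V}"
    by (rule preimage_open[OF left_mult_continuous[OF g] openin_chart_domain[OF d(1)]])
  have T: "((\<phi>0 \<circ> (\<lambda>h. h \<otimes> inv g) \<circ> inv_into V \<psi>) has_derivative (\<lambda>v. D2 (v, 0))) (at (\<psi> (g \<otimes> \<one>)) within E)"
    using right_mult_has_derivative[OF d d' D2] g by simp
  have "((\<phi>0 \<circ> (\<lambda>h. h \<otimes> inv g) \<circ> (\<lambda>h. g \<otimes> h) \<circ> inv_into U0 \<phi>0) has_derivative (\<lambda>v. D2 (D1 (0, v), 0))) (at (\<phi>0 \<one>) within E)"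
    by (rule chart_compose_has_derivative[OF top_atlas chart0(1,2) top_atlas d(1) W _ _ left_mult_has_derivative[OF d chart0(1,2) D1] T])
      (use g1 in auto)
  then show thesis using that by (simp add: o_def cj_def inv0_def e0_def)
qed

lemma cj_open: "g \<in> carrier G \<Longrightarrow> openin (lie_topology G) {h \<in> carrier G. cj g h \<in> U0}"
  by (rule preimage_open[OF cj_continuous openin_U0])

end

context lie_grp
begin

text \<open>\<open>L\<close> and \<open>R\<close> are the derivatives of left and right translations at the identity. As
  \<open>L = D\<^sub>2 m\<close> and \<open>R = D\<^sub>1 m\<close> for the multiplication \<open>m\<close>, their derivatives are the two mixed second
  derivatives of \<open>m\<close>, which agree up to exchanging the arguments.\<close>

lemma translation_derivatives:
  obtains L R :: "'e \<Rightarrow> 'e \<Rightarrow> 'e" and lam Rd :: "'e \<Rightarrow> 'e \<Rightarrow> 'e" where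
    "\<And>a. a \<in> U0 \<Longrightarrow> ((\<phi>0 \<circ> (\<lambda>h. a \<otimes> h) \<circ> inv0) has_derivative L (\<phi>0 a)) (at e0 within E)"
    "\<And>a. a \<in> U0 \<Longrightarrow> ((\<phi>0 \<circ> (\<lambda>h. h \<otimes> a) \<circ> inv0) has_derivative R (\<phi>0 a)) (at e0 within E)"
    "\<And>w. w \<in> E \<Longrightarrow> ((\<lambda>\<alpha>. L \<alpha> w) has_derivative (\<lambda>v. lam v w)) (at e0 within E)"
    "\<And>w. w \<in> E \<Longrightarrow> ((\<lambda>\<alpha>. R \<alpha> w) has_derivative Rd w) (at e0 within E)"
    "\<And>v w. v \<in> E \<Longrightarrow> w \<in> E \<Longrightarrow> Rd w v = lam w v"
proof -
  let ?c = "(U0, \<phi>0)"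
  let ?S = "mul_dom ?c ?c ?c" and ?m = "mul_rep ?c ?c ?c"
  \<comment> \<open>Two derivatives of the multiplication are taken: one for the translations, one
    more for their dependence on the base point.\<close>
  have "Ck (Suc (Suc 0)) (E \<times> E) ?S ?m"
    using mul_rep_smooth[OF chart0(1) chart0(1) chart0(1)] unfolding smooth_on_def by blast
  then obtain m' where m': "\<And>z. z \<in> ?S \<Longrightarrow> (?m has_derivative m' z) (at z within E \<times> E)"
    and Ck1: "\<And>v. v \<in> E \<times> E \<Longrightarrow> Ck (Suc 0) (E \<times> E) ?S (\<lambda>z. m' z v)"
    unfolding Ck.simps(2)[of "Suc 0"] by blast
  have "\<forall>v. \<exists>f. v \<in> E \<times> E \<longrightarrow> (\<forall>z\<in>?S. ((\<lambda>z. m' z v) has_derivative f z) (at z within E \<times> E))"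
    using Ck1 unfolding Ck.simps(2) by blast
  then obtain m2 where m2: "\<And>v z. v \<in> E \<times> E \<Longrightarrow> z \<in> ?S \<Longrightarrow> ((\<lambda>z. m' z v) has_derivative m2 v z) (at z within E \<times> E)"
    by metis
  have S1: "(\<phi>0 a, e0) \<in> ?S" and S2: "(e0, \<phi>0 a) \<in> ?S" if "a \<in> U0" for a
  proof -
    have "(a, \<one>) \<in> (U0 \<times> U0) \<inter> mul -` U0" "(\<one>, a) \<in> (U0 \<times> U0) \<inter> mul -` U0"
      using that chart0 U0_carrier by auto
    then have "map_prod \<phi>0 \<phi>0 (a, \<one>) \<in> ?S" "map_prod \<phi>0 \<phi>0 (\<one>, a) \<in> ?S"
      unfolding mul_dom_def fst_conv snd_conv by blast+
    then show "(\<phi>0 a, e0) \<in> ?S" "(e0, \<phi>0 a) \<in> ?S" by (simp_all add: e0_def)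
  qed
  have See: "(e0, e0) \<in> ?S" using S1[OF chart0(2)] by (simp add: e0_def)
  have E0: "0 \<in> E" using subspace_E subspace_0 by blast
  define L where "L \<alpha> w = m' (\<alpha>, e0) (0, w)" for \<alpha> w
  define R where "R \<alpha> w = m' (e0, \<alpha>) (w, 0)" for \<alpha> w
  define lam where "lam v w = m2 (0, w) (e0, e0) (v, 0)" for v w
  define Rd where "Rd w v = m2 (w, 0) (e0, e0) (0, v)" for v w
  show thesis
  proof (rule that[of L R lam Rd])
    fix a assume a: "a \<in> U0"
    show "((\<phi>0 \<circ> (\<lambda>h. a \<otimes> h) \<circ> inv0) has_derivative L (\<phi>0 a)) (at e0 within E)"
      unfolding L_def[abs_def] inv0_def e0_def
      using left_mult_has_derivative[OF chart0(1) a chart0(1,2), of U0 \<phi>0] m'[OF S1[OF a]] by (simp add: e0_def)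
    show "((\<phi>0 \<circ> (\<lambda>h. h \<otimes> a) \<circ> inv0) has_derivative R (\<phi>0 a)) (at e0 within E)"
      unfolding R_def[abs_def] inv0_def e0_def
      using right_mult_has_derivative[OF chart0(1,2) chart0(1) a, of U0 \<phi>0] m'[OF S2[OF a]] by (simp add: e0_def)
  next
    fix w assume w: "w \<in> E"
    have wE: "(0, w) \<in> E \<times> E" "(w, 0) \<in> E \<times> E" using w E0 by auto
    have p1: "((\<lambda>\<alpha>. (\<alpha>, e0)) has_derivative (\<lambda>v. (v, 0))) (at e0 within E)"
      and p2: "((\<lambda>\<alpha>. (e0, \<alpha>)) has_derivative (\<lambda>v. (0, v))) (at e0 within E)"
      by (auto intro!: derivative_eq_intros)
    have sub: "(\<lambda>\<alpha>. (\<alpha>, e0)) ` E \<subseteq> E \<times> E" "(\<lambda>\<alpha>. (e0, \<alpha>)) ` E \<subseteq> E \<times> E" using e0_in_E by auto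
    show "((\<lambda>\<alpha>. L \<alpha> w) has_derivative (\<lambda>v. lam v w)) (at e0 within E)"
      unfolding L_def lam_def
      by (rule has_derivative_in_compose[OF p1 has_derivative_subset[OF m2[OF wE(1) See] sub(1)]])
    show "((\<lambda>\<alpha>. R \<alpha> w) has_derivative Rd w) (at e0 within E)"
      unfolding R_def Rd_def[abs_def]
      by (rule has_derivative_in_compose[OF p2 has_derivative_subset[OF m2[OF wE(2) See] sub(2)]])
    fix v assume v: "v \<in> E"
    obtain r where r: "r > 0" "ball (e0, e0) r \<inter> (E \<times> E) \<subseteq> ?S"
      using openin_subspace_ball[OF mul_dom_open[OF chart0(1) chart0(1) chart0(1)] See] by blast
    have "m2 (w, 0) (e0, e0) (0, v) = m2 (0, v) (e0, e0) (w, 0)"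
    proof (rule symmetric_second_derivative[OF _ _ _ _ r(1) _ m2[OF _ See] m2[OF _ See]])
      show "subspace (E \<times> E)" using subspace_E by (rule subspace_Times[OF subspace_E])
      show "(?m has_derivative m' z) (at z within E \<times> E)" if "z \<in> E \<times> E" "norm (z - (e0, e0)) < r" for z
      proof (rule m')
        have "z \<in> ball (e0, e0) r \<inter> (E \<times> E)" using that by (simp add: dist_norm norm_minus_commute)
        then show "z \<in> ?S" using r(2) by blast
      qed
    qed (use v w E0 e0_in_E in auto)
    then show "Rd w v = lam w v" by (simp add: Rd_def lam_def)
  qed
qed

end

section \<open>The adjoint action and the bracket in coordinates at the identity\<close>

locale lie_grp_ident = lie_grp G for G :: "('g, 'e::real_normed_vector) lie_group" (structure) +
  fixes br :: "'a::real_normed_vector \<Rightarrow> 'a \<Rightarrow> 'a" and \<theta> :: "'a \<Rightarrow> ('g, 'e) tangent"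
  assumes br: "lie_algebra br" and ident: "lie_algebra_identification br G \<theta>"
begin

lemma finite_dim: "finite_dim_subspace (UNIV :: 'a set)" and bilinear_br: "bilinear br"
  using br by (auto simp: lie_algebra_def)

text \<open>A linear bijection of the Lie algebra onto \<open>E\<close>, through which
  \<open>Ad\<close> and the bracket are computed in coordinates.\<close>

definition th :: "'a \<Rightarrow> 'e" where "th x = \<theta> x (U0, \<phi>0)"

lemma \<theta>_tangent: "\<theta> x \<in> tangent_space (mfd G) \<one>"
  using ident unfolding lie_algebra_identification_def bij_betw_def by blast

lemma th_in_E: "th x \<in> E"
  unfolding th_def using \<theta>_tangent chart0 by (intro tangent_space_in_model) auto

lemma \<theta>_eq: "\<theta> x = tangent_of (mfd G) \<one> (U0, \<phi>0) (th x)"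
  unfolding th_def using \<theta>_tangent chart0 by (intro tangent_space_eq_tangent_of) auto

lemma linear_th: "linear th"
  using ident unfolding lie_algebra_identification_def th_def by (intro linearI) auto

lemma th_inj: "th x = th y \<Longrightarrow> x = y"
proof -
  assume "th x = th y"
  then have "\<theta> x = \<theta> y" using \<theta>_eq by metis
  then show "x = y" using ident unfolding lie_algebra_identification_def bij_betw_def inj_on_def by blast
qed

lemma th_surj:
  assumes "v \<in> E" obtains x where "th x = v"
proof -
  have "tangent_of (mfd G) \<one> (U0, \<phi>0) v \<in> tangent_space (mfd G) \<one>"
    using manifold chart0 assms by (intro tangent_of_in_tangent_space) auto
  then obtain x where "\<theta> x = tangent_of (mfd G) \<one> (U0, \<phi>0) v"
    using ident unfolding lie_algebra_identification_def bij_betw_def by (metis imageE)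
  then have "th x = v" unfolding th_def using tangent_of_chart[OF top_atlas subspace_E _ _ assms, of "(U0, \<phi>0)" \<one>] chart0 by simp
  then show thesis using that by blast
qed

text \<open>\<open>Ad\<close> is defined with \<open>inv_into\<close>, which cancels because the
  differential of a conjugation yields a tangent vector at the identity and \<open>\<theta>\<close>
  maps onto these.\<close>

lemma th_Ad:
  assumes g: "g \<in> carrier G" and D: "((\<phi>0 \<circ> cj g \<circ> inv0) has_derivative D) (at e0 within E)"
  shows "th (Ad G \<theta> g x) = D (th x)"
proof -
  have D': "((\<phi>0 \<circ> cj g \<circ> inv_into U0 \<phi>0) has_derivative D) (at (\<phi>0 \<one>) within E)"
    using D by (simp add: inv0_def e0_def)
  have p: "\<one> \<in> points (mfd G)" by (simp add: points)
  note dd = differential_eq_tangent_of[OF manifold manifold p chart0(3,1) cj_open[OF g] _ _ D', of "\<theta> x"]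
  have eq: "differential (mfd G) (mfd G) (cj g) \<one> (\<theta> x) = tangent_of (mfd G) \<one> (U0, \<phi>0) (D (th x))"
    and DE: "D (th x) \<in> E"
    using dd th_in_E g chart0 by (auto simp: th_def)
  have "tangent_of (mfd G) \<one> (U0, \<phi>0) (D (th x)) \<in> tangent_space (mfd G) \<one>"
    using manifold chart0 DE by (intro tangent_of_in_tangent_space) auto
  then have "tangent_of (mfd G) \<one> (U0, \<phi>0) (D (th x)) \<in> range \<theta>"
    using ident unfolding lie_algebra_identification_def bij_betw_def by simp
  then have "\<theta> (Ad G \<theta> g x) = tangent_of (mfd G) \<one> (U0, \<phi>0) (D (th x))"
    unfolding Ad_def eq[unfolded cj_def] by (rule f_inv_into_f)
  then show ?thesis
    unfolding th_def using tangent_of_chart[OF top_atlas subspace_E _ _ DE, of "(U0, \<phi>0)" \<one>] chart0 by (simp add: th_def)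
qed

lemma linear_Ad: assumes g: "g \<in> carrier G" shows "linear (Ad G \<theta> g)"
proof -
  obtain D where D: "((\<phi>0 \<circ> cj g \<circ> inv0) has_derivative D) (at e0 within E)" using cj_has_derivative[OF g] .
  interpret D: bounded_linear D using D has_derivative_bounded_linear by blast
  show ?thesis
    by (intro linearI; rule th_inj)
      (simp_all add: th_Ad[OF g D] linear_add[OF linear_th] linear_scale[OF linear_th] D.add D.scale)
qed

lemma Ad_one: "Ad G \<theta> \<one> x = x"
proof (rule th_inj)
  have "((\<phi>0 \<circ> cj \<one> \<circ> inv0) has_derivative (\<lambda>v. v)) (at e0 within E)"
    by (rule has_derivative_chart0_cong[OF chart0_id_has_derivative]) (simp add: U0_carrier cj_def)
  from th_Ad[OF _ this] show "th (Ad G \<theta> \<one> x) = th x" by simp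
qed

text \<open>The chain rule at the identity, which every conjugation fixes.\<close>

lemma Ad_mult:
  assumes g: "g \<in> carrier G" and h: "h \<in> carrier G"
  shows "Ad G \<theta> (g \<otimes> h) x = Ad G \<theta> g (Ad G \<theta> h x)"
proof (rule th_inj)
  obtain D where D: "((\<phi>0 \<circ> cj g \<circ> inv0) has_derivative D) (at e0 within E)" using cj_has_derivative[OF g] .
  obtain D' where D': "((\<phi>0 \<circ> cj h \<circ> inv0) has_derivative D') (at e0 within E)" using cj_has_derivative[OF h] .
  have *: "((\<phi>0 \<circ> cj g \<circ> cj h \<circ> inv_into U0 \<phi>0) has_derivative (\<lambda>v. D (D' v))) (at (\<phi>0 \<one>) within E)"
    by (rule chart_compose_has_derivative[where h = "\<phi>0 \<circ> cj g" and f = "cj h" and D = D' and T = D,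
          OF top_atlas chart0(1,2) top_atlas chart0(1) cj_open[OF h]])
      (use D D' h chart0 in \<open>auto simp: inv0_def e0_def\<close>)
  have "((\<phi>0 \<circ> cj (g \<otimes> h) \<circ> inv0) has_derivative (\<lambda>v. D (D' v))) (at e0 within E)"
    by (rule has_derivative_chart0_cong[OF *[folded e0_def inv0_def]]) (simp add: U0_carrier g h cj_mult)
  from th_Ad[OF _ this] show "th (Ad G \<theta> (g \<otimes> h) x) = th (Ad G \<theta> g (Ad G \<theta> h x))"
    using g h by (simp add: th_Ad[OF g D] th_Ad[OF h D'])
qed

lemma left_invariant_field_chart:
  assumes a: "a \<in> U0" and L: "((\<phi>0 \<circ> (\<lambda>h. a \<otimes> h) \<circ> inv0) has_derivative L) (at e0 within E)"
  shows "left_invariant_field G (\<theta> x) a (U0, \<phi>0) = L (th x)"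
proof -
  have "(U0, \<phi>0) \<in> atlas (mfd G) \<and> a \<otimes> \<one> \<in> U0" using a chart0 U0_carrier by simp
  then have "left_invariant_field G (\<theta> x) a (U0, \<phi>0)
      = frechet_derivative (\<phi>0 \<circ> (\<lambda>h. a \<otimes> h) \<circ> inv_into U0 \<phi>0) (at (\<phi>0 \<one>) within E) (\<theta> x (U0, \<phi>0))"
    unfolding left_invariant_field_def differential_def using chart0(3)[unfolded some_chart_def] by simp
  also have "\<dots> = L (th x)"
    using frechet_derivative_within_subspace[OF subspace_E e0_in_E th_in_E L] by (simp add: e0_def inv0_def th_def)
  finally show ?thesis .
qed

text \<open>In coordinates the left invariant field of y takes the value
  \<open>L (\<phi>0 a) (th y)\<close> at a, so its derivative at the identity along v is
  \<open>lam v (th y)\<close>; the commutator antisymmetrises \<open>lam\<close>.\<close>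

lemma th_bracket:
  assumes L: "\<And>a. a \<in> U0 \<Longrightarrow> ((\<phi>0 \<circ> (\<lambda>h. a \<otimes> h) \<circ> inv0) has_derivative L (\<phi>0 a)) (at e0 within E)"
    and lam: "\<And>w. w \<in> E \<Longrightarrow> ((\<lambda>\<alpha>. L \<alpha> w) has_derivative (\<lambda>v. lam v w)) (at e0 within E)"
  shows "th (br x y) = lam (th x) (th y) - lam (th y) (th x)"
proof -
  have fd: "frechet_derivative (\<lambda>\<alpha>. left_invariant_field G (\<theta> y) (inv_into U0 \<phi>0 \<alpha>) (U0, \<phi>0)) (at (\<phi>0 \<one>) within E) v = lam v (th y)"
    if v: "v \<in> E" for v y
  proof -
    have "((\<lambda>\<alpha>. left_invariant_field G (\<theta> y) (inv0 \<alpha>) (U0, \<phi>0)) has_derivative (\<lambda>v. lam v (th y))) (at e0 within E)"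
      by (rule has_derivative_chart0_cong[OF lam[OF th_in_E]]) (simp add: left_invariant_field_chart[OF _ L])
    from frechet_derivative_within_subspace[OF subspace_E e0_in_E v this] show ?thesis by (simp add: inv0_def e0_def)
  qed
  have id: "left_invariant_field G (\<theta> x) \<one> (U0, \<phi>0) = th x" for x
  proof -
    have "((\<phi>0 \<circ> (\<lambda>h. \<one> \<otimes> h) \<circ> inv0) has_derivative (\<lambda>v. v)) (at e0 within E)"
      by (rule has_derivative_chart0_cong[OF chart0_id_has_derivative]) (simp add: U0_carrier)
    from left_invariant_field_chart[OF chart0(2) this] show ?thesis .
  qed
  have "\<theta> (br x y) = lie_group_bracket G (\<theta> x) (\<theta> y)"
    using ident by (simp add: lie_algebra_identification_def)
  then show ?thesis using chart0 fd th_in_E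
    by (simp add: th_def[of "br x y"] lie_group_bracket_def vector_field_bracket_def id)
qed

lemma th_bounds:
  obtains c C where "c > 0" "C > 0" "\<And>x. c * norm x \<le> norm (th x)" "\<And>x. norm (th x) \<le> C * norm x"
proof -
  obtain C where "C > 0" "\<forall>x. norm (th x) \<le> C * norm x"
    using finite_dim_linear_bound[OF finite_dim, of th] linear_add[OF linear_th] linear_scale[OF linear_th] by auto
  moreover obtain c where "c > 0" "\<forall>x. c * norm x \<le> norm (th x)"
    using finite_dim_injective_lower_bound[OF finite_dim, of th] linear_add[OF linear_th] linear_scale[OF linear_th]
      th_inj linear_0[OF linear_th] by (metis UNIV_I)
  ultimately show thesis using that by blast
qed

end

section \<open>The derivative of the adjoint representation\<close>

context lie_grp_ident
begin

definition AdB :: "'g \<Rightarrow> 'a \<Rightarrow>\<^sub>L 'a" where "AdB g = Blinfun (Ad G \<theta> g)"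

lemma AdB_apply: "g \<in> carrier G \<Longrightarrow> blinfun_apply (AdB g) x = Ad G \<theta> g x"
  unfolding AdB_def using finite_dim_linear_bounded[OF finite_dim linear_Ad] by (simp add: bounded_linear_Blinfun_apply)

lemma AdB_one: "AdB \<one> = id_blinfun"
  by (intro blinfun_eqI) (simp add: AdB_apply Ad_one)

lemma AdB_mult: "g \<in> carrier G \<Longrightarrow> h \<in> carrier G \<Longrightarrow> AdB (g \<otimes> h) = AdB g o\<^sub>L AdB h"
  by (intro blinfun_eqI) (simp add: AdB_apply Ad_mult)

lemma AdB_inv: "g \<in> carrier G \<Longrightarrow> AdB (inv g) o\<^sub>L AdB g = id_blinfun"
  by (simp add: AdB_one flip: AdB_mult)

definition ad :: "'a \<Rightarrow> 'a \<Rightarrow>\<^sub>L 'a" where "ad z = Blinfun (br z)"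

lemma ad_apply [simp]: "blinfun_apply (ad z) x = br z x"
proof -
  have "linear (br z)" using bilinear_br by (simp add: bilinear_def)
  then show ?thesis unfolding ad_def using finite_dim_linear_bounded[OF finite_dim, of "br z"] by (simp add: bounded_linear_Blinfun_apply)
qed

text \<open>From \<open>a h = (a h a\<^sup>-\<^sup>1) a\<close> one gets \<open>L a = R a \<circ> Ad a\<close>; differentiating at \<open>a = 1\<close> expresses the
  derivative of \<open>Ad\<close> by those of \<open>L\<close> and \<open>R\<close>, and hence by the bracket.\<close>

lemma Ad_estimate_pointwise:
  assumes e: "\<epsilon> > 0"
  shows "\<exists>d>0. \<forall>v\<in>E. norm v < d \<longrightarrow> inv0 (e0 + v) \<in> U0 \<and> \<phi>0 (inv0 (e0 + v)) = e0 + v \<and>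
     (\<forall>z. v = th z \<longrightarrow> norm (th (Ad G \<theta> (inv0 (e0 + v)) x) - th x - th (br z x)) \<le> \<epsilon> * norm v)"
proof -
  obtain L R lam Rd where
    L: "\<And>a. a \<in> U0 \<Longrightarrow> ((\<phi>0 \<circ> (\<lambda>h. a \<otimes> h) \<circ> inv0) has_derivative L (\<phi>0 a)) (at e0 within E)" and
    R: "\<And>a. a \<in> U0 \<Longrightarrow> ((\<phi>0 \<circ> (\<lambda>h. h \<otimes> a) \<circ> inv0) has_derivative R (\<phi>0 a)) (at e0 within E)" and
    lam: "\<And>w. w \<in> E \<Longrightarrow> ((\<lambda>\<alpha>. L \<alpha> w) has_derivative (\<lambda>v. lam v w)) (at e0 within E)" and
    Rd: "\<And>w. w \<in> E \<Longrightarrow> ((\<lambda>\<alpha>. R \<alpha> w) has_derivative Rd w) (at e0 within E)" and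
    sym: "\<And>v w. v \<in> E \<Longrightarrow> w \<in> E \<Longrightarrow> Rd w v = lam w v"
    using translation_derivatives by blast
  note bracket = th_bracket[OF L lam]
  obtain r where r: "r > 0" "\<And>v. v \<in> E \<Longrightarrow> norm v < r \<Longrightarrow> inv0 (e0 + v) \<in> U0 \<inter> U0 \<and> \<phi>0 (inv0 (e0 + v)) = e0 + v"
    using chart0_ball[OF openin_U0 chart0(2)] by blast
  \<comment> \<open>At the identity both translations are the identity map; uniqueness of
    derivatives yields this on \<open>E\<close>.\<close>
  have Re: "R e0 w = w" and Le: "L e0 w = w" if w: "w \<in> E" for w
  proof -
    have "((\<phi>0 \<circ> (\<lambda>h. \<one> \<otimes> h) \<circ> inv0) has_derivative (\<lambda>v. v)) (at e0 within E)"
      "((\<phi>0 \<circ> (\<lambda>h. h \<otimes> \<one>) \<circ> inv0) has_derivative (\<lambda>v. v)) (at e0 within E)"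
      by (rule has_derivative_chart0_cong[OF chart0_id_has_derivative], simp add: U0_carrier)+
    then show "R e0 w = w" "L e0 w = w"
      using has_derivative_within_subspace_unique[OF subspace_E e0_in_E w] L[OF chart0(2)] R[OF chart0(2)]
      unfolding e0_def by blast+
  qed
  obtain B C rr where cb: "coordinate_basis E B C rr" using finite_dim_coords[OF finite_dim_E] .
  interpret coordinate_basis E B C rr by fact
  \<comment> \<open>A Lipschitz bound for \<open>R\<close> at \<open>e0\<close> on a single vector;
    the finite basis then makes it the uniform estimate \<open>Rest\<close>.\<close>
  have "\<exists>K d. K > 0 \<and> d > 0 \<and> (\<forall>v\<in>E. norm v < d \<longrightarrow> norm (R (e0 + v) b - b) \<le> K * norm v)" if b: "b \<in> E" for b
  proof -
    interpret Rdb: bounded_linear "Rd b" using Rd[OF b] has_derivative_bounded_linear by blast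
    obtain K where K: "K > 0" "\<And>v. norm (Rd b v) \<le> norm v * K" using Rdb.pos_bounded by blast
    obtain d where d: "d > 0" "\<And>y. y \<in> E \<Longrightarrow> norm (y - e0) < d \<Longrightarrow> norm (R y b - R e0 b - Rd b (y - e0)) \<le> 1 * norm (y - e0)"
      using Rd[OF b] unfolding has_derivative_within_alt by (metis zero_less_one)
    have "norm (R (e0 + v) b - b) \<le> (1 + K) * norm v" if v: "v \<in> E" "norm v < d" for v
    proof -
      have "norm (R (e0 + v) b - b - Rd b v) \<le> norm v"
        using d(2)[of "e0 + v"] v e0_in_E subspace_E Re[OF b] by (simp add: subspace_add)
      from norm_add_le_add[OF _ this K(2)[of v], of "R (e0 + v) b - b"] show ?thesis by (simp add: algebra_simps)
    qed
    then show ?thesis using K d by (intro exI[of _ "1 + K"] exI[of _ d]) auto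
  qed
  then have "\<forall>b. \<exists>K d. b \<in> B \<longrightarrow> K > 0 \<and> d > 0 \<and> (\<forall>v\<in>E. norm v < d \<longrightarrow> norm (R (e0 + v) b - b) \<le> K * norm v)"
    using B_subset by blast
  then obtain Kb db where Kb: "\<And>b. b \<in> B \<Longrightarrow> Kb b > 0 \<and> db b > 0 \<and> (\<forall>v\<in>E. norm v < db b \<longrightarrow> norm (R (e0 + v) b - b) \<le> Kb b * norm v)"
    by metis
  define d0 where "d0 = Min (insert r (db ` B))"
  have d0: "d0 > 0" "d0 \<le> r" "\<And>b. b \<in> B \<Longrightarrow> d0 \<le> db b"
    using finite_B r(1) Kb by (auto simp: d0_def)
  define K where "K = C * (\<Sum>b\<in>B. Kb b) + 1"
  have K0: "K > 0" unfolding K_def using C_pos Kb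
    by (intro add_nonneg_pos mult_nonneg_nonneg sum_nonneg) (auto intro: less_imp_le)
  have Rest: "norm (R (e0 + v) u - u) \<le> K * norm v * norm u" if v: "v \<in> E" "norm v < d0" and u: "u \<in> E" for u v
  proof -
    have a: "inv0 (e0 + v) \<in> U0" "\<phi>0 (inv0 (e0 + v)) = e0 + v" using r(2)[OF v(1)] v(2) d0(2) by auto
    interpret Rv: bounded_linear "R (e0 + v)" using R[OF a(1)] a(2) has_derivative_bounded_linear by force
    have Ru: "R (e0 + v) u = (\<Sum>b\<in>B. rr b u *\<^sub>R R (e0 + v) b)"
      using arg_cong[OF expand[OF u], of "R (e0 + v)"] by (simp add: Rv.sum Rv.scale)
    have "R (e0 + v) u - u = (\<Sum>b\<in>B. rr b u *\<^sub>R R (e0 + v) b) - (\<Sum>b\<in>B. rr b u *\<^sub>R b)"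
      unfolding expand[OF u] Ru ..
    also have "\<dots> = (\<Sum>b\<in>B. rr b u *\<^sub>R (R (e0 + v) b - b))"
      by (simp add: scaleR_right_diff_distrib sum_subtractf)
    finally have "norm (R (e0 + v) u - u) \<le> (\<Sum>b\<in>B. \<bar>rr b u\<bar> * norm (R (e0 + v) b - b))"
      by (simp add: sum_norm_le)
    also have "\<dots> \<le> (\<Sum>b\<in>B. (C * norm u) * (Kb b * norm v))"
    proof (intro sum_mono mult_mono)
      fix b assume b: "b \<in> B"
      then have "norm v < db b" using v(2) d0(3)[OF b] by simp
      then show "norm (R (e0 + v) b - b) \<le> Kb b * norm v" using Kb[OF b] v(1) by blast
    qed (use coord_le[OF u] C_pos in auto)
    also have "\<dots> = C * (\<Sum>b\<in>B. Kb b) * (norm v * norm u)" by (simp add: sum_distrib_left sum_distrib_right mult_ac)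
    also have "\<dots> \<le> K * (norm v * norm u)" by (intro mult_right_mono) (auto simp: K_def)
    finally show ?thesis by (simp add: mult.assoc)
  qed
  define w where "w = th x"
  have w: "w \<in> E" by (simp add: w_def th_in_E)
  define \<Delta> where "\<Delta> \<alpha> = L \<alpha> w - R \<alpha> w" for \<alpha>
  define \<Delta>' where "\<Delta>' v = lam v w - Rd w v" for v
  have \<Delta>: "(\<Delta> has_derivative \<Delta>') (at e0 within E)"
    unfolding \<Delta>_def[abs_def] \<Delta>'_def[abs_def] by (rule has_derivative_diff[OF lam[OF w] Rd[OF w]])
  interpret \<Delta>': bounded_linear \<Delta>' using \<Delta> has_derivative_bounded_linear by blast
  obtain K2 where K2: "K2 > 0" "\<And>v. norm (\<Delta>' v) \<le> norm v * K2" using \<Delta>'.pos_bounded by blast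
  have \<Delta>0: "\<Delta> e0 = 0" using Le[OF w] Re[OF w] by (simp add: \<Delta>_def)
  define \<epsilon>1 where "\<epsilon>1 = min 1 (\<epsilon> / 2)"
  have \<epsilon>1: "\<epsilon>1 > 0" "\<epsilon>1 \<le> 1" "\<epsilon>1 \<le> \<epsilon> / 2" using e by (auto simp: \<epsilon>1_def)
  obtain d1 where d1: "d1 > 0" "\<And>y. y \<in> E \<Longrightarrow> norm (y - e0) < d1 \<Longrightarrow> norm (\<Delta> y - \<Delta> e0 - \<Delta>' (y - e0)) \<le> \<epsilon>1 * norm (y - e0)"
    using \<Delta> \<epsilon>1(1) unfolding has_derivative_within_alt by metis
  \<comment> \<open>The first bound gives \<open>K * norm v \<le> 1/2\<close>, so that
    \<open>u - w\<close> can be absorbed; the second makes the quadratic remainder at most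
    \<open>\<epsilon> / 2 * norm v\<close>.\<close>
  define d2 where "d2 = min (1 / (2 * K)) (\<epsilon> / (4 * K * (1 + K2)))"
  have d2: "d2 > 0" using K0 K2 e by (simp add: d2_def)
  show ?thesis
  proof (intro exI[of _ "min d0 (min d1 d2)"] conjI ballI impI allI)
    show "min d0 (min d1 d2) > 0" using d0 d1 d2 by simp
    fix v assume v: "v \<in> E" "norm v < min d0 (min d1 d2)"
    then have vd: "norm v < d0" "norm v < d1" "norm v < d2" by auto
    show a: "inv0 (e0 + v) \<in> U0" and ea: "\<phi>0 (inv0 (e0 + v)) = e0 + v" using r(2)[OF v(1)] vd(1) d0(2) by auto
    fix z assume z: "v = th z"
    let ?a = "inv0 (e0 + v)"
    have ac: "?a \<in> carrier G" using a U0_carrier by blast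
    obtain D where D: "((\<phi>0 \<circ> cj ?a \<circ> inv0) has_derivative D) (at e0 within E)" using cj_has_derivative[OF ac] .
    define u where "u = th (Ad G \<theta> ?a x)"
    have uE: "u \<in> E" by (simp add: u_def th_in_E)
    have uD: "u = D w" by (simp add: u_def w_def th_Ad[OF ac D])
    have "((\<phi>0 \<circ> (\<lambda>h. h \<otimes> ?a) \<circ> cj ?a \<circ> inv_into U0 \<phi>0) has_derivative (\<lambda>v'. R (e0 + v) (D v'))) (at (\<phi>0 \<one>) within E)"
      by (rule chart_compose_has_derivative[where h = "\<phi>0 \<circ> (\<lambda>h. h \<otimes> ?a)" and f = "cj ?a" and D = D and T = "R (e0 + v)",
          OF top_atlas chart0(1,2) top_atlas chart0(1) cj_open[OF ac]])
        (use D R[OF a] ea ac chart0 in \<open>auto simp: inv0_def e0_def\<close>)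
    then have "((\<phi>0 \<circ> (\<lambda>h. h \<otimes> ?a) \<circ> cj ?a \<circ> inv0) has_derivative (\<lambda>v'. R (e0 + v) (D v'))) (at e0 within E)"
      by (simp only: e0_def inv0_def)
    then have "((\<phi>0 \<circ> (\<lambda>h. ?a \<otimes> h) \<circ> inv0) has_derivative (\<lambda>v'. R (e0 + v) (D v'))) (at e0 within E)"
      by (rule has_derivative_chart0_cong) (use ac in \<open>simp add: U0_carrier cj_def m_assoc\<close>)
    from has_derivative_within_subspace_unique[OF subspace_E e0_in_E w this L[OF a]]
    have RL: "R (e0 + v) u = L (e0 + v) w" by (simp add: ea uD)
    interpret Rv: bounded_linear "R (e0 + v)" using R[OF a] ea has_derivative_bounded_linear by force
    have uwE: "u - w \<in> E" using uE w subspace_E by (simp add: subspace_diff)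
    \<comment> \<open>This is \<open>RL\<close> rewritten: up to the error
      \<open>R (e0 + v) (u - w) - (u - w)\<close>, the change of \<open>Ad\<close> is
      \<open>\<Delta>\<close>, which is differentiable at \<open>e0\<close>.\<close>
    have eq: "u - w = \<Delta> (e0 + v) - (R (e0 + v) (u - w) - (u - w))"
      by (simp add: \<Delta>_def Rv.diff RL)
    have R1: "norm (R (e0 + v) (u - w) - (u - w)) \<le> K * norm v * norm (u - w)" by (rule Rest[OF v(1) vd(1) uwE])
    have Kv: "K * norm v \<le> 1/2" using vd(3) K0 by (simp add: d2_def field_simps)
    have D1: "norm (\<Delta> (e0 + v) - \<Delta>' v) \<le> \<epsilon>1 * norm v"
      using d1(2)[of "e0 + v"] v(1) vd(2) e0_in_E subspace_E \<Delta>0 by (simp add: subspace_add)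
    have "norm (\<Delta> (e0 + v)) \<le> \<epsilon>1 * norm v + norm v * K2"
      by (rule norm_add_le_add[OF _ D1 K2(2)]) simp
    also have "\<dots> \<le> 1 * norm v + norm v * K2" using \<epsilon>1 by (intro add_right_mono mult_right_mono) auto
    finally have D2: "norm (\<Delta> (e0 + v)) \<le> (1 + K2) * norm v" by (simp add: algebra_simps)
    \<comment> \<open>An a priori bound of order \<open>norm v\<close>, since \<open>u - w\<close>
      occurs in its own error term.\<close>
    have "norm (u - w) \<le> (1 + K2) * norm v + K * norm v * norm (u - w)"
      by (rule norm_diff_le_add[OF eq D2 R1])
    also have "\<dots> \<le> (1 + K2) * norm v + 1/2 * norm (u - w)" using Kv by (intro add_left_mono mult_right_mono) auto
    finally have "norm (u - w) \<le> 2 * ((1 + K2) * norm v)" by linarith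
    then have uw: "norm (u - w) \<le> 2 * (1 + K2) * norm v" by (simp only: mult.assoc)
    have "u - w - \<Delta>' v = (\<Delta> (e0 + v) - \<Delta>' v) - (R (e0 + v) (u - w) - (u - w))" using eq by simp
    from norm_diff_le_add[OF this D1 R1]
    have "norm (u - w - \<Delta>' v) \<le> \<epsilon>1 * norm v + K * norm v * norm (u - w)" .
    also have "\<dots> \<le> \<epsilon> / 2 * norm v + K * norm v * (2 * (1 + K2) * norm v)"
      using \<epsilon>1 uw K0 by (intro add_mono mult_right_mono mult_left_mono) auto
    also have "\<dots> = \<epsilon> / 2 * norm v + (2 * K * (1 + K2) * norm v) * norm v" by (simp add: algebra_simps)
    also have "\<dots> \<le> \<epsilon> / 2 * norm v + \<epsilon> / 2 * norm v"
    proof (intro add_left_mono mult_right_mono)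
      have "norm v \<le> \<epsilon> / (4 * K * (1 + K2))" using vd(3) by (simp add: d2_def)
      moreover have "0 < 4 * K * (1 + K2)" using K0 K2(1) by simp
      ultimately have "norm v * (4 * K * (1 + K2)) \<le> \<epsilon>" by (simp add: pos_le_divide_eq)
      then show "2 * K * (1 + K2) * norm v \<le> \<epsilon> / 2" by (simp add: algebra_simps)
    qed simp
    finally have "norm (u - w - \<Delta>' v) \<le> \<epsilon> * norm v" by simp
    \<comment> \<open>By the symmetry of the mixed derivatives, \<open>\<Delta>' v\<close> is
      \<open>lam v w - lam w v\<close>, which is the bracket.\<close>
    moreover have "\<Delta>' v = th (br z x)"
      using bracket[of z x] sym[OF v(1) w] by (simp add: \<Delta>'_def z w_def)
    ultimately show "norm (th (Ad G \<theta> ?a x) - th x - th (br z x)) \<le> \<epsilon> * norm v"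
      by (simp add: u_def w_def)
  qed
qed

text \<open>The pointwise estimate on a basis becomes an operator estimate;
  \<open>\<epsilon>1\<close> compensates for the constants of the basis and of
  \<open>th\<close>.\<close>

lemma AdB_estimate:
  assumes e: "\<epsilon> > 0"
  shows "\<exists>d>0. \<forall>z. norm (th z) < d \<longrightarrow> inv0 (e0 + th z) \<in> U0 \<and> \<phi>0 (inv0 (e0 + th z)) = e0 + th z \<and>
     norm (AdB (inv0 (e0 + th z)) - id_blinfun - ad z) \<le> \<epsilon> * norm z"
proof -
  obtain c C where c: "c > 0" "C > 0" "\<And>x. c * norm x \<le> norm (th x)" "\<And>x. norm (th x) \<le> C * norm x"
    using th_bounds by blast
  obtain B K where B: "finite B" "K > 0"
    "\<And>(T :: 'a \<Rightarrow>\<^sub>L 'a) e. e \<ge> 0 \<Longrightarrow> (\<And>b. b \<in> B \<Longrightarrow> norm (blinfun_apply T b) \<le> e) \<Longrightarrow> norm T \<le> K * e"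
    using blinfun_norm_le_basis[OF finite_dim] by blast
  define \<epsilon>1 where "\<epsilon>1 = \<epsilon> * c / (K * C)"
  have \<epsilon>1: "\<epsilon>1 > 0" using e c B by (simp add: \<epsilon>1_def)
  have "\<forall>b. \<exists>d>0. \<forall>v\<in>E. norm v < d \<longrightarrow> inv0 (e0 + v) \<in> U0 \<and> \<phi>0 (inv0 (e0 + v)) = e0 + v \<and>
     (\<forall>z. v = th z \<longrightarrow> norm (th (Ad G \<theta> (inv0 (e0 + v)) b) - th b - th (br z b)) \<le> \<epsilon>1 * norm v)"
    using Ad_estimate_pointwise[OF \<epsilon>1] by blast
  then obtain d where d: "\<And>b. d b > 0" "\<And>b v. v \<in> E \<Longrightarrow> norm v < d b \<Longrightarrow> inv0 (e0 + v) \<in> U0 \<and> \<phi>0 (inv0 (e0 + v)) = e0 + v \<and>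
     (\<forall>z. v = th z \<longrightarrow> norm (th (Ad G \<theta> (inv0 (e0 + v)) b) - th b - th (br z b)) \<le> \<epsilon>1 * norm v)" by metis
  \<comment> \<open>Including \<open>d 0\<close> secures the claims about the chart also when the
    basis is empty.\<close>
  define d0 where "d0 = Min (insert (d 0) (d ` B))"
  have d0: "d0 > 0" "d0 \<le> d 0" "\<And>b. b \<in> B \<Longrightarrow> d0 \<le> d b" using B(1) d(1) by (auto simp: d0_def)
  show ?thesis
  proof (intro exI[of _ d0] conjI allI impI d0(1))
    fix z assume z: "norm (th z) < d0"
    show a: "inv0 (e0 + th z) \<in> U0" and "\<phi>0 (inv0 (e0 + th z)) = e0 + th z"
      using d(2)[OF th_in_E, of z 0] z d0(2) by auto
    let ?a = "inv0 (e0 + th z)"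
    have ac: "?a \<in> carrier G" using a U0_carrier by blast
    have "norm (AdB ?a - id_blinfun - ad z) \<le> K * (\<epsilon>1 * norm (th z) / c)"
    proof (rule B(3))
      fix b assume b: "b \<in> B"
      let ?y = "Ad G \<theta> ?a b - b - br z b"
      have "c * norm ?y \<le> norm (th ?y)" by (rule c(3))
      also have "th ?y = th (Ad G \<theta> ?a b) - th b - th (br z b)" by (simp add: linear_diff[OF linear_th])
      also have "norm \<dots> \<le> \<epsilon>1 * norm (th z)" using d(2)[OF th_in_E, of z b] z d0(3)[OF b] by auto
      finally show "norm (blinfun_apply (AdB ?a - id_blinfun - ad z) b) \<le> \<epsilon>1 * norm (th z) / c"
        using c(1) AdB_apply[OF ac] by (simp add: blinfun.diff_left blinfun.add_left diff_diff_add field_simps)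
    qed (use \<epsilon>1 c in auto)
    also have "\<dots> \<le> K * (\<epsilon>1 * (C * norm z) / c)"
      using B(2) \<epsilon>1 c by (intro mult_left_mono divide_right_mono) auto
    also have "\<dots> = \<epsilon> * norm z" using B(2) c by (simp add: \<epsilon>1_def)
    finally show "norm (AdB ?a - id_blinfun - ad z) \<le> \<epsilon> * norm z" .
  qed
qed

lemma linear_ad: "linear ad"
  using bilinear_br by (intro linearI blinfun_eqI)
    (simp_all add: bilinear_ladd bilinear_lmul blinfun.add_left blinfun.scaleR_left)

lemma norm_ad_bound: obtains C where "C > 0" "\<And>z. norm (ad z) \<le> C * norm z"
  using finite_dim_linear_bound[OF finite_dim, of ad] linear_add[OF linear_ad] linear_scale[OF linear_ad] that by auto

lemma AdB_near_one:
  assumes e: "\<epsilon> > 0"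
  obtains W where "openin (lie_topology G) W" "\<one> \<in> W" "\<And>a. a \<in> W \<Longrightarrow> norm (AdB a - id_blinfun) < \<epsilon>"
proof -
  obtain c C where c: "c > 0" "C > 0" "\<And>x. c * norm x \<le> norm (th x)" "\<And>x. norm (th x) \<le> C * norm x"
    using th_bounds by blast
  obtain A where A: "A > 0" "\<And>z. norm (ad z) \<le> A * norm z" using norm_ad_bound by blast
  obtain d where d: "d > 0" "\<And>z. norm (th z) < d \<Longrightarrow> norm (AdB (inv0 (e0 + th z)) - id_blinfun - ad z) \<le> 1 * norm z"
    using AdB_estimate[of 1] by auto
  \<comment> \<open>The first-order estimate gives
    \<open>norm (AdB a - id_blinfun) \<le> (1 + A) * norm z\<close>, and
    \<open>norm z \<le> norm (th z) / c\<close>; hence this radius.\<close>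
  define q where "q = min d (c * \<epsilon> / (1 + A))"
  have q: "q > 0" using d c e A by (simp add: q_def)
  show thesis
  proof (rule that[of "U0 \<inter> \<phi>0 -` ball e0 q"])
    show "openin (lie_topology G) (U0 \<inter> \<phi>0 -` ball e0 q)"
      using openin_manifold_topology_chart[OF chart0(1)] by simp
    show "\<one> \<in> U0 \<inter> \<phi>0 -` ball e0 q" using chart0 q by (simp add: e0_def)
    fix a assume a: "a \<in> U0 \<inter> \<phi>0 -` ball e0 q"
    then obtain z where z: "th z = \<phi>0 a - e0"
      using th_surj[of "\<phi>0 a - e0"] \<phi>0_in_E e0_in_E subspace_E by (auto simp: subspace_diff)
    then have aeq: "inv0 (e0 + th z) = a" using a by simp
    have nz: "norm (th z) < q" using a by (simp add: z dist_norm norm_minus_commute)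
    then have "norm (AdB a - id_blinfun - ad z) \<le> 1 * norm z" using d(2)[of z] by (simp add: aeq q_def)
    from norm_add_le_add[OF _ this A(2)[of z], of "AdB a - id_blinfun"]
    have "norm (AdB a - id_blinfun) \<le> (1 + A) * norm z" by (simp add: algebra_simps)
    also have "\<dots> \<le> (1 + A) * (norm (th z) / c)"
      using A c(1) c(3)[of z] by (intro mult_left_mono) (auto simp: field_simps)
    also have "\<dots> < (1 + A) * (q / c)" using nz A c by (intro mult_strict_left_mono divide_strict_right_mono) auto
    also have "\<dots> \<le> (1 + A) * ((c * \<epsilon> / (1 + A)) / c)"
      using A c by (intro mult_left_mono divide_right_mono) (auto simp: q_def)
    also have "\<dots> = \<epsilon>" using A c by simp
    finally show "norm (AdB a - id_blinfun) < \<epsilon>" .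
  qed
qed

text \<open>\<open>Ad\<close> is a homomorphism, so AdB h - AdB g = AdB g (AdB (g^-1 h) - 1) reduces
  continuity at g to continuity at the identity.\<close>

lemma AdB_continuous: "continuous_map (lie_topology G) euclidean AdB"
  unfolding continuous_map
proof (intro conjI allI impI)
  fix O' :: "('a \<Rightarrow>\<^sub>L 'a) set" assume "openin euclidean O'"
  then have O: "open O'" by simp
  show "openin (lie_topology G) {x \<in> topspace (lie_topology G). AdB x \<in> O'}"
  proof (subst openin_subopen, rule ballI)
    fix g assume "g \<in> {x \<in> topspace (lie_topology G). AdB x \<in> O'}"
    then have g: "g \<in> carrier G" "AdB g \<in> O'" by (auto simp: topspace)
    then obtain \<epsilon> where \<epsilon>: "\<epsilon> > 0" "\<And>y. dist y (AdB g) < \<epsilon> \<Longrightarrow> y \<in> O'" using O unfolding open_dist by blast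
    define n where "n = norm (AdB g) + 1"
    have n: "n > 0" unfolding n_def by (intro add_nonneg_pos) auto
    obtain W where W: "openin (lie_topology G) W" "\<one> \<in> W" "\<And>a. a \<in> W \<Longrightarrow> norm (AdB a - id_blinfun) < \<epsilon> / n"
      using AdB_near_one[of "\<epsilon> / n"] \<epsilon> n by auto
    let ?T = "{h \<in> carrier G. inv g \<otimes> h \<in> W}"
    have "openin (lie_topology G) ?T" by (rule preimage_open[OF left_mult_continuous[OF inv_closed[OF g(1)]] W(1)])
    moreover have "g \<in> ?T" using g W by simp
    moreover have "?T \<subseteq> {x \<in> topspace (lie_topology G). AdB x \<in> O'}"
    proof
      fix h assume h: "h \<in> ?T"
      let ?b = "inv g \<otimes> h"
      have "AdB (g \<otimes> ?b) = AdB g o\<^sub>L AdB ?b" using g h by (intro AdB_mult) auto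
      moreover have "g \<otimes> ?b = h" using g h by (simp add: inv_solve_left' flip: m_assoc)
      ultimately have "AdB h - AdB g = AdB g o\<^sub>L (AdB ?b - id_blinfun)"
        by (intro blinfun_eqI) (simp add: blinfun.diff_left blinfun.diff_right)
      then have "norm (AdB h - AdB g) \<le> norm (AdB g) * norm (AdB ?b - id_blinfun)"
        by (simp add: norm_blinfun_compose)
      also have "\<dots> \<le> n * norm (AdB ?b - id_blinfun)" by (intro mult_right_mono) (auto simp: n_def)
      also have "\<dots> < n * (\<epsilon> / n)" using W(3)[of ?b] h n by (intro mult_strict_left_mono) auto
      finally have "dist (AdB h) (AdB g) < \<epsilon>" using n by (simp add: dist_norm)
      then show "h \<in> {x \<in> topspace (lie_topology G). AdB x \<in> O'}" using \<epsilon>(2) h by (simp add: topspace)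
    qed
    ultimately show "\<exists>T. openin (lie_topology G) T \<and> g \<in> T \<and> T \<subseteq> {x \<in> topspace (lie_topology G). AdB x \<in> O'}" by blast
  qed
qed simp

end

section \<open>Subdividing and generating a connected Lie group\<close>

text \<open>Evaluation in one chart of \<open>N\<close>, without compatibility between its charts;
  it thus applies to \<open>GL\<close> through its single chart.\<close>

lemma differential_chart:
  fixes M :: "('p, 'e::real_normed_vector) manifold" and N :: "('q, 'f::real_normed_vector) manifold"
  assumes E: "subspace (model M)" "\<phi> p \<in> model M" and c: "some_chart M p = (U, \<phi>)"
    and d: "(V, \<psi>) \<in> atlas N" "f p \<in> V"
    and D: "((\<psi> \<circ> f \<circ> inv_into U \<phi>) has_derivative D) (at (\<phi> p) within model M)"
    and v: "v (U, \<phi>) \<in> model M"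
  shows "differential M N f p v (V, \<psi>) = D (v (U, \<phi>))"
  using d frechet_derivative_within_subspace[OF E v D] c[unfolded some_chart_def]
  by (simp add: differential_def)

lemma blinfun_compose_id: "f o\<^sub>L id_blinfun = f" "id_blinfun o\<^sub>L f = f"
  by (auto intro: blinfun_eqI)

lemma blinfun_compose_assoc: "(f o\<^sub>L g) o\<^sub>L h = f o\<^sub>L (g o\<^sub>L h)"
  by (auto intro: blinfun_eqI)

text \<open>The products \<open>P\<close> and \<open>\<Gamma>\<close> are compared through
  \<open>P j o\<^sub>L \<Gamma>' j\<close>, where \<open>\<Gamma>'\<close> are inverses of
  \<open>\<Gamma>\<close>. Consecutive terms differ by
  \<open>P j o\<^sub>L (f j - g j) o\<^sub>L \<Gamma>' (Suc j)\<close>, so n factors with error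
  o(1/n) each cost only o(1).\<close>

lemma product_telescope:
  fixes P \<Gamma> \<Gamma>' f g :: "nat \<Rightarrow> 'a::real_normed_vector \<Rightarrow>\<^sub>L 'a"
  assumes "P 0 = id_blinfun" "\<Gamma>' 0 = id_blinfun"
    and P: "\<And>j. j < n \<Longrightarrow> P (Suc j) = P j o\<^sub>L f j"
    and \<Gamma>: "\<And>j. j < n \<Longrightarrow> \<Gamma> (Suc j) = \<Gamma> j o\<^sub>L g j"
    and inv: "\<And>j. j \<le> n \<Longrightarrow> \<Gamma> j o\<^sub>L \<Gamma>' j = id_blinfun" "\<And>j. j \<le> n \<Longrightarrow> \<Gamma>' j o\<^sub>L \<Gamma> j = id_blinfun"
    and M: "\<And>j. j \<le> n \<Longrightarrow> norm (P j) \<le> M" "\<And>j. j \<le> n \<Longrightarrow> norm (\<Gamma>' j) \<le> M'"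
    and \<delta>: "\<And>j. j < n \<Longrightarrow> norm (f j - g j) \<le> \<delta>"
  shows "norm ((P n o\<^sub>L \<Gamma>' n) - id_blinfun) \<le> real n * (M * \<delta> * M')"
proof -
  have M0: "M \<ge> 0" "M' \<ge> 0" using M[of 0] norm_ge_zero order_trans by blast+
  have "m \<le> n \<Longrightarrow> norm ((P m o\<^sub>L \<Gamma>' m) - id_blinfun) \<le> real m * (M * \<delta> * M')" for m
  proof (induction m)
    case 0
    then show ?case using assms(1,2) by (simp add: blinfun_compose_id)
  next
    case (Suc m)
    then have m: "m < n" by simp
    have "\<Gamma>' m = \<Gamma>' m o\<^sub>L (\<Gamma> (Suc m) o\<^sub>L \<Gamma>' (Suc m))" using inv(1)[OF Suc.prems] by (simp add: blinfun_compose_id)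
    also have "\<dots> = (\<Gamma>' m o\<^sub>L \<Gamma> m) o\<^sub>L (g m o\<^sub>L \<Gamma>' (Suc m))"
      by (simp add: \<Gamma>[OF m] blinfun_compose_assoc)
    also have "\<dots> = g m o\<^sub>L \<Gamma>' (Suc m)" using inv(2)[of m] m by (simp add: blinfun_compose_id)
    finally have gm: "\<Gamma>' m = g m o\<^sub>L \<Gamma>' (Suc m)" .
    have "(P (Suc m) o\<^sub>L \<Gamma>' (Suc m)) - (P m o\<^sub>L \<Gamma>' m) = P m o\<^sub>L ((f m - g m) o\<^sub>L \<Gamma>' (Suc m))"
      unfolding P[OF m] gm by (intro blinfun_eqI) (simp add: blinfun.diff_left blinfun.diff_right)
    then have "norm ((P (Suc m) o\<^sub>L \<Gamma>' (Suc m)) - (P m o\<^sub>L \<Gamma>' m)) \<le> norm (P m) * norm ((f m - g m) o\<^sub>L \<Gamma>' (Suc m))"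
      by (simp add: norm_blinfun_compose)
    also have "\<dots> \<le> M * (\<delta> * M')"
      using M(1)[of m] M(2)[OF Suc.prems] \<delta>[OF m] m M0
      by (intro mult_mono order_trans[OF norm_blinfun_compose]) (auto intro: order_trans[OF norm_ge_zero])
    finally have "norm ((P (Suc m) o\<^sub>L \<Gamma>' (Suc m)) - (P m o\<^sub>L \<Gamma>' m)) \<le> M * \<delta> * M'" by (simp add: mult.assoc)
    from norm_add_le_add[OF _ this Suc.IH[OF less_imp_le[OF m]], of "(P (Suc m) o\<^sub>L \<Gamma>' (Suc m)) - id_blinfun"]
    show ?case by (simp add: algebra_simps)
  qed
  then show ?thesis by simp
qed

section \<open>Centred coordinates, subdivision and generation of a Lie group\<close>

context lie_grp
begin

text \<open>The inverse chart recentred so that 0 goes to the identity. Lines through 0 need not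
  become one-parameter subgroups, so the increments along such a line are computed in
  \<open>subdivision\<close>.\<close>

definition \<kappa> :: "'e \<Rightarrow> 'g" where "\<kappa> w = inv0 (e0 + w)"

lemma \<kappa>_0 [simp]: "\<kappa> 0 = \<one>"
  using inv0[OF chart0(2)] by (simp add: \<kappa>_def e0_def)

lemma \<kappa>_\<phi>0: "g \<in> U0 \<Longrightarrow> \<kappa> (\<phi>0 g - e0) = g"
  by (simp add: \<kappa>_def)

lemma \<kappa>_ball:
  assumes W: "openin (lie_topology G) W" "\<one> \<in> W"
  obtains r where "r > 0" "\<forall>v\<in>E. norm v < r \<longrightarrow> \<kappa> v \<in> U0 \<and> \<kappa> v \<in> W \<and> \<phi>0 (\<kappa> v) = e0 + v"
proof (rule chart0_ball[OF W])
  fix r :: real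
  assume "r > 0" and r: "\<And>v. v \<in> E \<Longrightarrow> norm v < r \<Longrightarrow> inv0 (e0 + v) \<in> U0 \<inter> W \<and> \<phi>0 (inv0 (e0 + v)) = e0 + v"
  then show thesis using that[of r] unfolding \<kappa>_def by simp
qed

text \<open>Only the second factor varies: with \<open>u' = 0\<close> this bounds how far
  multiplication by \<open>\<kappa> u\<close> moves a coordinate.\<close>

lemma mult_local_lipschitz:
  obtains r C where "r > 0" "C > 0"
    "\<forall>w\<in>E. norm w < r \<longrightarrow> \<kappa> w \<in> U0 \<and> \<phi>0 (\<kappa> w) = e0 + w"
    "\<forall>w\<in>E. \<forall>u\<in>E. norm w < r \<longrightarrow> norm u < r \<longrightarrow> \<kappa> w \<otimes> \<kappa> u \<in> U0"
    "\<forall>w\<in>E. \<forall>u\<in>E. \<forall>u'\<in>E. norm w < r \<longrightarrow> norm u < r \<longrightarrow> norm u' < r \<longrightarrow>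
       norm (\<phi>0 (\<kappa> w \<otimes> \<kappa> u) - \<phi>0 (\<kappa> w \<otimes> \<kappa> u')) \<le> C * norm (u - u')"
proof -
  let ?c = "(U0, \<phi>0)"
  have Ck: "Ck (Suc 0) (E \<times> E) (mul_dom ?c ?c ?c) (mul_rep ?c ?c ?c)"
    using mul_rep_smooth[OF chart0(1) chart0(1) chart0(1)] unfolding smooth_on_def by blast
  have "(\<one>, \<one>) \<in> (U0 \<times> U0) \<inter> mul -` U0" using chart0 by simp
  then have "map_prod \<phi>0 \<phi>0 (\<one>, \<one>) \<in> mul_dom ?c ?c ?c" unfolding mul_dom_def fst_conv snd_conv by blast
  then have p: "(e0, e0) \<in> mul_dom ?c ?c ?c" by (simp add: e0_def)
  obtain r C where r: "r > 0" "C > 0" "ball (e0, e0) r \<inter> (E \<times> E) \<subseteq> mul_dom ?c ?c ?c"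
    "\<And>x y. x \<in> ball (e0, e0) r \<inter> (E \<times> E) \<Longrightarrow> y \<in> ball (e0, e0) r \<inter> (E \<times> E) \<Longrightarrow>
      norm (mul_rep ?c ?c ?c x - mul_rep ?c ?c ?c y) \<le> C * norm (x - y)"
    using C1_locally_lipschitz[OF finite_dim_subspace_Times[OF finite_dim_E finite_dim_E] mul_dom_open[OF chart0(1) chart0(1) chart0(1)] p Ck] by blast
  obtain r1 where r10: "r1 > 0" "\<forall>v\<in>E. norm v < r1 \<longrightarrow> \<kappa> v \<in> U0 \<and> \<kappa> v \<in> U0 \<and> \<phi>0 (\<kappa> v) = e0 + v"
    using \<kappa>_ball[OF openin_U0 chart0(2)] .
  then have r1: "r1 > 0" "\<And>v. v \<in> E \<Longrightarrow> norm v < r1 \<Longrightarrow> \<kappa> v \<in> U0" "\<And>v. v \<in> E \<Longrightarrow> norm v < r1 \<Longrightarrow> \<phi>0 (\<kappa> v) = e0 + v"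
    by auto
  \<comment> \<open>Half of r, since the norm of a pair is at most the sum of the norms.\<close>
  define q where "q = min r1 (r / 2)"
  have q: "q > 0" "q \<le> r1" "q \<le> r / 2" using r r1 by (auto simp: q_def)
  have inb: "(e0 + w, e0 + u) \<in> ball (e0, e0) r \<inter> (E \<times> E)" if "w \<in> E" "norm w < q" "u \<in> E" "norm u < q" for w u
  proof -
    have "norm (w, u) \<le> norm w + norm u" by (rule norm_Pair_le)
    also have "\<dots> < r" using that q by linarith
    finally have "norm (w, u) < r" .
    moreover have "dist (e0, e0) (e0 + w, e0 + u) = norm (w, u)" by (simp add: dist_norm norm_Pair)
    ultimately show ?thesis using that e0_in_E subspace_E by (simp add: subspace_add)
  qed
  have rep: "mul_rep ?c ?c ?c (e0 + w, e0 + u) = \<phi>0 (\<kappa> w \<otimes> \<kappa> u)" if "w \<in> E" "norm w < q" "u \<in> E" "norm u < q" for w u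
    using mul_rep_eq[OF chart0(1) chart0(1) r1(2)[of w] r1(2)[of u], of U0 \<phi>0] that q r1(3)[of w] r1(3)[of u] by simp
  show thesis
  proof (rule that[OF q(1) r(2)]; intro ballI impI)
    show "\<kappa> w \<otimes> \<kappa> u \<in> U0" if w: "w \<in> E" and u: "u \<in> E" and wq: "norm w < q" and uq: "norm u < q" for w u
    proof -
      have "(e0 + w, e0 + u) \<in> mul_dom ?c ?c ?c" using inb[OF w wq u uq] r(3) by blast
      then obtain x y where xy: "x \<in> U0" "y \<in> U0" "x \<otimes> y \<in> U0" "e0 + w = \<phi>0 x" "e0 + u = \<phi>0 y"
        by (auto simp: mul_dom_def)
      then have "\<kappa> w = x" "\<kappa> u = y" by (simp_all add: \<kappa>_def)
      then show ?thesis using xy by simp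
    qed
    show "norm (\<phi>0 (\<kappa> w \<otimes> \<kappa> u) - \<phi>0 (\<kappa> w \<otimes> \<kappa> u')) \<le> C * norm (u - u')"
      if "w \<in> E" "u \<in> E" "u' \<in> E" "norm w < q" "norm u < q" "norm u' < q" for w u u'
      using r(4)[OF inb inb, of w u w u'] that by (simp add: rep norm_Pair)
  qed (use r1 q in auto)
qed

text \<open>In \<open>mult_local_lipschitz\<close> the coordinate of \<open>inv (\<kappa> v)\<close>
  is taken as first factor, and \<open>\<kappa> v'\<close> is compared with
  \<open>\<kappa> v\<close>, for which the product is the identity.\<close>

lemma inv_mult_local_lipschitz:
  obtains r C where "r > 0" "C > 0"
    "\<forall>w\<in>E. norm w < r \<longrightarrow> \<kappa> w \<in> U0"
    "\<forall>v\<in>E. \<forall>v'\<in>E. norm v < r \<longrightarrow> norm v' < r \<longrightarrow> inv (\<kappa> v) \<otimes> \<kappa> v' \<in> U0"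
    "\<forall>v\<in>E. \<forall>v'\<in>E. norm v < r \<longrightarrow> norm v' < r \<longrightarrow> norm (\<phi>0 (inv (\<kappa> v) \<otimes> \<kappa> v') - e0) \<le> C * norm (v' - v)"
proof -
  obtain r C where r: "r > 0" "C > 0"
    "\<forall>w\<in>E. norm w < r \<longrightarrow> \<kappa> w \<in> U0 \<and> \<phi>0 (\<kappa> w) = e0 + w"
    "\<forall>w\<in>E. \<forall>u\<in>E. norm w < r \<longrightarrow> norm u < r \<longrightarrow> \<kappa> w \<otimes> \<kappa> u \<in> U0"
    "\<forall>w\<in>E. \<forall>u\<in>E. \<forall>u'\<in>E. norm w < r \<longrightarrow> norm u < r \<longrightarrow> norm u' < r \<longrightarrow>
       norm (\<phi>0 (\<kappa> w \<otimes> \<kappa> u) - \<phi>0 (\<kappa> w \<otimes> \<kappa> u')) \<le> C * norm (u - u')"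
    using mult_local_lipschitz .
  let ?W = "{h \<in> carrier G. inv h \<in> U0 \<inter> \<phi>0 -` ball e0 r}"
  have W: "openin (lie_topology G) ?W"
    using preimage_open[OF inv_continuous openin_manifold_topology_chart[OF chart0(1)]] by blast
  have W1: "\<one> \<in> ?W" using chart0 r(1) by (simp add: e0_def)
  obtain q where q: "q > 0" "\<forall>v\<in>E. norm v < q \<longrightarrow> \<kappa> v \<in> U0 \<and> \<kappa> v \<in> ?W \<and> \<phi>0 (\<kappa> v) = e0 + v"
    using \<kappa>_ball[OF W W1] .
  define p where "p = min r q"
  have *: "inv (\<kappa> v) \<otimes> \<kappa> v' \<in> U0 \<and> norm (\<phi>0 (inv (\<kappa> v) \<otimes> \<kappa> v') - e0) \<le> C * norm (v' - v)"
    if v: "v \<in> E" "norm v < p" and v': "v' \<in> E" "norm v' < p" for v v'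
  proof -
    have vr: "norm v < r" "norm v' < r" "norm v < q" using v v' by (auto simp: p_def)
    define w where "w = \<phi>0 (inv (\<kappa> v)) - e0"
    have iU: "inv (\<kappa> v) \<in> U0 \<inter> \<phi>0 -` ball e0 r" and vc: "\<kappa> v \<in> carrier G" using q(2) v(1) vr(3) by auto
    then have w: "w \<in> E" "norm w < r" using \<phi>0_in_E e0_in_E subspace_E
      by (auto simp: w_def subspace_diff dist_norm norm_minus_commute)
    have kw: "\<kappa> w = inv (\<kappa> v)" using iU by (simp add: w_def \<kappa>_\<phi>0)
    have one: "\<phi>0 (\<kappa> w \<otimes> \<kappa> v) = e0" using vc by (simp add: kw e0_def)
    have "\<kappa> w \<otimes> \<kappa> v' \<in> U0" using r(4) w v'(1) vr(2) by blast
    moreover have "norm (\<phi>0 (\<kappa> w \<otimes> \<kappa> v') - \<phi>0 (\<kappa> w \<otimes> \<kappa> v)) \<le> C * norm (v' - v)"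
      using r(5) w v(1) v'(1) vr(1,2) by blast
    ultimately show ?thesis using one by (simp add: kw)
  qed
  show thesis by (rule that[of p C]) (use * r q in \<open>auto simp: p_def\<close>)
qed

text \<open>The input of the telescoping argument: partial products \<open>\<gamma>\<close> leading
  from the identity to g, and coordinates u of the factors, with \<open>\<delta>\<close> of order
  1/n in the applications.\<close>

definition subdivides :: "real \<Rightarrow> nat \<Rightarrow> 'g \<Rightarrow> (nat \<Rightarrow> 'g) \<Rightarrow> (nat \<Rightarrow> 'e) \<Rightarrow> bool" where
  "subdivides \<delta> n g \<gamma> u \<longleftrightarrow> \<gamma> 0 = \<one> \<and> \<gamma> n = g \<and> (\<forall>j\<le>n. \<gamma> j \<in> carrier G) \<and>
     (\<forall>j<n. \<gamma> (Suc j) = \<gamma> j \<otimes> \<kappa> (u j) \<and> u j \<in> E \<and> \<kappa> (u j) \<in> carrier G \<and> norm (u j) \<le> \<delta>)"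

text \<open>The segment from 0 to v in the chart is cut into n equal pieces; quotients of
  consecutive points have small coordinates by \<open>inv_mult_local_lipschitz\<close>.\<close>

lemma subdivision:
  obtains r C where "r > 0" "C > 0" "\<forall>v\<in>E. norm v < r \<longrightarrow> \<kappa> v \<in> carrier G"
    "\<forall>v n. v \<in> E \<longrightarrow> norm v < r \<longrightarrow> n > 0 \<longrightarrow> (\<exists>\<gamma> u. subdivides (C * norm v / real n) n (\<kappa> v) \<gamma> u)"
proof -
  obtain r C where r: "r > 0" "C > 0"
    "\<forall>w\<in>E. norm w < r \<longrightarrow> \<kappa> w \<in> U0"
    "\<forall>v\<in>E. \<forall>v'\<in>E. norm v < r \<longrightarrow> norm v' < r \<longrightarrow> inv (\<kappa> v) \<otimes> \<kappa> v' \<in> U0"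
    "\<forall>v\<in>E. \<forall>v'\<in>E. norm v < r \<longrightarrow> norm v' < r \<longrightarrow> norm (\<phi>0 (inv (\<kappa> v) \<otimes> \<kappa> v') - e0) \<le> C * norm (v' - v)"
    using inv_mult_local_lipschitz .
  show thesis
  proof (rule that[OF r(1,2)]; intro allI ballI impI)
    show "\<kappa> v \<in> carrier G" if "v \<in> E" "norm v < r" for v using r(3) that U0_carrier by blast
    fix v and n :: nat assume v: "v \<in> E" "norm v < r" and n: "n > 0"
    define x where "x j = (real j / real n) *\<^sub>R v" for j
    define \<gamma> where "\<gamma> j = \<kappa> (x j)" for j
    define u where "u j = \<phi>0 (inv (\<gamma> j) \<otimes> \<gamma> (Suc j)) - e0" for j
    have x: "x j \<in> E" "norm (x j) < r" if "j \<le> n" for j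
    proof -
      have "(real j / real n) * norm v \<le> 1 * norm v" using that n by (intro mult_right_mono) auto
      then show "norm (x j) < r" using v by (simp add: x_def)
      show "x j \<in> E" using v subspace_E by (simp add: x_def subspace_scale)
    qed
    have xd: "norm (x (Suc j) - x j) = norm v / real n" for j
      using n by (simp add: x_def add_divide_distrib scaleR_left_distrib)
    have \<gamma>c: "\<gamma> j \<in> carrier G" if "j \<le> n" for j
      using r(3) x[OF that] U0_carrier by (simp add: \<gamma>_def)
    have U: "inv (\<gamma> j) \<otimes> \<gamma> (Suc j) \<in> U0" if "j < n" for j
      using r(4) x[of j] x[of "Suc j"] that by (simp add: \<gamma>_def)
    have "\<gamma> (Suc j) = \<gamma> j \<otimes> \<kappa> (u j)" if j: "j < n" for j
      using \<gamma>c[of j] \<gamma>c[of "Suc j"] j by (simp add: u_def \<kappa>_\<phi>0[OF U] inv_solve_left' flip: m_assoc)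
    moreover have "u j \<in> E" if "j < n" for j
      using \<phi>0_in_E[OF U[OF that]] e0_in_E subspace_E by (simp add: u_def subspace_diff)
    moreover have "norm (u j) \<le> C * norm v / real n" if "j < n" for j
      using r(5)[rule_format, of "x j" "x (Suc j)"] x[of j] x[of "Suc j"] that by (simp add: u_def \<gamma>_def xd)
    moreover have "\<gamma> 0 = \<one>" "\<gamma> n = \<kappa> v" using n by (simp_all add: \<gamma>_def x_def)
    moreover have "\<kappa> (u j) \<in> carrier G" if "j < n" for j
      using U0_carrier[OF U[OF that]] by (simp add: u_def \<kappa>_\<phi>0[OF U[OF that]])
    ultimately show "\<exists>\<gamma> u. subdivides (C * norm v / real n) n (\<kappa> v) \<gamma> u"
      using \<gamma>c unfolding subdivides_def by (intro exI[of _ \<gamma>] exI[of _ u]) auto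
  qed
qed

text \<open>A subgroup containing a neighbourhood of the identity is open, and its complement
  contains with each g a translate of that neighbourhood.\<close>

lemma connected_generated:
  assumes conn: "connected_space (lie_topology G)"
    and S: "S \<subseteq> carrier G" "\<one> \<in> S" "\<And>g h. g \<in> S \<Longrightarrow> h \<in> S \<Longrightarrow> g \<otimes> h \<in> S" "\<And>g. g \<in> S \<Longrightarrow> inv g \<in> S"
    and d: "d > 0" "\<And>v. v \<in> E \<Longrightarrow> norm v < d \<Longrightarrow> \<kappa> v \<in> S"
  shows "S = carrier G"
proof -
  let ?N = "U0 \<inter> \<phi>0 -` ball e0 d"
  have N: "openin (lie_topology G) ?N" using openin_manifold_topology_chart[OF chart0(1)] by simp
  have NS: "?N \<subseteq> S"
  proof
    fix g assume g: "g \<in> ?N"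
    then have "\<kappa> (\<phi>0 g - e0) \<in> S"
      using \<phi>0_in_E e0_in_E subspace_E by (intro d(2)) (auto simp: subspace_diff dist_norm norm_minus_commute)
    then show "g \<in> S" using g \<kappa>_\<phi>0 by auto
  qed
  have N1: "\<one> \<in> ?N" using chart0 d(1) by (simp add: e0_def)
  have tr: "openin (lie_topology G) {h \<in> carrier G. inv g \<otimes> h \<in> ?N}" if "g \<in> carrier G" for g
    by (rule preimage_open[OF left_mult_continuous[OF inv_closed[OF that]] N])
  have "openin (lie_topology G) S"
  proof (subst openin_subopen, rule ballI)
    fix g assume g: "g \<in> S"
    then have gc: "g \<in> carrier G" using S by blast
    have "{h \<in> carrier G. inv g \<otimes> h \<in> ?N} \<subseteq> S"
    proof
      fix h assume h: "h \<in> {h \<in> carrier G. inv g \<otimes> h \<in> ?N}"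
      then have "g \<otimes> (inv g \<otimes> h) \<in> S" using NS h by (intro S(3)[OF g]) auto
      then show "h \<in> S" using gc h by (simp add: inv_solve_left' flip: m_assoc)
    qed
    then show "\<exists>T. openin (lie_topology G) T \<and> g \<in> T \<and> T \<subseteq> S" using tr[OF gc] N1 gc by (intro exI conjI) auto
  qed
  moreover have "openin (lie_topology G) (carrier G - S)"
  proof (subst openin_subopen, rule ballI)
    fix g assume g: "g \<in> carrier G - S"
    have "{h \<in> carrier G. inv g \<otimes> h \<in> ?N} \<subseteq> carrier G - S"
    proof
      fix h assume h: "h \<in> {h \<in> carrier G. inv g \<otimes> h \<in> ?N}"
      \<comment> \<open>Otherwise g, a quotient of two elements of \<open>S\<close>, would lie in
        \<open>S\<close>.\<close>
      have "h \<notin> S"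
      proof
        assume hS: "h \<in> S"
        have "inv g \<otimes> h \<in> S" using h NS by blast
        then have "h \<otimes> inv (inv g \<otimes> h) \<in> S" by (rule S(3)[OF hS S(4)])
        moreover have "h \<otimes> inv (inv g \<otimes> h) = h \<otimes> (inv h \<otimes> g)" using g h by (simp add: inv_mult_group)
        moreover have "\<dots> = g" using g h by (simp flip: m_assoc)
        ultimately have "g \<in> S" by (simp only:)
        then show False using g by blast
      qed
      then show "h \<in> carrier G - S" using h by blast
    qed
    then show "\<exists>T. openin (lie_topology G) T \<and> g \<in> T \<and> T \<subseteq> carrier G - S" using tr[of g] N1 g by (intro exI conjI) auto
  qed
  ultimately have "S = {} \<or> S = carrier G"
    using conn S(1) unfolding connected_space_clopen_in closedin_def topspace by blast
  then show ?thesis using S(2) by blast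
qed

end

section \<open>The isotropy group and the adjoint image\<close>

text \<open>\<open>H\<close> is the group whose existence \<open>orthogonal_symmetric\<close>
  asserts, fixed as a parameter with its defining properties.\<close>

locale orthogonal_pair = lie_grp_ident G br \<theta> + KK: lie_grp K + HH: lie_grp H
  for G :: "('g, 'e::real_normed_vector) lie_group" (structure)
    and br :: "'a::real_normed_vector \<Rightarrow> 'a \<Rightarrow> 'a" and \<theta> :: "'a \<Rightarrow> ('g, 'e) tangent"
    and K :: "('g, 'n::real_normed_vector) lie_group"
    and H :: "('a \<Rightarrow>\<^sub>L 'a, 'a \<Rightarrow>\<^sub>L 'a) lie_group" +
  fixes s :: "'a \<Rightarrow> 'a"
  assumes sym: "symmetric_lie_algebra br s"
    and K_sub: "lie_subgroup K G" and K_alg: "lie_algebra_of_subgroup K G = \<theta> ` k_part s"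
    and H_sub: "lie_subgroup H GL"
    and H_alg: "lie_algebra_of_subgroup H GL = (\<lambda>x. GL_tangent (Blinfun (br x))) ` k_part s"
    and H_conn: "connected_space (lie_topology H)" and H_comp: "compact_space (lie_topology H)"
begin

section \<open>The subgroup \<open>K\<close> and its inclusion in \<open>G\<close>\<close>

lemma K_carrier: "x \<in> carrier K \<Longrightarrow> x \<in> carrier G"
  using K_sub subgroup.subset[of "carrier K" G] by (auto simp: lie_subgroup_def)

lemma K_mult: "x \<in> carrier K \<Longrightarrow> y \<in> carrier K \<Longrightarrow> x \<otimes>\<^bsub>K\<^esub> y = x \<otimes> y"
  using K_sub by (auto simp: lie_subgroup_def)

lemma K_one: "\<one>\<^bsub>K\<^esub> = \<one>"
proof -
  have "\<one>\<^bsub>K\<^esub> \<otimes> \<one>\<^bsub>K\<^esub> = \<one>\<^bsub>K\<^esub>" using KK.l_one[OF KK.one_closed] K_mult[OF KK.one_closed KK.one_closed] by simp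
  then show ?thesis using K_carrier[OF KK.one_closed] by (metis l_cancel_one)
qed

lemma K_inv: "x \<in> carrier K \<Longrightarrow> inv\<^bsub>K\<^esub> x = inv x"
  using KK.l_inv[of x] K_mult[of "inv\<^bsub>K\<^esub> x" x] K_carrier[of x] K_carrier[of "inv\<^bsub>K\<^esub> x"] K_one
  by (metis KK.inv_closed inv_equality)

lemma K_incl_smooth: "smooth_map (mfd K) (mfd G) (\<lambda>x. x)"
  using K_sub by (simp add: lie_subgroup_def)

lemma K_incl_continuous: "continuous_map (lie_topology K) (lie_topology G) (\<lambda>x. x)"
  using K_incl_smooth by (simp add: smooth_map_def)

lemma AdB_K_continuous: "continuous_map (lie_topology K) euclidean AdB"
  using continuous_map_compose[OF K_incl_continuous AdB_continuous] by (simp add: o_def)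

lemma K_open: "openin (lie_topology G) W \<Longrightarrow> openin (lie_topology K) {x \<in> carrier K. x \<in> W}"
  using openin_continuous_map_preimage[OF K_incl_continuous] by (simp add: KK.topspace)

text \<open>The derivative at the identity of the inclusion of \<open>K\<close> in \<open>G\<close>.
  It is determined on \<open>KK.E\<close> only, so one is chosen once and for all.\<close>

definition J :: "'n \<Rightarrow> 'e" where
  "J = (SOME D. ((\<phi>0 \<circ> (\<lambda>x. x) \<circ> inv_into KK.U0 KK.\<phi>0) has_derivative D) (at KK.e0 within KK.E))"

lemma J: "((\<phi>0 \<circ> (\<lambda>x. x) \<circ> inv_into KK.U0 KK.\<phi>0) has_derivative J) (at KK.e0 within KK.E)"
proof -
  have "\<one>\<^bsub>K\<^esub> \<in> U0" using chart0(2) K_one by simp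
  from smooth_map_chart_has_derivative[OF K_incl_smooth KK.chart0(1,2) chart0(1) this]
  have "\<exists>D. ((\<phi>0 \<circ> (\<lambda>x. x) \<circ> inv_into KK.U0 KK.\<phi>0) has_derivative D) (at (KK.\<phi>0 \<one>\<^bsub>K\<^esub>) within KK.E)" by blast
  then show ?thesis unfolding J_def KK.e0_def by (rule someI_ex)
qed

text \<open>One half of the assumption on the Lie algebra of \<open>K\<close>, read in the two
  charts: elements of k are velocities of \<open>K\<close>.\<close>

lemma J_onto:
  assumes "z \<in> k_part s"
  shows "\<exists>w\<in>KK.E. J w = th z"
proof -
  have "\<theta> z \<in> lie_algebra_of_subgroup K G" using K_alg assms by simp
  then obtain v where v: "v \<in> tangent_space (mfd K) \<one>\<^bsub>K\<^esub>" "\<theta> z = differential (mfd K) (mfd G) (\<lambda>x. x) \<one>\<^bsub>K\<^esub> v"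
    unfolding lie_algebra_of_subgroup_def by blast
  have vE: "v (KK.U0, KK.\<phi>0) \<in> KK.E" using v KK.chart0 by (intro tangent_space_in_model) auto
  have "\<one>\<^bsub>K\<^esub> \<in> U0" using chart0(2) K_one by simp
  then have "differential (mfd K) (mfd G) (\<lambda>x. x) \<one>\<^bsub>K\<^esub> v (U0, \<phi>0) = J (v (KK.U0, KK.\<phi>0))"
    using J KK.e0_in_E KK.subspace_E KK.chart0(3) chart0(1) vE unfolding KK.e0_def
    by (intro differential_chart[where D = J and U = KK.U0 and \<phi> = KK.\<phi>0 and v = v and V = U0 and \<psi> = \<phi>0])
  then show ?thesis using vE v(2) by (auto simp: th_def)
qed

text \<open>\<open>AdB_estimate\<close> refers to the exact coordinate \<open>th z'\<close> of
  \<open>KK.\<kappa> w\<close> in \<open>G\<close>, of which \<open>J w\<close> is the first-order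
  part; passing from z' to z costs a further small multiple of \<open>norm w\<close>.\<close>

lemma K_estimate:
  assumes e: "\<epsilon> > 0"
  shows "\<exists>d>0. \<forall>w\<in>KK.E. norm w < d \<longrightarrow> (\<forall>z. J w = th z \<longrightarrow> norm (AdB (KK.\<kappa> w) - id_blinfun - ad z) \<le> \<epsilon> * norm w)"
proof -
  obtain c C where c: "c > 0" "C > 0" "\<And>x. c * norm x \<le> norm (th x)" "\<And>x. norm (th x) \<le> C * norm x"
    using th_bounds by blast
  obtain A where A: "A > 0" "\<And>z. norm (ad z) \<le> A * norm z" using norm_ad_bound by blast
  interpret J: bounded_linear J using J has_derivative_bounded_linear by blast
  obtain KJ where KJ: "KJ > 0" "\<And>w. norm (J w) \<le> norm w * KJ" using J.pos_bounded by blast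
  \<comment> \<open>\<open>\<epsilon>1\<close> bounds the cost of replacing z' by z, and
    \<open>\<epsilon>2\<close> the remainder of \<open>Ad\<close>; each is to be at most
    \<open>\<epsilon> / 2 * norm w\<close>. The minimum with 1 gives
    \<open>norm (th z') \<le> norm w * (KJ + 1)\<close>.\<close>
  define \<epsilon>1 where "\<epsilon>1 = min 1 (\<epsilon> * c / (2 * A))"
  have \<epsilon>1: "\<epsilon>1 > 0" "\<epsilon>1 \<le> 1" "\<epsilon>1 \<le> \<epsilon> * c / (2 * A)" using e c A by (auto simp: \<epsilon>1_def)
  define \<epsilon>2 where "\<epsilon>2 = \<epsilon> * c / (2 * (KJ + 1))"
  have \<epsilon>2: "\<epsilon>2 > 0" using e c KJ by (simp add: \<epsilon>2_def)
  obtain d where d: "d > 0" "\<And>z. norm (th z) < d \<Longrightarrow> norm (AdB (inv0 (e0 + th z)) - id_blinfun - ad z) \<le> \<epsilon>2 * norm z"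
    using AdB_estimate[OF \<epsilon>2] by blast
  have W1: "\<one>\<^bsub>K\<^esub> \<in> {x \<in> carrier K. x \<in> U0}" using chart0(2) KK.one_closed K_one by auto
  obtain r where r: "r > 0" "\<forall>v\<in>KK.E. norm v < r \<longrightarrow> KK.\<kappa> v \<in> KK.U0 \<and> KK.\<kappa> v \<in> {x \<in> carrier K. x \<in> U0} \<and> KK.\<phi>0 (KK.\<kappa> v) = KK.e0 + v"
    using KK.\<kappa>_ball[OF K_open[OF openin_U0] W1] .
  obtain d1 where d1: "d1 > 0" "\<And>y. y \<in> KK.E \<Longrightarrow> norm (y - KK.e0) < d1 \<Longrightarrow>
      norm ((\<phi>0 \<circ> (\<lambda>x. x) \<circ> inv_into KK.U0 KK.\<phi>0) y - (\<phi>0 \<circ> (\<lambda>x. x) \<circ> inv_into KK.U0 KK.\<phi>0) KK.e0 - J (y - KK.e0)) \<le> \<epsilon>1 * norm (y - KK.e0)"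
    using J \<epsilon>1(1) unfolding has_derivative_within_alt by metis
  show ?thesis
  proof (intro exI[of _ "min r (min d1 (d / (KJ + 1)))"] conjI ballI impI allI)
    show "min r (min d1 (d / (KJ + 1))) > 0" using r d d1 KJ by simp
    fix w z assume w: "w \<in> KK.E" "norm w < min r (min d1 (d / (KJ + 1)))" and z: "J w = th z"
    then have nw: "norm w < r" "norm w < d1" "norm w * (KJ + 1) < d" using KJ by (auto simp: field_simps)
    have kw: "KK.\<kappa> w \<in> U0" using r(2) w(1) nw(1) by blast
    have e0: "(\<phi>0 \<circ> (\<lambda>x. x) \<circ> inv_into KK.U0 KK.\<phi>0) KK.e0 = e0"
      using KK.chart0(2) KK.inv0[OF KK.chart0(2)] K_one by (simp add: KK.inv0_def KK.e0_def e0_def)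
    have est: "norm (\<phi>0 (KK.\<kappa> w) - e0 - J w) \<le> \<epsilon>1 * norm w"
      using d1(2)[of "KK.e0 + w"] w(1) nw(2) KK.e0_in_E KK.subspace_E e0
      by (simp add: subspace_add KK.\<kappa>_def KK.inv0_def)
    obtain z' where z': "th z' = \<phi>0 (KK.\<kappa> w) - e0"
      using th_surj[of "\<phi>0 (KK.\<kappa> w) - e0"] \<phi>0_in_E[OF kw] e0_in_E subspace_E by (auto simp: subspace_diff)
    have "norm (th z') \<le> \<epsilon>1 * norm w + norm w * KJ"
      by (rule norm_add_le_add[OF _ est KJ(2)]) (simp add: z')
    also have "\<dots> \<le> 1 * norm w + norm w * KJ" using \<epsilon>1 by (intro add_right_mono mult_right_mono) auto
    finally have nz': "norm (th z') \<le> norm w * (KJ + 1)" by (simp add: algebra_simps)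
    have "inv0 (e0 + th z') = KK.\<kappa> w" using kw by (simp add: z')
    then have e1: "norm (AdB (KK.\<kappa> w) - id_blinfun - ad z') \<le> \<epsilon>2 * norm z'" using d(2)[of z'] nz' nw(3) by simp
    have "c * norm z' \<le> norm w * (KJ + 1)" using c(3)[of z'] nz' by simp
    then have "norm z' \<le> norm w * (KJ + 1) / c" using c(1) by (simp add: field_simps)
    then have "\<epsilon>2 * norm z' \<le> \<epsilon>2 * (norm w * (KJ + 1) / c)" using \<epsilon>2 by (intro mult_left_mono) auto
    also have "\<dots> = \<epsilon> / 2 * norm w"
    proof -
      obtain q where "q = KJ + 1" "q > 0" using KJ by simp
      then show ?thesis using c(1) by (simp add: \<epsilon>2_def flip: \<open>q = KJ + 1\<close>)
    qed
    finally have e1': "norm (AdB (KK.\<kappa> w) - id_blinfun - ad z') \<le> \<epsilon> / 2 * norm w" using e1 by simp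
    have "norm (ad z' - ad z) \<le> A * norm (z' - z)" using A(2)[of "z' - z"] by (simp add: linear_diff[OF linear_ad])
    also have "\<dots> \<le> A * (\<epsilon>1 * norm w / c)"
    proof (rule mult_left_mono)
      have "c * norm (z' - z) \<le> \<epsilon>1 * norm w"
        using c(3)[of "z' - z"] est by (simp add: linear_diff[OF linear_th] z' z)
      then show "norm (z' - z) \<le> \<epsilon>1 * norm w / c" using c(1) by (simp add: field_simps)
    qed (use A in simp)
    also have "\<dots> \<le> A * ((\<epsilon> * c / (2 * A)) * norm w / c)"
      using A c \<epsilon>1 by (intro mult_left_mono divide_right_mono mult_right_mono) auto
    also have "\<dots> = \<epsilon> / 2 * norm w" using A c by simp
    finally have "norm (ad z' - ad z) \<le> \<epsilon> / 2 * norm w" .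
    from norm_add_le_add[OF _ e1' this, of "AdB (KK.\<kappa> w) - id_blinfun - ad z"]
    show "norm (AdB (KK.\<kappa> w) - id_blinfun - ad z) \<le> \<epsilon> * norm w" by simp
  qed
qed

section \<open>The compact group \<open>H\<close> as a group of operators\<close>

lemma H_mult: "x \<in> carrier H \<Longrightarrow> y \<in> carrier H \<Longrightarrow> x \<otimes>\<^bsub>H\<^esub> y = x o\<^sub>L y"
  using H_sub by (auto simp: lie_subgroup_def GL_def)

lemma H_carrier: "x \<in> carrier H \<Longrightarrow> x \<in> GL_carrier"
  using H_sub subgroup.subset[of "carrier H" GL] by (auto simp: lie_subgroup_def GL_def)

text \<open>The unit of \<open>H\<close> is an idempotent invertible operator.\<close>

lemma H_one: "\<one>\<^bsub>H\<^esub> = id_blinfun"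
proof -
  let ?o = "\<one>\<^bsub>H\<^esub>"
  have oo: "?o o\<^sub>L ?o = ?o" using HH.l_one[OF HH.one_closed] H_mult[OF HH.one_closed HH.one_closed] by simp
  obtain g where g: "?o o\<^sub>L g = id_blinfun" using H_carrier[OF HH.one_closed] by (auto simp: GL_carrier_def)
  have "?o = ?o o\<^sub>L (?o o\<^sub>L g)" by (simp add: g blinfun_compose_id)
  also have "\<dots> = id_blinfun" unfolding blinfun_compose_assoc[symmetric] oo by (rule g)
  finally show ?thesis .
qed

lemma H_inv: "x \<in> carrier H \<Longrightarrow> inv\<^bsub>H\<^esub> x o\<^sub>L x = id_blinfun" "x \<in> carrier H \<Longrightarrow> x o\<^sub>L inv\<^bsub>H\<^esub> x = id_blinfun"
  using HH.l_inv[of x] HH.r_inv[of x] H_mult[of x "inv\<^bsub>H\<^esub> x"] H_mult[of "inv\<^bsub>H\<^esub> x" x] HH.inv_closed[of x] H_one by auto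

lemma H_incl_smooth: "smooth_map (mfd H) (mfd GL) (\<lambda>x. x)"
  using H_sub by (simp add: lie_subgroup_def)

lemma H_incl_continuous: "continuous_map (lie_topology H) euclidean (\<lambda>x. x)"
proof -
  have "continuous_map (lie_topology H) (lie_topology GL) (\<lambda>x. x)"
    using H_incl_smooth by (simp add: smooth_map_def)
  moreover have "continuous_map (lie_topology GL) euclidean (\<lambda>x::'a \<Rightarrow>\<^sub>L 'a. x)"
    unfolding continuous_map
  proof (intro conjI allI impI)
    fix V :: "('a \<Rightarrow>\<^sub>L 'a) set" assume "openin euclidean V"
    then have "openin (lie_topology GL) (GL_carrier \<inter> (\<lambda>f. f) -` V)"
      by (intro openin_manifold_topology_chart) (auto simp: GL_def)
    moreover have "{x \<in> topspace (lie_topology GL). x \<in> V} = GL_carrier \<inter> (\<lambda>f. f) -` V"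
      by (auto simp: topspace_manifold_topology points_def GL_def)
    ultimately show "openin (lie_topology GL) {x \<in> topspace (lie_topology GL). x \<in> V}" by simp
  qed simp
  ultimately show ?thesis using continuous_map_compose[of "lie_topology H" "lie_topology GL" "\<lambda>x. x" euclidean "\<lambda>x. x"]
    by (simp add: o_def)
qed

text \<open>Compactness is given for the topology of \<open>H\<close> itself, which may be finer;
  the continuous inclusion carries it to the operator norm.\<close>

lemma H_compact: "compact (carrier H)"
proof -
  have "compactin (lie_topology H) (carrier H)" using H_comp by (simp add: compact_space_def HH.topspace)
  from image_compactin[OF this H_incl_continuous] show ?thesis by simp
qed

lemma H_bounded: obtains M where "M > 0" "\<And>h. h \<in> carrier H \<Longrightarrow> norm h \<le> M"
  using compact_imp_bounded[OF H_compact] bounded_pos by metis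

definition T :: "('a \<Rightarrow>\<^sub>L 'a) \<Rightarrow> ('a \<Rightarrow>\<^sub>L 'a)" where
  "T = (SOME D. (((\<lambda>f. f) \<circ> (\<lambda>x. x) \<circ> inv_into HH.U0 HH.\<phi>0) has_derivative D) (at HH.e0 within HH.E))"

lemma T: "(((\<lambda>f. f) \<circ> (\<lambda>x. x) \<circ> inv_into HH.U0 HH.\<phi>0) has_derivative T) (at HH.e0 within HH.E)"
proof -
  have GLa: "(GL_carrier, \<lambda>f. f) \<in> atlas (mfd GL)" by (simp add: GL_def)
  from smooth_map_chart_has_derivative[OF H_incl_smooth HH.chart0(1,2) GLa H_carrier[OF HH.one_closed]]
  have "\<exists>D. (((\<lambda>f. f) \<circ> (\<lambda>x. x) \<circ> inv_into HH.U0 HH.\<phi>0) has_derivative D) (at (HH.\<phi>0 \<one>\<^bsub>H\<^esub>) within HH.E)" by blast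
  then show ?thesis unfolding T_def HH.e0_def by (rule someI_ex)
qed

lemma T_chart:
  assumes v: "v \<in> tangent_space (mfd H) \<one>\<^bsub>H\<^esub>"
  shows "v (HH.U0, HH.\<phi>0) \<in> HH.E"
    "differential (mfd H) (mfd GL) (\<lambda>x. x) \<one>\<^bsub>H\<^esub> v (GL_carrier, \<lambda>f. f) = T (v (HH.U0, HH.\<phi>0))"
proof -
  show vE: "v (HH.U0, HH.\<phi>0) \<in> HH.E" using v HH.chart0 by (intro tangent_space_in_model) auto
  have GLa: "(GL_carrier, \<lambda>f. f) \<in> atlas (mfd GL)" by (simp add: GL_def)
  show "differential (mfd H) (mfd GL) (\<lambda>x. x) \<one>\<^bsub>H\<^esub> v (GL_carrier, \<lambda>f. f) = T (v (HH.U0, HH.\<phi>0))"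
    using T HH.e0_in_E H_carrier[OF HH.one_closed] HH.subspace_E HH.chart0(3) GLa vE unfolding HH.e0_def
    by (intro differential_chart[where D = T and U = HH.U0 and \<phi> = HH.\<phi>0 and v = v and V = GL_carrier and \<psi> = "\<lambda>f. f"])
qed

text \<open>Every small factor in \<open>H\<close> thus has a first-order term \<open>ad z\<close>
  with z in k, which \<open>K\<close> can imitate and which commutes with s.\<close>

lemma T_range: "v \<in> HH.E \<Longrightarrow> \<exists>z\<in>k_part s. T v = ad z"
proof -
  assume v: "v \<in> HH.E"
  let ?t = "tangent_of (mfd H) \<one>\<^bsub>H\<^esub> (HH.U0, HH.\<phi>0) v"
  have t: "?t \<in> tangent_space (mfd H) \<one>\<^bsub>H\<^esub>"
    using HH.manifold HH.chart0 v by (intro tangent_of_in_tangent_space) auto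
  have tc: "?t (HH.U0, HH.\<phi>0) = v"
    using HH.chart0 by (intro tangent_of_chart[OF HH.top_atlas HH.subspace_E _ _ v]) auto
  have "differential (mfd H) (mfd GL) (\<lambda>x. x) \<one>\<^bsub>H\<^esub> ?t \<in> lie_algebra_of_subgroup H GL"
    unfolding lie_algebra_of_subgroup_def using t by blast
  then obtain z where z: "z \<in> k_part s" "differential (mfd H) (mfd GL) (\<lambda>x. x) \<one>\<^bsub>H\<^esub> ?t = GL_tangent (ad z)"
    using H_alg by (auto simp: ad_def)
  then have "T v = ad z" using T_chart(2)[OF t] tc by (simp add: GL_tangent_def)
  then show ?thesis using z by blast
qed

text \<open>The converse inclusion supplies, for each z in k, a direction in \<open>H\<close> with
  velocity \<open>ad z\<close>, as \<open>H_tangent\<close> requires.\<close>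

lemma T_onto: "z \<in> k_part s \<Longrightarrow> \<exists>v\<in>HH.E. T v = ad z"
proof -
  assume "z \<in> k_part s"
  then have "GL_tangent (ad z) \<in> lie_algebra_of_subgroup H GL" using H_alg by (auto simp: ad_def)
  then obtain v where v: "v \<in> tangent_space (mfd H) \<one>\<^bsub>H\<^esub>"
    "GL_tangent (ad z) = differential (mfd H) (mfd GL) (\<lambda>x. x) \<one>\<^bsub>H\<^esub> v"
    unfolding lie_algebra_of_subgroup_def by blast
  have "T (v (HH.U0, HH.\<phi>0)) = GL_tangent (ad z) (GL_carrier, \<lambda>f. f)"
    unfolding v(2) using T_chart(2)[OF v(1)] by simp
  then show ?thesis using T_chart(1)[OF v(1)] by (auto simp: GL_tangent_def)
qed

lemma H_estimate:
  assumes e: "\<epsilon> > 0"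
  shows "\<exists>d>0. \<forall>v\<in>HH.E. norm v < d \<longrightarrow> norm (HH.\<kappa> v - id_blinfun - T v) \<le> \<epsilon> * norm v"
proof -
  obtain d where d: "d > 0" "\<And>y. y \<in> HH.E \<Longrightarrow> norm (y - HH.e0) < d \<Longrightarrow>
      norm (((\<lambda>f. f) \<circ> (\<lambda>x. x) \<circ> inv_into HH.U0 HH.\<phi>0) y - ((\<lambda>f. f) \<circ> (\<lambda>x. x) \<circ> inv_into HH.U0 HH.\<phi>0) HH.e0 - T (y - HH.e0)) \<le> \<epsilon> * norm (y - HH.e0)"
    using T e unfolding has_derivative_within_alt by metis
  have e0: "((\<lambda>f. f) \<circ> (\<lambda>x. x) \<circ> inv_into HH.U0 HH.\<phi>0) HH.e0 = id_blinfun"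
    using HH.chart0(2) HH.inv0[OF HH.chart0(2)] H_one by (simp add: HH.inv0_def HH.e0_def)
  have "norm (HH.\<kappa> v - id_blinfun - T v) \<le> \<epsilon> * norm v" if "v \<in> HH.E" "norm v < d" for v
    using d(2)[of "HH.e0 + v"] that HH.e0_in_E HH.subspace_E e0
    by (simp add: subspace_add HH.\<kappa>_def HH.inv0_def)
  then show ?thesis using d(1) by blast
qed

end

section \<open>Products of small elements of \<open>H\<close> and their counterparts in
  \<open>Ad K\<close>\<close>

context orthogonal_pair
begin

lemma linear_s: "linear s" and s_br: "s (br x y) = br (s x) (s y)" and s_s: "s (s x) = x"
  using sym by (auto simp: symmetric_lie_algebra_def)

lemma subspace_k: "subspace (k_part s)"
  unfolding subspace_def k_part_def
  by (simp add: linear_0[OF linear_s] linear_add[OF linear_s] linear_scale[OF linear_s])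

text \<open>Matches the first-order terms of \<open>H\<close> and \<open>K\<close>. Choices are made
  on a basis and extended linearly, so that \<open>S\<close> is bounded; factors of size O(1/n) in
  \<open>H\<close> then have counterparts of size O(1/n) in \<open>K\<close>.\<close>

lemma lift_map:
  obtains S z CS where "CS > 0" "\<forall>u\<in>HH.E. S u \<in> KK.E \<and> z u \<in> k_part s \<and> J (S u) = th (z u) \<and> T u = ad (z u) \<and> norm (S u) \<le> CS * norm u"
proof -
  interpret J: bounded_linear J using J has_derivative_bounded_linear by blast
  interpret T: bounded_linear T using T has_derivative_bounded_linear by blast
  obtain B C rr where cb: "coordinate_basis HH.E B C rr" using finite_dim_coords[OF HH.finite_dim_E] .
  interpret coordinate_basis HH.E B C rr by fact
  have "\<forall>b. \<exists>z w. b \<in> B \<longrightarrow> z \<in> k_part s \<and> w \<in> KK.E \<and> J w = th z \<and> T b = ad z"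
    using T_range[OF B_subset] J_onto by metis
  then obtain zb wb where b: "\<And>b. b \<in> B \<Longrightarrow> zb b \<in> k_part s \<and> wb b \<in> KK.E \<and> J (wb b) = th (zb b) \<and> T b = ad (zb b)"
    by metis
  define S where "S u = (\<Sum>b\<in>B. rr b u *\<^sub>R wb b)" for u
  define z where "z u = (\<Sum>b\<in>B. rr b u *\<^sub>R zb b)" for u
  have 1: "S u \<in> KK.E" for u
    unfolding S_def using b by (intro subspace_sum subspace_scale KK.subspace_E) auto
  have 2: "z u \<in> k_part s" for u
    unfolding z_def using b by (intro subspace_sum subspace_scale subspace_k) auto
  have 3: "J (S u) = th (z u)" for u
    unfolding S_def z_def linear_sum[OF linear_th] J.sum linear_scale[OF linear_th] J.scale using b by simp
  have 4: "T u = ad (z u)" if u: "u \<in> HH.E" for u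
  proof -
    have "T u = T (\<Sum>b\<in>B. rr b u *\<^sub>R b)" using expand[OF u] by simp
    also have "\<dots> = ad (z u)"
      unfolding z_def linear_sum[OF linear_ad] T.sum linear_scale[OF linear_ad] T.scale using b by simp
    finally show ?thesis .
  qed
  have "\<exists>CS>0. \<forall>u\<in>HH.E. norm (S u) \<le> CS * norm u"
    by (rule finite_dim_linear_bound[OF HH.finite_dim_E])
      (simp_all add: S_def coord_add coord_scale scaleR_left_distrib sum.distrib scaleR_sum_right)
  then show thesis using that 1 2 3 4 by blast
qed

text \<open>If f agrees with \<open>HH.\<kappa>\<close> to first order, replacing each factor
  \<open>HH.\<kappa> (u j)\<close> by \<open>f (u j)\<close> changes the product arbitrarily little.
  It serves both the lift to \<open>K\<close> and the conjugation by \<open>\<sigma>\<close>; n is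
  fixed before the subdivision.\<close>

lemma telescope_estimate:
  assumes f: "\<forall>\<epsilon>>0. \<exists>d>0. \<forall>u\<in>HH.E. norm u < d \<longrightarrow> norm (f u - HH.\<kappa> u) \<le> \<epsilon> * norm u"
    and BC: "B \<ge> 0" "C > 0" and v: "HH.\<kappa> v \<in> carrier H" and e: "\<epsilon> > 0"
  shows "\<exists>n>0. \<forall>\<gamma> u P. HH.subdivides (C * norm v / real n) n (HH.\<kappa> v) \<gamma> u \<and>
      P 0 = id_blinfun \<and> (\<forall>j<n. P (Suc j) = P j o\<^sub>L f (u j)) \<and> (\<forall>j\<le>n. norm (P j) \<le> B) \<longrightarrow>
      norm ((P n o\<^sub>L inv\<^bsub>H\<^esub> (HH.\<kappa> v)) - id_blinfun) \<le> \<epsilon>"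
proof -
  obtain M where M: "M > 0" "\<And>h. h \<in> carrier H \<Longrightarrow> norm h \<le> M" using H_bounded by blast
  \<comment> \<open>In the telescoped error the number of factors cancels and
    \<open>\<epsilon>' * (Q - 1)\<close> remains; the 1 allows division by \<open>Q\<close>.\<close>
  define Q where "Q = B * M * C * norm v + 1"
  have Q: "Q > 0" unfolding Q_def using M BC by (intro add_nonneg_pos mult_nonneg_nonneg) auto
  define \<epsilon>' where "\<epsilon>' = \<epsilon> / Q"
  have e': "\<epsilon>' > 0" using e Q by (simp add: \<epsilon>'_def)
  obtain d where d: "d > 0" "\<forall>u\<in>HH.E. norm u < d \<longrightarrow> norm (f u - HH.\<kappa> u) \<le> \<epsilon>' * norm u" using f e' by blast
  \<comment> \<open>Enough pieces that every factor has size below d.\<close>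
  obtain N where N: "real N > C * norm v / d" using reals_Archimedean2 by blast
  have N0: "N > 0" using N BC d by (metis divide_nonneg_pos less_imp_le mult_nonneg_nonneg norm_ge_zero not_less of_nat_0_less_iff order_le_less_trans)
  define n where "n = N"
  have n: "N \<le> n" and n00: "n > 0" using N0 by (simp_all add: n_def)
  show ?thesis
  proof (intro exI[of _ n] conjI allI impI n00, elim conjE)
    fix \<gamma> u P assume sub: "HH.subdivides (C * norm v / real n) n (HH.\<kappa> v) \<gamma> u" and P: "P 0 = id_blinfun" "\<forall>j<n. P (Suc j) = P j o\<^sub>L f (u j)" "\<forall>j\<le>n. norm (P j) \<le> B"
    from sub have \<gamma>: "\<gamma> 0 = \<one>\<^bsub>H\<^esub>" "\<gamma> n = HH.\<kappa> v" "\<forall>j\<le>n. \<gamma> j \<in> carrier H" and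
      s: "\<forall>j<n. \<gamma> (Suc j) = \<gamma> j \<otimes>\<^bsub>H\<^esub> HH.\<kappa> (u j) \<and> u j \<in> HH.E \<and> HH.\<kappa> (u j) \<in> carrier H \<and> norm (u j) \<le> C * norm v / real n"
      unfolding HH.subdivides_def by auto
    have n0: "real n > 0" using n N0 by simp
    have "C * norm v < real N * d" using N d(1) by (simp add: field_simps)
    also have "\<dots> \<le> real n * d" using n d(1) by (intro mult_right_mono) auto
    finally have nd: "C * norm v / real n < d" using n0 by (simp add: field_simps)
    let ?\<delta> = "\<epsilon>' * (C * norm v / real n)"
    have "norm ((P n o\<^sub>L inv\<^bsub>H\<^esub> (\<gamma> n)) - id_blinfun) \<le> real n * (B * ?\<delta> * M)"
    proof (rule product_telescope[where \<Gamma> = \<gamma> and \<Gamma>' = "\<lambda>j. inv\<^bsub>H\<^esub> (\<gamma> j)" and f = "\<lambda>j. f (u j)" and g = "\<lambda>j. HH.\<kappa> (u j)"])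
      show "inv\<^bsub>H\<^esub> (\<gamma> 0) = id_blinfun" unfolding \<gamma>(1) HH.inv_one by (rule H_one)
      fix j assume j: "j < n"
      show "\<gamma> (Suc j) = \<gamma> j o\<^sub>L HH.\<kappa> (u j)" using s \<gamma>(3) j H_mult by simp
      have uj: "u j \<in> HH.E" "norm (u j) \<le> C * norm v / real n" using s j by auto
      then have "norm (f (u j) - HH.\<kappa> (u j)) \<le> \<epsilon>' * norm (u j)" using d(2) nd by auto
      also have "\<dots> \<le> ?\<delta>" using uj(2) e' by (intro mult_left_mono) auto
      finally show "norm (f (u j) - HH.\<kappa> (u j)) \<le> ?\<delta>" .
    qed (use P \<gamma>(3) H_inv M in auto)
    also have "\<dots> = \<epsilon>' * (B * M * C * norm v)" using n0 by simp
    also have "\<dots> \<le> \<epsilon>' * Q" using e' by (intro mult_left_mono) (auto simp: Q_def)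
    also have "\<dots> = \<epsilon>" using Q by (simp add: \<epsilon>'_def)
    finally show "norm ((P n o\<^sub>L inv\<^bsub>H\<^esub> (HH.\<kappa> v)) - id_blinfun) \<le> \<epsilon>" using \<gamma>(2) by simp
  qed
qed

lemma eq_of_inv_close:
  assumes h: "h \<in> carrier H" and e: "\<And>\<epsilon>. \<epsilon> > 0 \<Longrightarrow> norm ((P o\<^sub>L inv\<^bsub>H\<^esub> h) - id_blinfun) \<le> \<epsilon>"
  shows "P = h"
proof -
  have "norm ((P o\<^sub>L inv\<^bsub>H\<^esub> h) - id_blinfun) \<le> 0"
  proof (rule field_le_epsilon)
    fix \<epsilon> :: real assume "0 < \<epsilon>"
    then show "norm ((P o\<^sub>L inv\<^bsub>H\<^esub> h) - id_blinfun) \<le> 0 + \<epsilon>" using e[of \<epsilon>] by linarith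
  qed
  then have "P o\<^sub>L inv\<^bsub>H\<^esub> h = id_blinfun" by simp
  then have "(P o\<^sub>L inv\<^bsub>H\<^esub> h) o\<^sub>L h = h" by (simp add: blinfun_compose_id)
  then show ?thesis by (simp add: blinfun_compose_assoc H_inv[OF h] blinfun_compose_id)
qed

definition \<sigma> :: "'a \<Rightarrow>\<^sub>L 'a" where "\<sigma> = Blinfun s"

lemma \<sigma>_apply [simp]: "blinfun_apply \<sigma> x = s x"
  unfolding \<sigma>_def using finite_dim_linear_bounded[OF finite_dim linear_s] by (simp add: bounded_linear_Blinfun_apply)

lemma \<sigma>_\<sigma>: "\<sigma> o\<^sub>L \<sigma> = id_blinfun"
  by (intro blinfun_eqI) (simp add: s_s)

text \<open>For z in k, \<open>\<sigma>\<close> commutes with \<open>ad z\<close>, so conjugation by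
  \<open>\<sigma>\<close> preserves the first-order term of \<open>HH.\<kappa> u\<close>. Products
  of conjugated factors are conjugated products, hence arbitrarily close to the original
  ones.\<close>

lemma local_commute_s: "\<exists>r>0. \<forall>v\<in>HH.E. norm v < r \<longrightarrow> \<sigma> o\<^sub>L HH.\<kappa> v o\<^sub>L \<sigma> = HH.\<kappa> v"
proof -
  obtain r C where r: "r > 0" "C > 0"
    "\<forall>v\<in>HH.E. norm v < r \<longrightarrow> HH.\<kappa> v \<in> carrier H"
    "\<forall>v n. v \<in> HH.E \<longrightarrow> norm v < r \<longrightarrow> n > 0 \<longrightarrow> (\<exists>\<gamma> u. HH.subdivides (C * norm v / real n) n (HH.\<kappa> v) \<gamma> u)"
    using HH.subdivision .
  obtain M where M: "M > 0" "\<And>h. h \<in> carrier H \<Longrightarrow> norm h \<le> M" using H_bounded by blast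
  define f where "f u = \<sigma> o\<^sub>L HH.\<kappa> u o\<^sub>L \<sigma>" for u
  define B where "B = norm \<sigma> * M * norm \<sigma>"
  have nB: "norm (\<sigma> o\<^sub>L h o\<^sub>L \<sigma>) \<le> norm \<sigma> * norm h * norm \<sigma>" for h
    using norm_blinfun_compose[of "\<sigma> o\<^sub>L h" \<sigma>] mult_right_mono[OF norm_blinfun_compose[of \<sigma> h], of "norm \<sigma>"] by simp
  have f: "\<exists>d>0. \<forall>u\<in>HH.E. norm u < d \<longrightarrow> norm (f u - HH.\<kappa> u) \<le> \<epsilon> * norm u" if e: "\<epsilon> > 0" for \<epsilon>
  proof -
    \<comment> \<open>Accounts for the remainder of \<open>HH.\<kappa> u\<close> and its conjugate
      together.\<close>
    define q where "q = norm \<sigma> * norm \<sigma> + 1"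
    have q: "q > 0" unfolding q_def by (intro add_nonneg_pos) auto
    obtain d where d: "d > 0" "\<forall>u\<in>HH.E. norm u < d \<longrightarrow> norm (HH.\<kappa> u - id_blinfun - T u) \<le> \<epsilon> / q * norm u"
      using H_estimate[of "\<epsilon> / q"] e q by auto
    have "norm (f u - HH.\<kappa> u) \<le> \<epsilon> * norm u" if u: "u \<in> HH.E" "norm u < d" for u
    proof -
      let ?D = "HH.\<kappa> u - id_blinfun - T u"
      obtain z where z: "z \<in> k_part s" "T u = ad z" using T_range[OF u(1)] by blast
      have nD: "norm ?D \<le> \<epsilon> / q * norm u" using d(2) u by blast
      have "norm (\<sigma> o\<^sub>L ?D o\<^sub>L \<sigma>) \<le> norm \<sigma> * norm ?D * norm \<sigma>" by (rule nB)
      also have "\<dots> \<le> norm \<sigma> * (\<epsilon> / q * norm u) * norm \<sigma>" using nD by (intro mult_right_mono mult_left_mono) auto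
      finally have n1: "norm (\<sigma> o\<^sub>L ?D o\<^sub>L \<sigma>) \<le> norm \<sigma> * (\<epsilon> / q * norm u) * norm \<sigma>" .
      have "f u - HH.\<kappa> u = (\<sigma> o\<^sub>L ?D o\<^sub>L \<sigma>) - ?D"
        using z by (intro blinfun_eqI)
          (simp add: f_def blinfun.diff_left blinfun.diff_right linear_diff[OF linear_s] s_br s_s k_part_def)
      from norm_diff_le_add[OF this n1 nD]
      have "norm (f u - HH.\<kappa> u) \<le> norm \<sigma> * (\<epsilon> / q * norm u) * norm \<sigma> + \<epsilon> / q * norm u" .
      also have "\<dots> = (norm \<sigma> * norm \<sigma> + 1) * (\<epsilon> / q * norm u)" by (simp only: algebra_simps mult_1)
      also have "\<dots> = \<epsilon> * norm u" using q by (simp flip: q_def)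
      finally show ?thesis .
    qed
    then show ?thesis using d(1) by blast
  qed
  have f': "\<forall>\<epsilon>>0. \<exists>d>0. \<forall>u\<in>HH.E. norm u < d \<longrightarrow> norm (f u - HH.\<kappa> u) \<le> \<epsilon> * norm u" using f by blast
  have B0: "B \<ge> 0" using M by (simp add: B_def)
  have "\<sigma> o\<^sub>L HH.\<kappa> v o\<^sub>L \<sigma> = HH.\<kappa> v" if v: "v \<in> HH.E" "norm v < r" for v
  proof (rule eq_of_inv_close)
    show vc: "HH.\<kappa> v \<in> carrier H" using r(3) v by blast
    fix \<epsilon> :: real assume e: "\<epsilon> > 0"
    obtain N where N: "N > 0" and N2: "\<forall>\<gamma> u P. HH.subdivides (C * norm v / real N) N (HH.\<kappa> v) \<gamma> u \<and>
      P 0 = id_blinfun \<and> (\<forall>j<N. P (Suc j) = P j o\<^sub>L f (u j)) \<and> (\<forall>j\<le>N. norm (P j) \<le> B) \<longrightarrow>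
      norm ((P N o\<^sub>L inv\<^bsub>H\<^esub> (HH.\<kappa> v)) - id_blinfun) \<le> \<epsilon>"
      using telescope_estimate[OF f' B0 r(2) vc e] by (elim exE conjE) (rule that)
    obtain \<gamma> u where g0: "HH.subdivides (C * norm v / real N) N (HH.\<kappa> v) \<gamma> u"
      using r(4) v N by blast
    then have g: "\<gamma> 0 = \<one>\<^bsub>H\<^esub>" "\<gamma> N = HH.\<kappa> v" "\<forall>j\<le>N. \<gamma> j \<in> carrier H"
       "\<forall>j<N. \<gamma> (Suc j) = \<gamma> j \<otimes>\<^bsub>H\<^esub> HH.\<kappa> (u j) \<and> u j \<in> HH.E \<and> HH.\<kappa> (u j) \<in> carrier H \<and> norm (u j) \<le> C * norm v / real N"
      unfolding HH.subdivides_def by auto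
    \<comment> \<open>As \<open>\<sigma>\<close> is an involution, these are exactly the partial
      products of the factors \<open>f (u j)\<close>.\<close>
    define P where "P j = \<sigma> o\<^sub>L \<gamma> j o\<^sub>L \<sigma>" for j
    have "P (Suc j) = P j o\<^sub>L f (u j)" if "j < N" for j
    proof -
      have "\<gamma> (Suc j) = \<gamma> j o\<^sub>L HH.\<kappa> (u j)" using g(3,4) that H_mult by simp
      then show ?thesis by (intro blinfun_eqI) (simp add: P_def f_def s_s)
    qed
    moreover have "P 0 = id_blinfun" by (simp add: P_def g(1) H_one \<sigma>_\<sigma> blinfun_compose_id)
    moreover have "norm (P j) \<le> B" if "j \<le> N" for j
    proof -
      have "norm (P j) \<le> norm \<sigma> * norm (\<gamma> j) * norm \<sigma>" unfolding P_def by (rule nB)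
      also have "\<dots> \<le> B" unfolding B_def using M(2)[of "\<gamma> j"] g(3) that by (intro mult_right_mono mult_left_mono) auto
      finally show ?thesis .
    qed
    ultimately have "norm ((P N o\<^sub>L inv\<^bsub>H\<^esub> (HH.\<kappa> v)) - id_blinfun) \<le> \<epsilon>"
      using g0 by (intro N2[rule_format, of \<gamma> u P]) auto
    then show "norm ((\<sigma> o\<^sub>L HH.\<kappa> v o\<^sub>L \<sigma> o\<^sub>L inv\<^bsub>H\<^esub> (HH.\<kappa> v)) - id_blinfun) \<le> \<epsilon>"
      by (simp add: P_def g(2))
  qed
  then show ?thesis using r(1) by blast
qed

text \<open>The product of the lifted factors is followed in the chart of \<open>K\<close> by its
  coordinate \<open>x j\<close>. The drift per step is O(1/N), so the total drift is bounded
  independently of N, and one closed ball contains all endpoints and supplies the limit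
  point.\<close>

lemma local_lift: "\<exists>r>0. \<forall>v\<in>HH.E. norm v < r \<longrightarrow> (\<exists>k\<in>carrier K. AdB k = HH.\<kappa> v)"
proof -
  obtain r C where r: "r > 0" "C > 0"
    "\<forall>v\<in>HH.E. norm v < r \<longrightarrow> HH.\<kappa> v \<in> carrier H"
    "\<forall>v n. v \<in> HH.E \<longrightarrow> norm v < r \<longrightarrow> n > 0 \<longrightarrow> (\<exists>\<gamma> u. HH.subdivides (C * norm v / real n) n (HH.\<kappa> v) \<gamma> u)"
    using HH.subdivision .
  obtain S z CS where CS: "CS > 0" and S: "\<forall>u\<in>HH.E. S u \<in> KK.E \<and> z u \<in> k_part s \<and> J (S u) = th (z u) \<and> T u = ad (z u) \<and> norm (S u) \<le> CS * norm u"
    using lift_map .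
  obtain rK CK where rK: "rK > 0" "CK > 0"
    "\<forall>w\<in>KK.E. norm w < rK \<longrightarrow> KK.\<kappa> w \<in> KK.U0 \<and> KK.\<phi>0 (KK.\<kappa> w) = KK.e0 + w"
    "\<forall>w\<in>KK.E. \<forall>u\<in>KK.E. norm w < rK \<longrightarrow> norm u < rK \<longrightarrow> KK.\<kappa> w \<otimes>\<^bsub>K\<^esub> KK.\<kappa> u \<in> KK.U0"
    "\<forall>w\<in>KK.E. \<forall>u\<in>KK.E. \<forall>u'\<in>KK.E. norm w < rK \<longrightarrow> norm u < rK \<longrightarrow> norm u' < rK \<longrightarrow>
       norm (KK.\<phi>0 (KK.\<kappa> w \<otimes>\<^bsub>K\<^esub> KK.\<kappa> u) - KK.\<phi>0 (KK.\<kappa> w \<otimes>\<^bsub>K\<^esub> KK.\<kappa> u')) \<le> CK * norm (u - u')"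
    using KK.mult_local_lipschitz .
  have W: "openin (lie_topology K) {k \<in> topspace (lie_topology K). AdB k \<in> ball id_blinfun 1}"
    by (rule openin_continuous_map_preimage[OF AdB_K_continuous]) simp
  have W1: "\<one>\<^bsub>K\<^esub> \<in> {k \<in> topspace (lie_topology K). AdB k \<in> ball id_blinfun 1}"
    using KK.one_closed by (simp add: KK.topspace K_one AdB_one)
  obtain r1 where r1: "r1 > 0" "\<forall>w\<in>KK.E. norm w < r1 \<longrightarrow> KK.\<kappa> w \<in> KK.U0 \<and>
      KK.\<kappa> w \<in> {k \<in> topspace (lie_topology K). AdB k \<in> ball id_blinfun 1} \<and> KK.\<phi>0 (KK.\<kappa> w) = KK.e0 + w"
    using KK.\<kappa>_ball[OF W W1] .
  have bnd: "norm (AdB (KK.\<kappa> w)) \<le> 2" if "w \<in> KK.E" "norm w < r1" for w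
  proof -
    have "norm (AdB (KK.\<kappa> w) - id_blinfun) < 1" using r1(2) that by (auto simp: dist_norm norm_minus_commute)
    moreover have "norm (id_blinfun :: 'a \<Rightarrow>\<^sub>L 'a) \<le> 1" by (rule norm_blinfun_id_le)
    ultimately show ?thesis using norm_triangle_sub[of "AdB (KK.\<kappa> w)" id_blinfun] by simp
  qed
  define f where "f u = AdB (KK.\<kappa> (S u))" for u
  have f: "\<exists>d>0. \<forall>u\<in>HH.E. norm u < d \<longrightarrow> norm (f u - HH.\<kappa> u) \<le> \<epsilon> * norm u" if e: "\<epsilon> > 0" for \<epsilon>
  proof -
    have e1: "\<epsilon> / (2 * CS) > 0" "\<epsilon> / 2 > 0" using e CS by auto
    obtain d1 where d1: "d1 > 0" "\<forall>w\<in>KK.E. norm w < d1 \<longrightarrow> (\<forall>z. J w = th z \<longrightarrow> norm (AdB (KK.\<kappa> w) - id_blinfun - ad z) \<le> \<epsilon> / (2 * CS) * norm w)"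
      using K_estimate[OF e1(1)] by blast
    obtain d2 where d2: "d2 > 0" "\<forall>u\<in>HH.E. norm u < d2 \<longrightarrow> norm (HH.\<kappa> u - id_blinfun - T u) \<le> \<epsilon> / 2 * norm u"
      using H_estimate[OF e1(2)] by blast
    have "norm (f u - HH.\<kappa> u) \<le> \<epsilon> * norm u" if u: "u \<in> HH.E" "norm u < min (d1 / CS) d2" for u
    proof -
      have Su: "S u \<in> KK.E" "J (S u) = th (z u)" "T u = ad (z u)" "norm (S u) \<le> CS * norm u" using S u(1) by auto
      have "norm (S u) < d1" using Su(4) u(2) CS by (simp add: field_simps)
      then have "norm (f u - id_blinfun - ad (z u)) \<le> \<epsilon> / (2 * CS) * norm (S u)" using d1(2) Su by (simp add: f_def)
      also have "\<dots> \<le> \<epsilon> / (2 * CS) * (CS * norm u)" using Su(4) e1 by (intro mult_left_mono) auto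
      also have "\<dots> = \<epsilon> / 2 * norm u" using CS by simp
      finally have 1: "norm (f u - id_blinfun - ad (z u)) \<le> \<epsilon> / 2 * norm u" .
      have 2: "norm (HH.\<kappa> u - id_blinfun - T u) \<le> \<epsilon> / 2 * norm u" using d2(2) u by auto
      have "f u - HH.\<kappa> u = (f u - id_blinfun - ad (z u)) - (HH.\<kappa> u - id_blinfun - T u)" using Su(3) by simp
      from norm_diff_le_add[OF this 1 2] show ?thesis by simp
    qed
    moreover have "min (d1 / CS) d2 > 0" using d1 d2 CS by simp
    ultimately show ?thesis by blast
  qed
  have f': "\<forall>\<epsilon>>0. \<exists>d>0. \<forall>u\<in>HH.E. norm u < d \<longrightarrow> norm (f u - HH.\<kappa> u) \<le> \<epsilon> * norm u" using f by blast
  \<comment> \<open>Strictly below both radii: the closed ball stays where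
    \<open>KK.\<kappa>\<close> inverts the chart and where \<open>AdB\<close> has norm at most
    2.\<close>
  define \<rho> where "\<rho> = min rK r1 / 2"
  have \<rho>: "\<rho> > 0" "\<rho> < rK" "\<rho> < r1" using rK r1 by (auto simp: \<rho>_def)
  define C1 where "C1 = CS * C"
  have C1: "C1 > 0" using CS r by (simp add: C1_def)
  \<comment> \<open>The three bounds make v subdividable, keep each lifted factor within
    \<open>rK\<close>, and keep the total drift \<open>CK * C1 * norm v\<close> at most
    \<open>\<rho>\<close>.\<close>
  define p where "p = min r (min (rK / C1) (\<rho> / (CK * C1)))"
  have p: "p > 0" using r rK C1 \<rho> by (simp add: p_def)
  have "\<exists>k\<in>carrier K. AdB k = HH.\<kappa> v" if v: "v \<in> HH.E" "norm v < p" for v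
  proof -
    have vp: "norm v < r" "C1 * norm v < rK" "CK * C1 * norm v \<le> \<rho>"
      using v(2) C1 rK by (auto simp: p_def field_simps)
    have vc: "HH.\<kappa> v \<in> carrier H" using r(3) v(1) vp(1) by blast
    have B0: "(2::real) \<ge> 0" by simp
    have approx: "\<exists>w\<in>KK.E. norm w \<le> \<rho> \<and> norm ((AdB (KK.\<kappa> w) o\<^sub>L inv\<^bsub>H\<^esub> (HH.\<kappa> v)) - id_blinfun) \<le> \<epsilon>" if e: "\<epsilon> > 0" for \<epsilon>
    proof -
      obtain N where N: "N > 0" and N2: "\<forall>\<gamma> u P. HH.subdivides (C * norm v / real N) N (HH.\<kappa> v) \<gamma> u \<and>
        P 0 = id_blinfun \<and> (\<forall>j<N. P (Suc j) = P j o\<^sub>L f (u j)) \<and> (\<forall>j\<le>N. norm (P j) \<le> 2) \<longrightarrow>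
        norm ((P N o\<^sub>L inv\<^bsub>H\<^esub> (HH.\<kappa> v)) - id_blinfun) \<le> \<epsilon>"
        using telescope_estimate[OF f' B0 r(2) vc e] by (elim exE conjE) (rule that)
      obtain \<gamma> u where g0: "HH.subdivides (C * norm v / real N) N (HH.\<kappa> v) \<gamma> u"
        using r(4) v(1) vp(1) N by blast
      then have g: "\<gamma> 0 = \<one>\<^bsub>H\<^esub>" "\<gamma> N = HH.\<kappa> v" "\<forall>j\<le>N. \<gamma> j \<in> carrier H"
         "\<forall>j<N. \<gamma> (Suc j) = \<gamma> j \<otimes>\<^bsub>H\<^esub> HH.\<kappa> (u j) \<and> u j \<in> HH.E \<and> HH.\<kappa> (u j) \<in> carrier H \<and> norm (u j) \<le> C * norm v / real N"
        unfolding HH.subdivides_def by auto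
      \<comment> \<open>Multiplication by the lifted factor, carried out in coordinates. It
        represents the group product as long as \<open>x j\<close> stays in the ball, which
        \<open>xj\<close> proves by induction.\<close>
      define x where "x = rec_nat 0 (\<lambda>j xj. KK.\<phi>0 (KK.\<kappa> xj \<otimes>\<^bsub>K\<^esub> KK.\<kappa> (S (u j))) - KK.e0)"
      have x0: "x 0 = 0" and xS: "\<And>j. x (Suc j) = KK.\<phi>0 (KK.\<kappa> (x j) \<otimes>\<^bsub>K\<^esub> KK.\<kappa> (S (u j))) - KK.e0"
        by (simp_all add: x_def)
      have Su: "S (u j) \<in> KK.E" "norm (S (u j)) \<le> C1 * norm v / real N" "norm (S (u j)) < rK" if j: "j < N" for j
      proof -
        have uj: "u j \<in> HH.E" "norm (u j) \<le> C * norm v / real N" using g(4) j by auto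
        then show "S (u j) \<in> KK.E" using S by blast
        have "norm (S (u j)) \<le> CS * norm (u j)" using S uj by blast
        also have "\<dots> \<le> CS * (C * norm v / real N)" using uj CS by (intro mult_left_mono) auto
        finally show *: "norm (S (u j)) \<le> C1 * norm v / real N" by (simp add: C1_def)
        have "C1 * norm v / real N \<le> C1 * norm v / 1" using N C1 by (intro divide_left_mono) auto
        then show "norm (S (u j)) < rK" using * vp(2) by simp
      qed
      have step: "x (Suc j) \<in> KK.E \<and> norm (x (Suc j) - x j) \<le> CK * C1 * norm v / real N \<and> KK.\<kappa> (x (Suc j)) = KK.\<kappa> (x j) \<otimes>\<^bsub>K\<^esub> KK.\<kappa> (S (u j))"
        if j: "j < N" and xj: "x j \<in> KK.E" "norm (x j) < rK" for j
      proof -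
        have U: "KK.\<kappa> (x j) \<otimes>\<^bsub>K\<^esub> KK.\<kappa> (S (u j)) \<in> KK.U0" using rK(4) xj Su[OF j] by blast
        have z0: "0 \<in> KK.E" "norm (0::'n) < rK" using KK.subspace_E rK(1) by (auto simp: subspace_0)
        have kx: "KK.\<kappa> (x j) \<in> carrier K" "KK.\<phi>0 (KK.\<kappa> (x j)) = KK.e0 + x j" using rK(3) xj KK.U0_carrier by auto
        \<comment> \<open>Comparison with multiplication by \<open>KK.\<kappa> 0\<close>, the
          identity.\<close>
        have "norm (KK.\<phi>0 (KK.\<kappa> (x j) \<otimes>\<^bsub>K\<^esub> KK.\<kappa> (S (u j))) - KK.\<phi>0 (KK.\<kappa> (x j) \<otimes>\<^bsub>K\<^esub> KK.\<kappa> 0)) \<le> CK * norm (S (u j) - 0)"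
          using rK(5) xj Su[OF j] z0 by blast
        then have "norm (x (Suc j) - x j) \<le> CK * norm (S (u j))"
          using kx by (simp add: xS algebra_simps)
        also have "\<dots> \<le> CK * (C1 * norm v / real N)" using Su(2)[OF j] rK(2) by (intro mult_left_mono) auto
        finally have "norm (x (Suc j) - x j) \<le> CK * C1 * norm v / real N" by (simp add: mult.assoc)
        moreover have "x (Suc j) \<in> KK.E" unfolding xS using KK.\<phi>0_in_E[OF U] KK.e0_in_E KK.subspace_E by (simp add: subspace_diff)
        moreover have "KK.\<kappa> (x (Suc j)) = KK.\<kappa> (x j) \<otimes>\<^bsub>K\<^esub> KK.\<kappa> (S (u j))" unfolding xS by (rule KK.\<kappa>_\<phi>0[OF U])
        ultimately show ?thesis by blast
      qed
      have le\<rho>: "real j * (CK * C1 * norm v / real N) \<le> \<rho>" if "j \<le> N" for j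
      proof -
        have "real j * (CK * C1 * norm v / real N) \<le> real N * (CK * C1 * norm v / real N)"
          using that rK C1 by (intro mult_right_mono) auto
        also have "\<dots> = CK * C1 * norm v" using N by simp
        finally show ?thesis using vp(3) by simp
      qed
      have xj: "x j \<in> KK.E \<and> norm (x j) \<le> real j * (CK * C1 * norm v / real N)" if "j \<le> N" for j
        using that
      proof (induction j)
        case 0 then show ?case using KK.subspace_E by (simp add: x0 subspace_0)
      next
        case (Suc j)
        then have j: "j < N" and IH: "x j \<in> KK.E" "norm (x j) \<le> real j * (CK * C1 * norm v / real N)" by auto
        have "norm (x j) < rK" using IH(2) le\<rho>[of j] j \<rho>(2) by simp
        from step[OF j IH(1) this] have st: "x (Suc j) \<in> KK.E" "norm (x (Suc j) - x j) \<le> CK * C1 * norm v / real N" by auto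
        have "norm (x (Suc j)) \<le> CK * C1 * norm v / real N + real j * (CK * C1 * norm v / real N)"
          by (rule norm_add_le_add[OF _ st(2) IH(2)]) simp
        also have "\<dots> = real (Suc j) * (CK * C1 * norm v / real N)" by (simp only: of_nat_Suc distrib_right mult_1)
        finally show ?case using st(1) by simp
      qed
      have xr: "x j \<in> KK.E" "norm (x j) \<le> \<rho>" "norm (x j) < rK" "norm (x j) < r1" if "j \<le> N" for j
        using xj[OF that] le\<rho>[OF that] \<rho> by auto
      define P where "P j = AdB (KK.\<kappa> (x j))" for j
      have kc: "KK.\<kappa> w \<in> carrier K" if "w \<in> KK.E" "norm w < rK" for w using rK(3) that KK.U0_carrier by blast
      have "P (Suc j) = P j o\<^sub>L f (u j)" if j: "j < N" for j
      proof -
        have jN: "j \<le> N" using j by simp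
        have c: "KK.\<kappa> (x j) \<in> carrier K" "KK.\<kappa> (S (u j)) \<in> carrier K" using kc xr[OF jN] Su[OF j] by auto
        have "KK.\<kappa> (x (Suc j)) = KK.\<kappa> (x j) \<otimes>\<^bsub>K\<^esub> KK.\<kappa> (S (u j))" using step[OF j xr(1,3)[OF jN]] by blast
        also have "\<dots> = KK.\<kappa> (x j) \<otimes> KK.\<kappa> (S (u j))" by (rule K_mult[OF c])
        finally show ?thesis using AdB_mult[OF K_carrier[OF c(1)] K_carrier[OF c(2)]] by (simp add: P_def f_def)
      qed
      moreover have "P 0 = id_blinfun" by (simp add: P_def x0 K_one AdB_one)
      moreover have "norm (P j) \<le> 2" if "j \<le> N" for j
        unfolding P_def using bnd xr[OF that] by blast
      ultimately have "norm ((P N o\<^sub>L inv\<^bsub>H\<^esub> (HH.\<kappa> v)) - id_blinfun) \<le> \<epsilon>"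
        using g0 by (intro N2[rule_format, of \<gamma> u P]) auto
      then show ?thesis using xr[OF order_refl] by (auto simp: P_def)
    qed
    \<comment> \<open>The endpoints for errors 1/(n+1) form a bounded sequence in
      \<open>KK.E\<close>; a limit point gives an exact preimage.\<close>
    have "\<forall>n. \<exists>w. w \<in> KK.E \<and> norm w \<le> \<rho> \<and> norm ((AdB (KK.\<kappa> w) o\<^sub>L inv\<^bsub>H\<^esub> (HH.\<kappa> v)) - id_blinfun) \<le> 1 / real (Suc n)"
      using approx by (metis of_nat_0_less_iff zero_less_Suc zero_less_divide_1_iff)
    then obtain w where w: "\<And>n. w n \<in> KK.E" "\<And>n. norm (w n) \<le> \<rho>"
      "\<And>n. norm ((AdB (KK.\<kappa> (w n)) o\<^sub>L inv\<^bsub>H\<^esub> (HH.\<kappa> v)) - id_blinfun) \<le> 1 / real (Suc n)" by metis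
    obtain q l where q: "strict_mono (q::nat\<Rightarrow>nat)" "l \<in> KK.E" "(\<lambda>n. w (q n)) \<longlonglongrightarrow> l"
      using finite_dim_convergent_subsequence[OF KK.finite_dim_E w(1,2)] .
    have nl: "norm l \<le> \<rho>" using tendsto_norm[OF q(3)] w(2) by (intro LIMSEQ_le_const2[of _ "norm l"]) auto
    have inim: "KK.e0 + x \<in> KK.\<phi>0 ` KK.U0" if "x \<in> KK.E" "norm x \<le> \<rho>" for x
      using rK(3) that \<rho>(2) by (metis imageI order_le_less_trans)
    have "continuous_map (top_of_set (KK.\<phi>0 ` KK.U0)) euclidean (AdB \<circ> inv_into KK.U0 KK.\<phi>0)"
      using continuous_map_compose[OF chart_inverse_continuous[OF KK.top_atlas KK.chart0(1)] AdB_K_continuous] .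
    then have co: "continuous_on (KK.\<phi>0 ` KK.U0) (AdB \<circ> inv_into KK.U0 KK.\<phi>0)" by simp
    have "(\<lambda>n. KK.e0 + w (q n)) \<longlonglongrightarrow> KK.e0 + l" using q(3) by (intro tendsto_intros)
    then have "(\<lambda>n. (AdB \<circ> inv_into KK.U0 KK.\<phi>0) (KK.e0 + w (q n))) \<longlonglongrightarrow> (AdB \<circ> inv_into KK.U0 KK.\<phi>0) (KK.e0 + l)"
      by (rule continuous_on_tendsto_compose[OF co]) (use inim q(2) nl w in auto)
    then have lim: "(\<lambda>n. AdB (KK.\<kappa> (w (q n)))) \<longlonglongrightarrow> AdB (KK.\<kappa> l)"
      by (simp add: KK.\<kappa>_def KK.inv0_def)
    have "(\<lambda>n. norm ((AdB (KK.\<kappa> (w (q n))) o\<^sub>L inv\<^bsub>H\<^esub> (HH.\<kappa> v)) - id_blinfun)) \<longlonglongrightarrow> norm ((AdB (KK.\<kappa> l) o\<^sub>L inv\<^bsub>H\<^esub> (HH.\<kappa> v)) - id_blinfun)"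
      using lim by (intro tendsto_intros bounded_bilinear.tendsto[OF bounded_bilinear_blinfun_compose])
    moreover have "(\<lambda>n. norm ((AdB (KK.\<kappa> (w (q n))) o\<^sub>L inv\<^bsub>H\<^esub> (HH.\<kappa> v)) - id_blinfun)) \<longlonglongrightarrow> 0"
    proof (rule tendsto_sandwich[OF _ _ tendsto_const])
      have "((\<lambda>n. 1 / real (Suc n)) \<circ> q) \<longlonglongrightarrow> 0"
        using LIMSEQ_subseq_LIMSEQ[OF _ q(1)] LIMSEQ_inverse_real_of_nat by (auto simp: inverse_eq_divide)
      then show "(\<lambda>n. 1 / real (Suc (q n))) \<longlonglongrightarrow> 0" by (simp add: o_def)
      show "\<forall>\<^sub>F n in sequentially. norm ((AdB (KK.\<kappa> (w (q n))) o\<^sub>L inv\<^bsub>H\<^esub> (HH.\<kappa> v)) - id_blinfun) \<le> 1 / real (Suc (q n))"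
        using w(3) by (intro always_eventually allI)
    qed auto
    ultimately have "norm ((AdB (KK.\<kappa> l) o\<^sub>L inv\<^bsub>H\<^esub> (HH.\<kappa> v)) - id_blinfun) = 0" by (rule LIMSEQ_unique)
    then have "AdB (KK.\<kappa> l) = HH.\<kappa> v" by (intro eq_of_inv_close[OF vc]) simp
    moreover have "KK.\<kappa> l \<in> carrier K" using rK(3) q(2) nl \<rho>(2) KK.U0_carrier by (metis order_le_less_trans)
    ultimately show ?thesis by blast
  qed
  then show ?thesis using p by blast
qed

text \<open>The elements that have a preimage in \<open>K\<close> and commute with s form a subgroup
  of the connected group \<open>H\<close> containing a neighbourhood of the identity.\<close>

lemma H_lift:
  assumes "h \<in> carrier H"
  shows "\<exists>k\<in>carrier K. AdB k = h" "s (blinfun_apply h x) = blinfun_apply h (s x)"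
proof -
  obtain r1 where r1: "r1 > 0" "\<forall>v\<in>HH.E. norm v < r1 \<longrightarrow> (\<exists>k\<in>carrier K. AdB k = HH.\<kappa> v)" using local_lift by blast
  obtain r2 where r2: "r2 > 0" "\<forall>v\<in>HH.E. norm v < r2 \<longrightarrow> \<sigma> o\<^sub>L HH.\<kappa> v o\<^sub>L \<sigma> = HH.\<kappa> v" using local_commute_s by blast
  obtain r3 where r3: "r3 > 0" "\<forall>v\<in>HH.E. norm v < r3 \<longrightarrow> HH.\<kappa> v \<in> HH.U0 \<and> HH.\<kappa> v \<in> HH.U0 \<and> HH.\<phi>0 (HH.\<kappa> v) = HH.e0 + v"
    using HH.\<kappa>_ball[OF HH.openin_U0 HH.chart0(2)] .
  let ?S = "{h \<in> carrier H. (\<exists>k\<in>carrier K. AdB k = h) \<and> \<sigma> o\<^sub>L h o\<^sub>L \<sigma> = h}"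
  have "?S = carrier H"
  proof (rule HH.connected_generated[OF H_conn])
    show "\<one>\<^bsub>H\<^esub> \<in> ?S" using KK.one_closed HH.one_closed AdB_one K_one
      by (auto simp: H_one \<sigma>_\<sigma> blinfun_compose_id)
    show "min r1 (min r2 r3) > 0" using r1 r2 r3 by simp
    show "HH.\<kappa> v \<in> ?S" if "v \<in> HH.E" "norm v < min r1 (min r2 r3)" for v
      using that r1 r2 r3 HH.U0_carrier by auto
    show "g \<otimes>\<^bsub>H\<^esub> h \<in> ?S" if g: "g \<in> ?S" and h: "h \<in> ?S" for g h
    proof -
      obtain a b where ab: "a \<in> carrier K" "AdB a = g" "b \<in> carrier K" "AdB b = h" using g h by blast
      have "AdB (a \<otimes>\<^bsub>K\<^esub> b) = g \<otimes>\<^bsub>H\<^esub> h"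
        using ab g h AdB_mult[OF K_carrier K_carrier, of a b] by (simp add: K_mult H_mult)
      moreover have "\<sigma> o\<^sub>L (g o\<^sub>L h) o\<^sub>L \<sigma> = (\<sigma> o\<^sub>L g o\<^sub>L \<sigma>) o\<^sub>L (\<sigma> o\<^sub>L h o\<^sub>L \<sigma>)"
        by (intro blinfun_eqI) (simp add: s_s)
      moreover have "g \<otimes>\<^bsub>H\<^esub> h = g o\<^sub>L h" "g \<otimes>\<^bsub>H\<^esub> h \<in> carrier H" using g h by (auto simp: H_mult[symmetric])
      ultimately show ?thesis using ab g h by (auto intro: bexI[of _ "a \<otimes>\<^bsub>K\<^esub> b"])
    qed
    show "inv\<^bsub>H\<^esub> g \<in> ?S" if g: "g \<in> ?S" for g
    proof -
      have gc: "g \<in> carrier H" and gs: "\<sigma> o\<^sub>L g o\<^sub>L \<sigma> = g" using g by auto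
      obtain a where a: "a \<in> carrier K" "AdB a = g" using g by blast
      have uniq: "X = inv\<^bsub>H\<^esub> g" if "X o\<^sub>L g = id_blinfun" for X
      proof -
        have "X = X o\<^sub>L (g o\<^sub>L inv\<^bsub>H\<^esub> g)" by (simp add: H_inv[OF gc] blinfun_compose_id)
        also have "\<dots> = inv\<^bsub>H\<^esub> g" using that by (simp add: blinfun_compose_id flip: blinfun_compose_assoc)
        finally show ?thesis .
      qed
      have "AdB (inv\<^bsub>K\<^esub> a) = inv\<^bsub>H\<^esub> g"
        using a AdB_inv[OF K_carrier[OF a(1)]] by (intro uniq) (simp add: K_inv)
      moreover have "(\<sigma> o\<^sub>L inv\<^bsub>H\<^esub> g o\<^sub>L \<sigma>) o\<^sub>L (\<sigma> o\<^sub>L g o\<^sub>L \<sigma>) = \<sigma> o\<^sub>L (inv\<^bsub>H\<^esub> g o\<^sub>L g) o\<^sub>L \<sigma>"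
        by (intro blinfun_eqI) (simp add: s_s)
      then have "\<sigma> o\<^sub>L inv\<^bsub>H\<^esub> g o\<^sub>L \<sigma> = inv\<^bsub>H\<^esub> g"
        using gs by (intro uniq) (simp add: H_inv[OF gc] blinfun_compose_id \<sigma>_\<sigma>)
      ultimately show ?thesis using gc a by (auto intro: bexI[of _ "inv\<^bsub>K\<^esub> a"])
    qed
  qed auto
  then have h: "h \<in> ?S" using assms by simp
  then show "\<exists>k\<in>carrier K. AdB k = h" by blast
  have "\<sigma> o\<^sub>L h o\<^sub>L \<sigma> = h" using h by simp
  then have "blinfun_apply (\<sigma> o\<^sub>L h o\<^sub>L \<sigma>) (s x) = blinfun_apply h (s x)" by simp
  then show "s (blinfun_apply h x) = blinfun_apply h (s x)" by (simp add: s_s)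
qed

end

section \<open>Invariant inner products\<close>

lemma positive_form_lower_bound:
  fixes q :: "'e::real_normed_vector \<Rightarrow> 'e \<Rightarrow> real"
  assumes E: "finite_dim_subspace E" and q: "bounded_bilinear q"
    and pos: "\<And>x. x \<in> E \<Longrightarrow> x \<noteq> 0 \<Longrightarrow> q x x > 0"
  shows "\<exists>c>0. \<forall>x\<in>E. c * (norm x)\<^sup>2 \<le> q x x"
proof -
  interpret q: bounded_bilinear q by fact
  have sE: "subspace E" using E finite_dim_subspaceD by blast
  let ?S = "E \<inter> sphere 0 1"
  note cS = finite_dim_compact_sphere[OF E]
  have cont: "continuous_on ?S (\<lambda>x. q x x)" by (intro q.continuous_on continuous_on_id)
  have scale: "(1 / norm x) *\<^sub>R x \<in> ?S" if "x \<in> E" "x \<noteq> 0" for x using that sE by (simp add: subspace_scale)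
  show ?thesis
  proof (cases "?S = {}")
    case True
    then have "x = 0" if "x \<in> E" for x using scale that by blast
    then have "1 * (norm x)\<^sup>2 \<le> q x x" if "x \<in> E" for x using that by (metis mult_1 norm_zero order_refl power_zero_numeral q.zero_left)
    then show ?thesis using zero_less_one by blast
  next
    case False
    obtain a where a: "a \<in> ?S" "\<And>y. y \<in> ?S \<Longrightarrow> q a a \<le> q y y"
      using continuous_attains_inf[OF cS False cont] by blast
    have "q a a * (norm x)\<^sup>2 \<le> q x x" if x: "x \<in> E" for x
    proof (cases "x = 0")
      case False
      have "q a a \<le> q ((1 / norm x) *\<^sub>R x) ((1 / norm x) *\<^sub>R x)" by (rule a(2)[OF scale[OF x False]])
      then show ?thesis using False by (simp add: q.scaleR_left q.scaleR_right power2_eq_square field_simps)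
    qed (simp add: q.zero_left)
    moreover have "a \<noteq> 0" using a(1) by auto
    ultimately show ?thesis using pos[of a] a(1) by blast
  qed
qed

text \<open>Gram-Schmidt for a form given as a function. A vector in the span of the previous ones
  is skipped, so \<open>S\<close> may be dependent.\<close>

lemma orthonormal_spanning_set:
  fixes \<beta> :: "'a::real_vector \<Rightarrow> 'a \<Rightarrow> real"
  assumes \<beta>: "bilinear \<beta>" and sym: "\<And>u v. \<beta> u v = \<beta> v u" and pos: "\<And>u. u \<noteq> 0 \<Longrightarrow> \<beta> u u > 0"
    and S: "finite S"
  shows "\<exists>N. finite N \<and> span N = span S \<and> (\<forall>e\<in>N. \<forall>e'\<in>N. \<beta> e e' = (if e = e' then 1 else 0))"
  using S
proof (induction S rule: finite_induct)
  case empty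
  show ?case by (rule exI[of _ "{}"]) simp
next
  case (insert a S)
  then obtain N where N: "finite N" "span N = span S" "\<And>e e'. e \<in> N \<Longrightarrow> e' \<in> N \<Longrightarrow> \<beta> e e' = (if e = e' then 1 else 0)" by blast
  have linl: "linear (\<lambda>x. \<beta> x y)" and linr: "linear (\<beta> y)" for y using \<beta> by (auto simp: bilinear_def)
  define p where "p = (\<Sum>e\<in>N. \<beta> a e *\<^sub>R e)"
  have pN: "p \<in> span N" unfolding p_def by (intro span_sum span_scale span_base)
  define w where "w = a - p"
  have we: "\<beta> w e = 0" if e: "e \<in> N" for e
  proof -
    have "\<beta> p e = (\<Sum>e'\<in>N. \<beta> a e' * \<beta> e' e)"
      unfolding p_def by (simp add: linear_sum[OF linl] linear_scale[OF linl])
    also have "\<dots> = (\<Sum>e'\<in>N. if e' = e then \<beta> a e' else 0)"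
      by (intro sum.cong refl) (simp add: N(3)[OF _ e])
    also have "\<dots> = \<beta> a e" using N(1) e by (simp add: sum.delta')
    finally show ?thesis by (simp add: w_def linear_diff[OF linl])
  qed
  show ?case
  proof (cases "w = 0")
    case True
    then have "a \<in> span S" using pN N(2) by (simp add: w_def)
    then have "span (insert a S) = span S" by (rule span_redundant)
    then show ?thesis using N by (intro exI[of _ N]) simp
  next
    case False
    define c where "c = 1 / sqrt (\<beta> w w)"
    have c: "c > 0" "c * c * \<beta> w w = 1" using pos[OF False] by (auto simp: c_def)
    define e0 where "e0 = c *\<^sub>R w"
    have e00: "\<beta> e0 e0 = 1" using c by (simp add: e0_def linear_scale[OF linl] linear_scale[OF linr])
    have e0e: "\<beta> e0 e = 0" "\<beta> e e0 = 0" if "e \<in> N" for e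
      using we[OF that] sym[of e e0] by (auto simp: e0_def linear_scale[OF linl])
    have e0N: "e0 \<notin> N" using e0e e00 by fastforce
    have "span (insert e0 N) = span (insert a N)"
    proof (subst span_eq, intro conjI)
      have "e0 \<in> span (insert a N)"
        unfolding e0_def w_def using pN by (meson span_base span_diff span_mono span_scale insertI1 subset_insertI subsetD)
      then show "insert e0 N \<subseteq> span (insert a N)" by (auto intro: span_base)
      have "w = (1 / c) *\<^sub>R e0" using c(1) by (simp add: e0_def)
      then have "a = (1 / c) *\<^sub>R e0 + p" by (simp add: w_def algebra_simps)
      moreover have "p \<in> span (insert e0 N)" using pN by (meson span_mono subset_insertI subsetD)
      ultimately have "a \<in> span (insert e0 N)" by (metis span_add span_base span_scale insertI1)
      then show "insert a N \<subseteq> span (insert e0 N)" by (auto intro: span_base)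
    qed
    also have "\<dots> = span (insert a S)" using N(2) by (metis span_insert)
    finally show ?thesis
      using N(1,3) e00 e0e e0N by (intro exI[of _ "insert e0 N"]) auto
  qed
qed

lemma orthonormal_expand:
  fixes \<beta> :: "'a::real_vector \<Rightarrow> 'a \<Rightarrow> real"
  assumes \<beta>: "bilinear \<beta>" and N: "finite N" "\<And>e e'. e \<in> N \<Longrightarrow> e' \<in> N \<Longrightarrow> \<beta> e e' = (if e = e' then 1 else 0)"
    and u: "u \<in> span N"
  shows "(\<Sum>e\<in>N. \<beta> u e *\<^sub>R e) = u"
proof -
  have linl: "linear (\<lambda>x. \<beta> x y)" for y using \<beta> by (auto simp: bilinear_def)
  show ?thesis using u
  proof (induction rule: span_induct_alt)
    case base
    then show ?case by (simp add: linear_0[OF linl])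
  next
    case (step c x y)
    have "(\<Sum>e\<in>N. \<beta> x e *\<^sub>R e) = (\<Sum>e\<in>N. if e = x then e else 0)"
      by (intro sum.cong refl) (simp add: N(2)[OF step(1)])
    also have "\<dots> = x" using N(1) step(1) by (simp add: sum.delta')
    finally have x: "(\<Sum>e\<in>N. \<beta> x e *\<^sub>R e) = x" .
    have "(\<Sum>e\<in>N. \<beta> (c *\<^sub>R x + y) e *\<^sub>R e) = c *\<^sub>R (\<Sum>e\<in>N. \<beta> x e *\<^sub>R e) + (\<Sum>e\<in>N. \<beta> y e *\<^sub>R e)"
      by (simp add: linear_add[OF linl] linear_scale[OF linl] scaleR_left_distrib sum.distrib scaleR_sum_right)
    then show ?case using x step(2) by simp
  qed
qed

locale compact_operator_group =
  fixes Hs :: "('a::real_normed_vector \<Rightarrow>\<^sub>L 'a) set"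
  assumes finite_dim: "finite_dim_subspace (UNIV :: 'a set)"
    and compact: "compact Hs"
    and one_mem: "id_blinfun \<in> Hs"
    and mult_mem: "g \<in> Hs \<Longrightarrow> h \<in> Hs \<Longrightarrow> g o\<^sub>L h \<in> Hs"
    and inv_mem: "g \<in> Hs \<Longrightarrow> \<exists>h\<in>Hs. h o\<^sub>L g = id_blinfun \<and> g o\<^sub>L h = id_blinfun"
begin

text \<open>A strictly convex invariant function on the invariant convex set of admissible forms has a unique,
  hence invariant, minimiser. This replaces averaging over the Haar measure.\<close>

definition admissible :: "('a \<Rightarrow> 'a \<Rightarrow> real) \<Rightarrow> bool" where
  "admissible \<beta> \<longleftrightarrow> bilinear \<beta> \<and> (\<forall>u v. \<beta> u v = \<beta> v u) \<and>
     (\<forall>g\<in>Hs. \<forall>u. (norm u)\<^sup>2 \<le> \<beta> (blinfun_apply g u) (blinfun_apply g u))"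

text \<open>The squared Hilbert-Schmidt norm of the Gram matrix, in the basis \<open>B\<close>, of
  the form \<open>\<beta>\<close> transported by g.\<close>

definition energy :: "'a set \<Rightarrow> ('a \<Rightarrow> 'a \<Rightarrow> real) \<Rightarrow> ('a \<Rightarrow>\<^sub>L 'a) \<Rightarrow> real" where
  "energy B \<beta> g = (\<Sum>b\<in>B. \<Sum>b'\<in>B. (\<beta> (blinfun_apply g b) (blinfun_apply g b'))\<^sup>2)"

lemma energy_nonneg: "0 \<le> energy B \<beta> g"
  unfolding energy_def by (intro sum_nonneg) auto

lemma energy_continuous:
  assumes "bilinear \<beta>" shows "continuous_on X (energy B \<beta>)"
proof -
  interpret \<beta>: bounded_bilinear \<beta> using finite_dim_bilinear_bounded[OF finite_dim assms] .
  show ?thesis unfolding energy_def[abs_def]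
    by (intro continuous_intros \<beta>.continuous_on)
qed

lemma norm_bound: obtains M where "M > 0" "\<And>h. h \<in> Hs \<Longrightarrow> norm h \<le> M"
  using compact_imp_bounded[OF compact] bounded_pos by metis

lemma admissible_exists: "\<exists>\<beta>. admissible \<beta>"
proof -
  obtain B C r where cb: "coordinate_basis (UNIV :: 'a set) B C r" using finite_dim_coords[OF finite_dim] .
  interpret coordinate_basis "UNIV :: 'a set" B C r by fact
  obtain M where M: "M > 0" "\<And>h. h \<in> Hs \<Longrightarrow> norm h \<le> M" using norm_bound by blast
  define D where "D = (\<Sum>b\<in>B. (norm b)\<^sup>2)"
  \<comment> \<open>\<open>D\<close> comes from the Cauchy-Schwarz inequality between coordinates
    and basis vectors; the square of \<open>M\<close> pays for recovering u from its image under g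
    by an inverse in \<open>Hs\<close>.\<close>
  define \<beta> where "\<beta> u v = M\<^sup>2 * D * (\<Sum>b\<in>B. r b u * r b v)" for u v
  have n: "(norm u)\<^sup>2 \<le> D * (\<Sum>b\<in>B. r b u * r b u)" for u
  proof -
    have "norm u = norm (\<Sum>b\<in>B. r b u *\<^sub>R b)" using expand[of u] by simp
    also have "\<dots> \<le> (\<Sum>b\<in>B. \<bar>r b u\<bar> * \<bar>norm b\<bar>)" by (rule order_trans[OF norm_sum]) simp
    also have "\<dots> \<le> L2_set (\<lambda>b. r b u) B * L2_set norm B" by (rule L2_set_mult_ineq)
    finally have "(norm u)\<^sup>2 \<le> (L2_set (\<lambda>b. r b u) B * L2_set norm B)\<^sup>2" by (intro power_mono) auto
    also have "\<dots> = (\<Sum>b\<in>B. (r b u)\<^sup>2) * D"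
      by (simp add: power_mult_distrib L2_set_def D_def sum_nonneg)
    finally show ?thesis by (simp add: power2_eq_square mult.commute)
  qed
  have "bilinear \<beta>"
    unfolding bilinear_def \<beta>_def
    by (auto intro!: linearI simp: coord_add coord_scale algebra_simps sum.distrib sum_distrib_left)
  moreover have "\<beta> u v = \<beta> v u" for u v by (simp add: \<beta>_def mult.commute)
  moreover have "(norm u)\<^sup>2 \<le> \<beta> (blinfun_apply g u) (blinfun_apply g u)" if g: "g \<in> Hs" for g u
  proof -
    obtain h where h: "h \<in> Hs" "h o\<^sub>L g = id_blinfun" using inv_mem[OF g] by blast
    have "u = blinfun_apply h (blinfun_apply g u)" using arg_cong[OF h(2), of "\<lambda>f. blinfun_apply f u"] by simp
    then have "norm u \<le> norm h * norm (blinfun_apply g u)" by (metis norm_blinfun)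
    also have "\<dots> \<le> M * norm (blinfun_apply g u)" using M(2)[OF h(1)] by (intro mult_right_mono) auto
    finally have "(norm u)\<^sup>2 \<le> (M * norm (blinfun_apply g u))\<^sup>2" by (intro power_mono) auto
    also have "\<dots> \<le> M\<^sup>2 * (D * (\<Sum>b\<in>B. r b (blinfun_apply g u) * r b (blinfun_apply g u)))"
      unfolding power_mult_distrib by (intro mult_left_mono n) auto
    finally show ?thesis by (simp add: \<beta>_def mult.assoc)
  qed
  ultimately show ?thesis unfolding admissible_def by blast
qed

text \<open>The quantity minimised is the supremum of the energy over \<open>Hs\<close>, expressed
  by its upper bounds t. The energy at the identity bounds the Gram entries of a minimising
  sequence, and admissibility is a closed condition, so a subsequence converges to a
  minimiser.\<close>

lemma energy_minimiser:
  assumes B: "coordinate_basis (UNIV :: 'a set) B C r"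
  shows "\<exists>t \<beta>. admissible \<beta> \<and> (\<forall>g\<in>Hs. energy B \<beta> g \<le> t) \<and>
    (\<forall>\<mu> t'. admissible \<mu> \<longrightarrow> (\<forall>g\<in>Hs. energy B \<mu> g \<le> t') \<longrightarrow> t \<le> t')"
proof -
  interpret coordinate_basis "UNIV :: 'a set" B C r by fact
  define Ts where "Ts = {t. \<exists>\<beta>. admissible \<beta> \<and> (\<forall>g\<in>Hs. energy B \<beta> g \<le> t)}"
  have Tne: "Ts \<noteq> {}"
  proof -
    obtain \<beta> where \<beta>: "admissible \<beta>" using admissible_exists by blast
    then have "compact (energy B \<beta> ` Hs)"
      by (intro compact_continuous_image energy_continuous compact) (simp add: admissible_def)
    then obtain t where "\<forall>x\<in>energy B \<beta> ` Hs. norm x \<le> t" using compact_imp_bounded bounded_iff by metis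
    then have "\<forall>g\<in>Hs. energy B \<beta> g \<le> t" by force
    then show ?thesis using \<beta> by (auto simp: Ts_def)
  qed
  have Tb: "t \<ge> 0" if "t \<in> Ts" for t
    using that one_mem energy_nonneg order_trans unfolding Ts_def by blast
  then have bb: "bdd_below Ts" by (intro bdd_belowI[of _ 0])
  define t0 where "t0 = Inf Ts"
  have "\<exists>\<beta>. admissible \<beta> \<and> (\<forall>g\<in>Hs. energy B \<beta> g \<le> t0 + 1 / real (Suc n))" for n
  proof -
    have "Inf Ts < t0 + 1 / real (Suc n)" by (simp add: t0_def)
    then obtain t where t: "t \<in> Ts" "t < t0 + 1 / real (Suc n)" using cInf_lessD[OF Tne] by blast
    then obtain \<beta> where "admissible \<beta>" and \<beta>: "\<forall>g\<in>Hs. energy B \<beta> g \<le> t" by (auto simp: Ts_def)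
    moreover have "energy B \<beta> g \<le> t0 + 1 / real (Suc n)" if "g \<in> Hs" for g
      using \<beta> that t(2) by (meson less_imp_le order_trans)
    ultimately show ?thesis by blast
  qed
  then have "\<exists>\<beta>. \<forall>n. admissible (\<beta> n) \<and> (\<forall>g\<in>Hs. energy B (\<beta> n) g \<le> t0 + 1 / real (Suc n))" by (intro choice) blast
  then obtain \<beta> where \<beta>: "\<And>n. admissible (\<beta> n)" "\<And>n g. g \<in> Hs \<Longrightarrow> energy B (\<beta> n) g \<le> t0 + 1 / real (Suc n)" by blast
  have bd: "\<bar>\<beta> n b b'\<bar> \<le> sqrt (t0 + 1)" if "b \<in> B" "b' \<in> B" for n b b'
  proof -
    have "(\<beta> n b b')\<^sup>2 \<le> (\<Sum>b'\<in>B. (\<beta> n b b')\<^sup>2)" using that finite_B by (intro member_le_sum) auto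
    also have "\<dots> \<le> (\<Sum>b\<in>B. \<Sum>b'\<in>B. (\<beta> n b b')\<^sup>2)"
      using that finite_B by (intro member_le_sum[of b B "\<lambda>b. \<Sum>b'\<in>B. (\<beta> n b b')\<^sup>2"] sum_nonneg) auto
    also have "\<dots> = energy B (\<beta> n) id_blinfun" by (simp add: energy_def)
    also have "\<dots> \<le> t0 + 1 / real (Suc n)" by (rule \<beta>(2)[OF one_mem])
    also have "\<dots> \<le> t0 + 1" by simp
    finally show ?thesis by (simp add: real_le_rsqrt)
  qed
  have "\<exists>K. \<forall>n. \<bar>\<beta> n (fst i) (snd i)\<bar> \<le> K" if "i \<in> B \<times> B" for i
    using bd that by (intro exI[of _ "sqrt (t0 + 1)"]) auto
  from finite_family_subseq[of "B \<times> B" "\<lambda>n i. \<beta> n (fst i) (snd i)", OF _ this] finite_B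
  obtain q l where q: "strict_mono (q::nat\<Rightarrow>nat)" and l: "\<forall>i\<in>B \<times> B. (\<lambda>n. \<beta> (q n) (fst i) (snd i)) \<longlonglongrightarrow> l i"
    by auto
  \<comment> \<open>The limit form is built from the limits of the Gram entries; by the expansion
    \<open>ex\<close> the approximating forms converge to it pointwise.\<close>
  define \<beta>0 where "\<beta>0 u v = (\<Sum>b\<in>B. \<Sum>b'\<in>B. r b u * r b' v * l (b, b'))" for u v
  have bil: "bilinear (\<beta> n)" for n using \<beta>(1) by (simp add: admissible_def)
  have ex: "\<beta> n u v = (\<Sum>b\<in>B. \<Sum>b'\<in>B. r b u * r b' v * \<beta> n b b')" for n u v
  proof -
    have 1: "linear (\<lambda>u. \<beta> n u v)" and 2: "linear (\<beta> n u)" for u v using bil by (auto simp: bilinear_def)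
    have "\<beta> n u v = \<beta> n (\<Sum>b\<in>B. r b u *\<^sub>R b) (\<Sum>b'\<in>B. r b' v *\<^sub>R b')" using expand[of u] expand[of v] by simp
    also have "\<dots> = (\<Sum>b\<in>B. r b u * \<beta> n b (\<Sum>b'\<in>B. r b' v *\<^sub>R b'))"
      by (simp add: linear_sum[OF 1] linear_scale[OF 1])
    also have "\<dots> = (\<Sum>b\<in>B. r b u * (\<Sum>b'\<in>B. r b' v * \<beta> n b b'))"
      by (simp add: linear_sum[OF 2] linear_scale[OF 2])
    finally show ?thesis by (simp add: sum_distrib_left mult.assoc)
  qed
  have lim: "(\<lambda>n. \<beta> (q n) u v) \<longlonglongrightarrow> \<beta>0 u v" for u v
    unfolding ex[of _ u v] \<beta>0_def using l by (intro tendsto_intros) auto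
  have adm: "admissible \<beta>0"
    unfolding admissible_def
  proof (intro conjI allI ballI)
    show "bilinear \<beta>0"
      unfolding bilinear_def \<beta>0_def
      by (auto intro!: linearI simp: coord_add coord_scale algebra_simps sum.distrib sum_distrib_left)
    fix u v
    have "\<beta> (q n) u v = \<beta> (q n) v u" for n using \<beta>(1) unfolding admissible_def by blast
    then show "\<beta>0 u v = \<beta>0 v u" using LIMSEQ_unique[OF lim[of u v]] lim[of v u] by simp
  next
    fix g u assume g: "g \<in> Hs"
    have "(norm u)\<^sup>2 \<le> \<beta> (q n) (blinfun_apply g u) (blinfun_apply g u)" for n
      using \<beta>(1)[of "q n"] g by (simp add: admissible_def)
    then show "(norm u)\<^sup>2 \<le> \<beta>0 (blinfun_apply g u) (blinfun_apply g u)"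
      by (intro LIMSEQ_le_const[OF lim]) auto
  qed
  have en: "energy B \<beta>0 g \<le> t0" if g: "g \<in> Hs" for g
  proof (rule LIMSEQ_le)
    show "(\<lambda>n. energy B (\<beta> (q n)) g) \<longlonglongrightarrow> energy B \<beta>0 g"
      unfolding energy_def by (intro tendsto_intros lim)
    have "((\<lambda>n. 1 / real (Suc n)) \<circ> q) \<longlonglongrightarrow> 0"
      using LIMSEQ_subseq_LIMSEQ[OF _ q] LIMSEQ_inverse_real_of_nat by (auto simp: inverse_eq_divide)
    then have "(\<lambda>n. t0 + 1 / real (Suc (q n))) \<longlonglongrightarrow> t0 + 0" by (intro tendsto_intros) (simp add: o_def)
    then show "(\<lambda>n. t0 + 1 / real (Suc (q n))) \<longlonglongrightarrow> t0" by simp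
    show "\<exists>N. \<forall>n\<ge>N. energy B (\<beta> (q n)) g \<le> t0 + 1 / real (Suc (q n))" using \<beta>(2)[OF g] by blast
  qed
  have "t0 \<le> t'" if "admissible \<mu>" "\<forall>g\<in>Hs. energy B \<mu> g \<le> t'" for \<mu> t'
    unfolding t0_def using that by (intro cInf_lower bb) (auto simp: Ts_def)
  then show ?thesis using adm en by blast
qed

text \<open>If h changed the minimiser, its average with the transported form would be admissible,
  and by the parallelogram identity its energy would be lower by that of half the difference,
  uniformly over the group.\<close>

lemma invariant_inner_product:
  obtains \<beta> where "bilinear \<beta>" "\<And>u v. \<beta> u v = \<beta> v u" "\<And>u. u \<noteq> 0 \<Longrightarrow> \<beta> u u > (0::real)"
    "\<And>h u v. h \<in> Hs \<Longrightarrow> \<beta> (blinfun_apply h u) (blinfun_apply h v) = \<beta> u v"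
proof -
  obtain B C r where cb: "coordinate_basis (UNIV :: 'a set) B C r" using finite_dim_coords[OF finite_dim] .
  interpret coordinate_basis "UNIV :: 'a set" B C r by fact
  obtain t \<beta> where \<beta>: "admissible \<beta>" and t: "\<forall>g\<in>Hs. energy B \<beta> g \<le> t"
    and min: "\<forall>\<mu> t'. admissible \<mu> \<longrightarrow> (\<forall>g\<in>Hs. energy B \<mu> g \<le> t') \<longrightarrow> t \<le> t'"
    using energy_minimiser[OF cb] by blast
  have bil: "bilinear \<beta>" and sym: "\<And>u v. \<beta> u v = \<beta> v u"
    and adm: "\<And>g u. g \<in> Hs \<Longrightarrow> (norm u)\<^sup>2 \<le> \<beta> (blinfun_apply g u) (blinfun_apply g u)"
    using \<beta> by (auto simp: admissible_def)
  have inv: "\<beta> (blinfun_apply h u0) (blinfun_apply h v0) = \<beta> u0 v0" if h: "h \<in> Hs" for h u0 v0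
  proof (rule ccontr)
    assume ne: "\<beta> (blinfun_apply h u0) (blinfun_apply h v0) \<noteq> \<beta> u0 v0"
    define \<beta>' where "\<beta>' u v = \<beta> (blinfun_apply h u) (blinfun_apply h v)" for u v
    define \<delta> where "\<delta> u v = (\<beta> u v - \<beta>' u v) / 2" for u v
    define \<mu> where "\<mu> u v = (\<beta> u v + \<beta>' u v) / 2" for u v
    have bil': "bilinear \<beta>'"
      unfolding bilinear_def \<beta>'_def
      by (auto intro!: linearI simp: bilinear_ladd[OF bil] bilinear_radd[OF bil] bilinear_lmul[OF bil] bilinear_rmul[OF bil]
          blinfun.add_right blinfun.scaleR_right)
    have bil\<delta>: "bilinear \<delta>" and bil\<mu>: "bilinear \<mu>"
      unfolding bilinear_def \<delta>_def \<mu>_def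
      by (auto intro!: linearI simp: bilinear_ladd[OF bil] bilinear_radd[OF bil] bilinear_lmul[OF bil] bilinear_rmul[OF bil]
          bilinear_ladd[OF bil'] bilinear_radd[OF bil'] bilinear_lmul[OF bil'] bilinear_rmul[OF bil'] field_simps)
    have adm\<mu>: "admissible \<mu>"
      unfolding admissible_def
    proof (intro conjI allI ballI bil\<mu>)
      show "\<mu> u v = \<mu> v u" for u v by (simp add: \<mu>_def \<beta>'_def sym)
      fix g u assume g: "g \<in> Hs"
      have "(norm u)\<^sup>2 \<le> \<beta>' (blinfun_apply g u) (blinfun_apply g u)"
        using adm[OF mult_mem[OF h g], of u] by (simp add: \<beta>'_def)
      then show "(norm u)\<^sup>2 \<le> \<mu> (blinfun_apply g u) (blinfun_apply g u)"
        using adm[OF g, of u] by (simp add: \<mu>_def)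
    qed
    have par: "energy B \<mu> g = (energy B \<beta> g + energy B \<beta>' g) / 2 - energy B \<delta> g" for g
    proof -
      have sq: "((x + y) / 2)\<^sup>2 = (x\<^sup>2 + y\<^sup>2) / 2 - ((x - y) / 2)\<^sup>2" for x y :: real
        by (simp add: power2_eq_square field_simps)
      show ?thesis unfolding energy_def \<mu>_def \<delta>_def sq
        by (simp only: sum_subtractf sum.distrib flip: sum_divide_distrib)
    qed
    have en': "energy B \<beta>' g \<le> t" if g: "g \<in> Hs" for g
    proof -
      have "energy B \<beta>' g = energy B \<beta> (h o\<^sub>L g)" by (simp add: energy_def \<beta>'_def)
      then show ?thesis using t mult_mem[OF h g] by simp
    qed
    \<comment> \<open>Compactness of \<open>Hs\<close> gives a gap that does not depend on
      g.\<close>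
    obtain g0 where g0: "g0 \<in> Hs" "\<And>g. g \<in> Hs \<Longrightarrow> energy B \<delta> g0 \<le> energy B \<delta> g"
      using continuous_attains_inf[OF compact _ energy_continuous[OF bil\<delta>]] one_mem by blast
    \<comment> \<open>Energy 0 at \<open>g0\<close> would make \<open>\<delta>\<close> vanish on the
      image of the invertible \<open>g0\<close>, that is everywhere.\<close>
    have "energy B \<delta> g0 \<noteq> 0"
    proof
      assume "energy B \<delta> g0 = 0"
      then have "\<forall>b\<in>B. (\<Sum>b'\<in>B. (\<delta> (blinfun_apply g0 b) (blinfun_apply g0 b'))\<^sup>2) = 0"
        unfolding energy_def using finite_B by (subst (asm) sum_nonneg_eq_0_iff) (auto intro: sum_nonneg)
      then have z: "\<delta> (blinfun_apply g0 b) (blinfun_apply g0 b') = 0" if "b \<in> B" "b' \<in> B" for b b'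
        using that finite_B by (subst (asm) sum_nonneg_eq_0_iff) auto
      obtain h0 where h0: "g0 o\<^sub>L h0 = id_blinfun" using inv_mem[OF g0(1)] by blast
      have 1: "linear (\<lambda>u. \<delta> u v)" and 2: "linear (\<delta> u)" for u v using bil\<delta> by (auto simp: bilinear_def)
      have zero: "\<delta> (blinfun_apply g0 u) (blinfun_apply g0 v) = 0" for u v
      proof -
        have "blinfun_apply g0 u = (\<Sum>b\<in>B. r b u *\<^sub>R blinfun_apply g0 b)"
          "blinfun_apply g0 v = (\<Sum>b\<in>B. r b v *\<^sub>R blinfun_apply g0 b)"
          using arg_cong[OF expand[of u], of "blinfun_apply g0"] arg_cong[OF expand[of v], of "blinfun_apply g0"]
          by (simp_all add: blinfun.sum_right blinfun.scaleR_right)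
        then show ?thesis
          by (simp add: linear_sum[OF 1] linear_scale[OF 1] linear_sum[OF 2] linear_scale[OF 2] z)
      qed
      have "u = blinfun_apply g0 (blinfun_apply h0 u)" for u
        using arg_cong[OF h0, of "\<lambda>f. blinfun_apply f u"] by simp
      then have "\<delta> u0 v0 = 0" using zero by metis
      then show False using ne by (simp add: \<delta>_def \<beta>'_def)
    qed
    then have m: "energy B \<delta> g0 > 0" using energy_nonneg[of B \<delta> g0] by linarith
    have "energy B \<mu> g \<le> t - energy B \<delta> g0" if g: "g \<in> Hs" for g
    proof -
      have "energy B \<beta> g \<le> t" using t g by blast
      then show ?thesis using par[of g, unfolded add_divide_distrib] en'[OF g] g0(2)[OF g] by linarith
    qed
    then have "t \<le> t - energy B \<delta> g0" using min adm\<mu> by blast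
    then show False using m by simp
  qed
  have pos: "\<beta> u u > 0" if "u \<noteq> 0" for u
  proof -
    have "0 < (norm u)\<^sup>2" using that by simp
    also have "\<dots> \<le> \<beta> u u" using adm[OF one_mem, of u] by simp
    finally show ?thesis .
  qed
  show thesis by (rule that[OF bil sym pos inv])
qed

end

section \<open>Maximal abelian subspaces\<close>

text \<open>The premise \<open>tangent\<close> is a discrete form of a curve in \<open>Hs\<close>
  through the identity with velocity \<open>ad z\<close>; \<open>skew\<close> and
  \<open>orbit_meets_maximal_abelian\<close> differentiate along it.\<close>

locale compact_symmetric = compact_operator_group Hs
  for Hs :: "('a::real_normed_vector \<Rightarrow>\<^sub>L 'a) set" +
  fixes br :: "'a \<Rightarrow> 'a \<Rightarrow> 'a" and s :: "'a \<Rightarrow> 'a"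
  assumes sym: "symmetric_lie_algebra br s" and ss: "semisimple br"
    and comm: "h \<in> Hs \<Longrightarrow> s (blinfun_apply h x) = blinfun_apply h (s x)"
    and tangent: "z \<in> k_part s \<Longrightarrow> \<exists>g t. (\<forall>n::nat. g n \<in> Hs \<and> t n > 0) \<and> g \<longlonglongrightarrow> id_blinfun \<and>
      (\<forall>x. (\<lambda>n. (1 / t n) *\<^sub>R (blinfun_apply (g n) x - x)) \<longlonglongrightarrow> br z x)"
begin

section \<open>Bracket identities and the trace form\<close>

lemma bil: "bilinear br" and br_self: "br x x = 0"
  and jacobi: "br x (br y z) + br y (br z x) + br z (br x y) = 0"
  and lin_s: "linear s" and s_br: "s (br x y) = br (s x) (s y)" and s_s: "s (s x) = x"
  using sym by (auto simp: symmetric_lie_algebra_def lie_algebra_def)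

lemmas br_simps = bilinear_ladd[OF bil] bilinear_radd[OF bil] bilinear_lmul[OF bil] bilinear_rmul[OF bil]
  bilinear_lsub[OF bil] bilinear_rsub[OF bil] bilinear_lneg[OF bil] bilinear_rneg[OF bil] bilinear_lzero[OF bil] bilinear_rzero[OF bil]

lemma br_anti: "br y x = - br x y"
proof -
  have "br (x + y) (x + y) = br x (x + y) + br y (x + y)" by (rule bilinear_ladd[OF bil])
  also have "\<dots> = (br x x + br x y) + (br y x + br y y)" by (simp only: bilinear_radd[OF bil])
  finally have "br y x + br x y = 0" by (simp add: br_self add.commute)
  then show ?thesis by (simp only: eq_neg_iff_add_eq_0)
qed

lemma br_br: "br (br x y) z = br x (br y z) - br y (br x z)"
proof -
  have a: "br (br x y) z = - br z (br x y)" by (rule br_anti)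
  have "br x (br y z) + br y (br z x) = - br z (br x y)" using jacobi[of x y z] by (simp only: eq_neg_iff_add_eq_0)
  then have e: "- br z (br x y) = br x (br y z) + br y (br z x)" by simp
  have "br y (br z x) = - br y (br x z)" by (subst br_anti[of z x]) (simp add: br_simps)
  with a e show ?thesis by simp
qed

lemma subspace_k: "subspace (k_part s)" and subspace_p: "subspace (p_part s)"
  by (simp_all add: subspace_def k_part_def p_part_def linear_0[OF lin_s] linear_add[OF lin_s] linear_scale[OF lin_s])

lemma br_pp: "x \<in> p_part s \<Longrightarrow> y \<in> p_part s \<Longrightarrow> br x y \<in> k_part s"
  by (simp add: k_part_def p_part_def s_br br_simps)

text \<open>The centre is an ideal with vanishing derived algebra, hence solvable.\<close>

lemma center_trivial:
  assumes "\<And>x. br z x = 0" shows "z = 0"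
proof -
  let ?I = "{z. \<forall>x. br z x = 0}"
  have "lie_ideal br ?I"
  proof -
    have "br x y = 0" if "\<forall>w. br y w = 0" for x y using that br_anti[of y x] by simp
    then show ?thesis unfolding lie_ideal_def subspace_def by (simp add: br_simps)
  qed
  moreover have "{br x y | x y. x \<in> ?I \<and> y \<in> ?I} = {0}"
    using bilinear_lzero[OF bil] by (auto intro!: exI[of _ "0::'a"])
  then have "derived_series br ?I (Suc 0) = {0}" by simp
  then have "solvable br ?I" unfolding solvable_def by blast
  ultimately have "?I = {0}" using ss unfolding semisimple_def by blast
  then show ?thesis using assms by auto
qed

text \<open>The invariance is differentiated: the change of \<open>\<beta>\<close> under g splits
  into \<open>\<beta> (g u - u) (g v)\<close> and \<open>\<beta> u (g v - v)\<close>, and both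
  quotients converge.\<close>

lemma skew:
  fixes \<beta> :: "'a \<Rightarrow> 'a \<Rightarrow> real"
  assumes \<beta>: "bilinear \<beta>" and inv: "\<And>h u v. h \<in> Hs \<Longrightarrow> \<beta> (blinfun_apply h u) (blinfun_apply h v) = \<beta> u v"
    and z: "z \<in> k_part s"
  shows "\<beta> (br z u) v + \<beta> u (br z v) = 0"
proof -
  interpret \<beta>: bounded_bilinear \<beta> using finite_dim_bilinear_bounded[OF finite_dim \<beta>] .
  obtain g t where gt: "\<And>n::nat. g n \<in> Hs" "\<And>n. t n > 0" "g \<longlonglongrightarrow> id_blinfun"
    "\<And>x. (\<lambda>n. (1 / t n) *\<^sub>R (blinfun_apply (g n) x - x)) \<longlonglongrightarrow> br z x" using tangent[OF z] by blast
  have "(\<lambda>n. blinfun_apply (g n) v) \<longlonglongrightarrow> blinfun_apply id_blinfun v"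
    by (intro blinfun.tendsto gt(3) tendsto_const)
  then have gv: "(\<lambda>n. blinfun_apply (g n) v) \<longlonglongrightarrow> v" by simp
  have "(\<lambda>n. \<beta> ((1 / t n) *\<^sub>R (blinfun_apply (g n) u - u)) (blinfun_apply (g n) v) + \<beta> u ((1 / t n) *\<^sub>R (blinfun_apply (g n) v - v)))
      \<longlonglongrightarrow> \<beta> (br z u) v + \<beta> u (br z v)"
    by (intro tendsto_add \<beta>.tendsto gt(4) gv tendsto_const)
  moreover have "\<beta> ((1 / t n) *\<^sub>R (blinfun_apply (g n) u - u)) (blinfun_apply (g n) v) + \<beta> u ((1 / t n) *\<^sub>R (blinfun_apply (g n) v - v)) = 0" for n
    by (simp only: \<beta>.scaleR_left \<beta>.scaleR_right \<beta>.diff_left \<beta>.diff_right inv[OF gt(1)] flip: scaleR_add_right) simp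
  ultimately show ?thesis by (simp add: LIMSEQ_const_iff)
qed

text \<open>The trace is computed in an orthonormal basis of the invariant inner product. Its
  cyclicity gives invariance of the form, and skewness of \<open>ad z\<close> makes the value at z
  minus the sum of the squared lengths of \<open>br z e\<close>, which vanishes only for central
  z.\<close>

lemma trace_form:
  obtains \<tau> :: "'a \<Rightarrow> 'a \<Rightarrow> real" where "bilinear \<tau>" "\<forall>x y z. \<tau> (br x y) z = \<tau> x (br y z)"
    "\<forall>z\<in>k_part s. z \<noteq> 0 \<longrightarrow> \<tau> z z < 0"
proof -
  obtain \<beta> where \<beta>: "bilinear \<beta>" "\<And>u v. \<beta> u v = \<beta> v u" "\<And>u. u \<noteq> 0 \<Longrightarrow> \<beta> u u > (0::real)"
    and inv: "\<And>h u v. h \<in> Hs \<Longrightarrow> \<beta> (blinfun_apply h u) (blinfun_apply h v) = \<beta> u v"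
    using invariant_inner_product by blast
  obtain S :: "'a set" where "finite S" "span S = UNIV" using finite_dim by (auto simp: finite_dim_subspace_def)
  with orthonormal_spanning_set[OF \<beta>] obtain N where N: "finite N" "span N = UNIV"
    "\<And>e e'. e \<in> N \<Longrightarrow> e' \<in> N \<Longrightarrow> \<beta> e e' = (if e = e' then 1 else 0)" by metis
  have ex: "(\<Sum>e\<in>N. \<beta> u e *\<^sub>R e) = u" for u using orthonormal_expand[OF \<beta>(1) N(1,3)] N(2) by simp
  have linl: "linear (\<lambda>x. \<beta> x y)" for y using \<beta>(1) by (auto simp: bilinear_def)
  define tr where "tr X = (\<Sum>e\<in>N. \<beta> (X e) e)" for X :: "'a \<Rightarrow> 'a"
  \<comment> \<open>A double sum that becomes symmetric in the two maps once both are
    linear.\<close>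
  have tr_comp: "tr (\<lambda>x. X (Y x)) = (\<Sum>e\<in>N. \<Sum>f\<in>N. \<beta> (Y e) f * \<beta> (X f) e)" if X: "linear X" for X Y
  proof -
    have "\<beta> (X (Y e)) e = (\<Sum>f\<in>N. \<beta> (Y e) f * \<beta> (X f) e)" for e
    proof -
      have "X (Y e) = X (\<Sum>f\<in>N. \<beta> (Y e) f *\<^sub>R f)" using ex by simp
      then show ?thesis by (simp add: linear_sum[OF X] linear_scale[OF X] linear_sum[OF linl] linear_scale[OF linl])
    qed
    then show ?thesis by (simp add: tr_def)
  qed
  have tr_comm: "tr (\<lambda>x. X (Y x)) = tr (\<lambda>x. Y (X x))" if "linear X" "linear Y" for X Y
    unfolding tr_comp[OF that(1)] tr_comp[OF that(2)] by (subst sum.swap) (simp add: mult.commute)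
  have tr_diff: "tr (\<lambda>x. X x - Y x) = tr X - tr Y" for X Y
    by (simp add: tr_def linear_diff[OF linl] sum_subtractf)
  have lin: "linear (br x)" for x using bil by (simp add: bilinear_def)
  define \<tau> where "\<tau> x y = tr (\<lambda>u. br x (br y u))" for x y
  have 1: "bilinear \<tau>"
    unfolding bilinear_def \<tau>_def tr_def
    by (auto intro!: linearI simp: br_simps linear_add[OF linl] linear_scale[OF linl] sum.distrib sum_distrib_left)
  have 2: "\<tau> (br x y) z = \<tau> x (br y z)" for x y z
  proof -
    have "\<tau> (br x y) z = tr (\<lambda>u. br x (br y (br z u))) - tr (\<lambda>u. br y (br x (br z u)))"
      unfolding \<tau>_def br_br tr_diff ..
    \<comment> \<open>Cyclicity moves \<open>ad y\<close> to the end, where it forms the commutator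
      of \<open>ad y\<close> and \<open>ad z\<close>.\<close>
    also have "tr (\<lambda>u. br y (br x (br z u))) = tr (\<lambda>u. br x (br z (br y u)))"
      using tr_comm[OF lin[of y] linear_compose[OF lin[of z] lin[of x]]] by (simp add: o_def)
    also have "tr (\<lambda>u. br x (br y (br z u))) - \<dots> = \<tau> x (br y z)"
      unfolding \<tau>_def br_br bilinear_rsub[OF bil] tr_diff ..
    finally show ?thesis .
  qed
  have 3: "\<tau> z z < 0" if z: "z \<in> k_part s" "z \<noteq> 0" for z
  proof -
    have sk: "\<beta> (br z (br z e)) e = - \<beta> (br z e) (br z e)" for e
      using skew[OF \<beta>(1) inv z(1), of "br z e" e] by linarith
    have "\<exists>e\<in>N. br z e \<noteq> 0"
    proof (rule ccontr)
      assume "\<not> ?thesis"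
      then have "br z x = 0" for x
        using arg_cong[OF ex[of x], of "br z"] by (simp add: linear_sum[OF lin] linear_scale[OF lin])
      then show False using center_trivial z(2) by blast
    qed
    then obtain e0 where e0: "e0 \<in> N" "br z e0 \<noteq> 0" by blast
    have nn: "0 \<le> \<beta> (br z e) (br z e)" for e
      using \<beta>(3)[of "br z e"] linear_0[OF linl] by (cases "br z e = 0") (auto intro: less_imp_le)
    have "0 < (\<Sum>e\<in>N. \<beta> (br z e) (br z e))"
      using N(1) e0 nn \<beta>(3) by (intro sum_pos2[OF N(1) e0(1)]) auto
    then show ?thesis by (simp add: \<tau>_def tr_def sk sum_negf)
  qed
  show thesis using that[of \<tau>] 1 2 3 by blast
qed

text \<open>By invariance of the form, \<open>ad h2\<close> maps the kernel of \<open>ad h1\<close> on \<open>p\<close> into the orthogonal complement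
  of its image, so the kernel of \<open>ad h1 + e ad h2\<close> is the intersection of the kernels for small \<open>e\<close>.\<close>

lemma kernel_perturbation:
  fixes \<tau> :: "'a \<Rightarrow> 'a \<Rightarrow> real"
  assumes \<tau>: "bilinear \<tau>" "\<forall>x y z. \<tau> (br x y) z = \<tau> x (br y z)" "\<forall>z\<in>k_part s. z \<noteq> 0 \<longrightarrow> \<tau> z z < 0"
    and h: "h1 \<in> p_part s" "h2 \<in> p_part s" "br h1 h2 = 0"
  shows "\<exists>e. \<forall>x\<in>p_part s. br (h1 + e *\<^sub>R h2) x = 0 \<longrightarrow> br h1 x = 0 \<and> br h2 x = 0"
proof -
  interpret \<tau>: bounded_bilinear \<tau> using finite_dim_bilinear_bounded[OF finite_dim \<tau>(1)] .
  have lin: "linear (br x)" for x using bil by (simp add: bilinear_def)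
  \<comment> \<open>The image of p under \<open>ad h1\<close> lies in k, where the form is
    definite.\<close>
  define V where "V = br h1 ` p_part s"
  have subV: "subspace V" unfolding V_def by (rule linear_subspace_image[OF lin subspace_p])
  have fV: "finite_dim_subspace V" by (rule finite_dim_subspace_mono[OF finite_dim subV]) simp
  have Vk: "V \<subseteq> k_part s" unfolding V_def using br_pp[OF h(1)] by auto
  obtain B C r where cb: "coordinate_basis V B C r" using finite_dim_coords[OF fV] .
  interpret coordinate_basis V B C r by fact
  have "\<forall>b. \<exists>y. b \<in> B \<longrightarrow> y \<in> p_part s \<and> br h1 y = b" using B_subset unfolding V_def by blast
  then obtain y where y: "\<And>b. b \<in> B \<Longrightarrow> y b \<in> p_part s \<and> br h1 (y b) = b" by metis
  \<comment> \<open>A linear right inverse of \<open>ad h1\<close> on its image; followed by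
    \<open>ad h2\<close> it is bounded.\<close>
  define G where "G v = (\<Sum>b\<in>B. r b v *\<^sub>R y b)" for v
  have Gv: "br h1 (G v) = v" if "v \<in> V" for v
    using expand[OF that] y by (simp add: G_def linear_sum[OF lin] linear_scale[OF lin])
  have Ga: "G (v + w) = G v + G w" if "v \<in> V" "w \<in> V" for v w
    by (simp add: G_def coord_add[OF that] scaleR_left_distrib sum.distrib)
  have Gs: "G (a *\<^sub>R v) = a *\<^sub>R G v" if "v \<in> V" for a v
    by (simp add: G_def coord_scale[OF that] scaleR_sum_right)
  obtain C1 where C1: "C1 > 0" "\<forall>v\<in>V. norm (br h2 (G v)) \<le> C1 * norm v"
    using finite_dim_linear_bound[OF fV, of "\<lambda>v. br h2 (G v)"] by (auto simp: Ga Gs br_simps)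
  have neg: "bounded_bilinear (\<lambda>x y. - \<tau> x y)"
    by (rule bounded_bilinear.comp[OF _ bounded_linear_ident bounded_linear_ident, of "\<lambda>x y. - \<tau> x y"])
      (rule finite_dim_bilinear_bounded[OF finite_dim], auto intro!: linearI simp: bilinear_def \<tau>.add_left \<tau>.add_right \<tau>.scaleR_left \<tau>.scaleR_right)
  obtain c where c: "c > 0" "\<forall>v\<in>V. c * (norm v)\<^sup>2 \<le> - \<tau> v v"
  proof -
    have "0 < - \<tau> x x" if "x \<in> V" "x \<noteq> 0" for x
    proof -
      have "x \<in> k_part s" using Vk that by blast
      then have "\<tau> x x < 0" using \<tau>(3) that by blast
      then show ?thesis by simp
    qed
    from positive_form_lower_bound[OF fV neg this] show thesis using that by blast
  qed
  obtain K where K: "K > 0" "\<And>x y. norm (\<tau> x y) \<le> norm x * norm y * K" using \<tau>.pos_bounded by blast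
  \<comment> \<open>So small that the cross term is at most half of
    \<open>c * (norm v)\<^sup>2\<close>.\<close>
  define e where "e = c / (2 * C1 * K)"
  have e: "e > 0" using c C1 K by (simp add: e_def)
  show ?thesis
  proof (intro exI[of _ e] ballI impI)
    fix x assume x: "x \<in> p_part s" and 0: "br (h1 + e *\<^sub>R h2) x = 0"
    define v where "v = br h1 x"
    have v: "v \<in> V" using x by (simp add: V_def v_def)
    \<comment> \<open>The part of x in the kernel of \<open>ad h1\<close>.\<close>
    define n where "n = x - G v"
    have "br h1 n = v - br h1 (G v)" by (simp add: n_def br_simps v_def)
    then have n: "br h1 n = 0" by (simp only: Gv[OF v] diff_self)
    have "\<tau> v (br h2 n) = 0"
    proof -
      \<comment> \<open>Invariance moves \<open>ad h1\<close> onto \<open>br h2 n\<close>, where it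
        commutes with \<open>ad h2\<close> and annihilates n.\<close>
      have "\<tau> v (br h2 n) = \<tau> (br x (- h1)) (br h2 n)" by (simp add: v_def br_anti[of x h1] br_simps)
      also have "\<dots> = \<tau> x (br (- h1) (br h2 n))" using \<tau>(2) by blast
      also have "br (- h1) (br h2 n) = 0" using br_br[of h1 h2 n] h(3) n by (simp add: br_simps)
      finally show ?thesis by (simp add: \<tau>.zero_right)
    qed
    moreover have "v + e *\<^sub>R (br h2 (G v) + br h2 n) = 0" using 0 by (simp add: v_def n_def br_simps)
    then have "\<tau> v (v + e *\<^sub>R (br h2 (G v) + br h2 n)) = 0" by (simp add: \<tau>.zero_right)
    ultimately have eq: "- \<tau> v v = e * \<tau> v (br h2 (G v))" by (simp add: \<tau>.add_right \<tau>.scaleR_right)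
    have "c * (norm v)\<^sup>2 \<le> - \<tau> v v" using c(2) v by blast
    also have "\<dots> \<le> e * (norm v * norm (br h2 (G v)) * K)"
      unfolding eq using K(2)[of v "br h2 (G v)"] e by (intro mult_left_mono) auto
    also have "\<dots> \<le> e * (norm v * (C1 * norm v) * K)"
      using C1(2) v K(1) e by (intro mult_left_mono mult_right_mono) auto
    also have "\<dots> = c / 2 * (norm v)\<^sup>2" using C1(1) K(1) by (simp add: e_def power2_eq_square)
    finally have "(norm v)\<^sup>2 \<le> 0" using c(1) by (simp add: mult_le_cancel_right zero_le_mult_iff)
    then have "br h1 x = 0" by (simp add: v_def)
    then show "br h1 x = 0 \<and> br h2 x = 0" using 0 e by (simp add: br_simps)
  qed
qed

text \<open>\<open>kernel_perturbation\<close> merges a finite spanning set of \<open>A\<close> into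
  one h such that everything in p commuting with h commutes with \<open>A\<close>. Adjoining such an
  x leaves \<open>A\<close> abelian, so maximality puts x in \<open>A\<close>.\<close>

lemma regular_element:
  fixes \<tau> :: "'a \<Rightarrow> 'a \<Rightarrow> real"
  assumes \<tau>: "bilinear \<tau>" "\<forall>x y z. \<tau> (br x y) z = \<tau> x (br y z)" "\<forall>z\<in>k_part s. z \<noteq> 0 \<longrightarrow> \<tau> z z < 0"
    and max: "maximal_abelian_subspace br s A"
  obtains h where "h \<in> A" "\<And>x. x \<in> p_part s \<Longrightarrow> br h x = 0 \<Longrightarrow> x \<in> A"
proof -
  have A: "subspace A" "A \<subseteq> p_part s" "\<And>x y. x \<in> A \<Longrightarrow> y \<in> A \<Longrightarrow> br x y = 0"
    and mx: "\<And>B. abelian_subspace br s B \<Longrightarrow> A \<subseteq> B \<Longrightarrow> B = A"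
    using max by (auto simp: maximal_abelian_subspace_def abelian_subspace_def)
  obtain S where S: "finite S" "span S = A"
    using finite_dim_subspace_mono[OF finite_dim A(1)] by (auto simp: finite_dim_subspace_def)
  have "S' \<subseteq> A \<Longrightarrow> \<exists>h\<in>A. \<forall>x\<in>p_part s. br h x = 0 \<longrightarrow> (\<forall>a\<in>S'. br a x = 0)" if "finite S'" for S'
    using that
  proof (induction S' rule: finite_induct)
    case empty then show ?case using A(1) subspace_0 by blast
  next
    case (insert a S')
    then obtain h1 where h1: "h1 \<in> A" "\<forall>x\<in>p_part s. br h1 x = 0 \<longrightarrow> (\<forall>a\<in>S'. br a x = 0)" by auto
    have a: "a \<in> A" using insert by blast
    obtain e where e: "\<forall>x\<in>p_part s. br (h1 + e *\<^sub>R a) x = 0 \<longrightarrow> br h1 x = 0 \<and> br a x = 0"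
      using kernel_perturbation[OF \<tau>, of h1 a] A h1(1) a by blast
    have "h1 + e *\<^sub>R a \<in> A" using h1(1) a A(1) by (simp add: subspace_add subspace_scale)
    then show ?case using e h1(2) by blast
  qed
  from this[OF S(1)] S(2) obtain h where h: "h \<in> A" "\<And>x a. x \<in> p_part s \<Longrightarrow> br h x = 0 \<Longrightarrow> a \<in> S \<Longrightarrow> br a x = 0"
    using span_superset by blast
  have "x \<in> A" if x: "x \<in> p_part s" "br h x = 0" for x
  proof -
    have comm: "br a x = 0" if "a \<in> A" for a
    proof -
      have "a \<in> span S" using that S(2) by simp
      then show ?thesis
        by (induction rule: span_induct_alt) (use h(2)[OF x] in \<open>auto simp: br_simps\<close>)
    qed
    have comm': "br x a = 0" if "a \<in> A" for a using comm[OF that] br_anti[of x a] by simp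
    let ?B = "{a + c *\<^sub>R x | a c. a \<in> A}"
    have "abelian_subspace br s ?B"
      unfolding abelian_subspace_def
    proof (intro conjI ballI)
      show "subspace ?B"
      proof (rule subspaceI)
        show "0 \<in> ?B" using A(1) by (auto intro!: exI[of _ "0::'a"] exI[of _ "0::real"] simp: subspace_0)
        fix u v assume "u \<in> ?B" "v \<in> ?B"
        then obtain a c b d where "u = a + c *\<^sub>R x" "v = b + d *\<^sub>R x" "a \<in> A" "b \<in> A" by blast
        then have "u + v = (a + b) + (c + d) *\<^sub>R x" "a + b \<in> A" using A(1) by (simp_all add: algebra_simps subspace_add)
        then show "u + v \<in> ?B" by blast
      next
        fix k u assume "u \<in> ?B"
        then obtain a c where "u = a + c *\<^sub>R x" "a \<in> A" by blast
        then have "k *\<^sub>R u = k *\<^sub>R a + (k * c) *\<^sub>R x" "k *\<^sub>R a \<in> A" using A(1) by (simp_all add: algebra_simps subspace_scale)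
        then show "k *\<^sub>R u \<in> ?B" by blast
      qed
      show "?B \<subseteq> p_part s" using A(2) x(1) subspace_p by (auto intro!: subspace_add subspace_scale)
      fix u v assume "u \<in> ?B" "v \<in> ?B"
      then obtain a c b d where "u = a + c *\<^sub>R x" "v = b + d *\<^sub>R x" "a \<in> A" "b \<in> A" by blast
      then show "br u v = 0" using A(3) comm comm' by (simp add: br_simps br_self)
    qed
    moreover have "A \<subseteq> ?B" by (force intro: exI[of _ "0::real"])
    ultimately have "?B = A" by (rule mx)
    moreover have "x \<in> ?B" using A(1) by (auto intro!: exI[of _ "0::'a"] exI[of _ "1::real"] simp: subspace_0)
    ultimately show ?thesis by blast
  qed
  then show thesis using that h(1) by blast
qed

lemma orbit_meets_maximal_abelian:
  assumes max: "maximal_abelian_subspace br s A" and x: "x \<in> p_part s"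
  shows "\<exists>g\<in>Hs. blinfun_apply g x \<in> A"
proof -
  obtain \<tau> where \<tau>: "bilinear \<tau>" "\<forall>x y z. \<tau> (br x y) z = \<tau> x (br y z)"
    "\<forall>z\<in>k_part s. z \<noteq> 0 \<longrightarrow> \<tau> z z < (0::real)" using trace_form by metis
  interpret \<tau>: bounded_bilinear \<tau> using finite_dim_bilinear_bounded[OF finite_dim \<tau>(1)] .
  obtain h where h: "h \<in> A" "\<And>x. x \<in> p_part s \<Longrightarrow> br h x = 0 \<Longrightarrow> x \<in> A" using regular_element[OF \<tau> max] by blast
  have hp: "h \<in> p_part s" using h(1) max by (auto simp: maximal_abelian_subspace_def abelian_subspace_def)
  have "continuous_on Hs (\<lambda>g. \<tau> (blinfun_apply g x) h)" by (intro \<tau>.continuous_on continuous_intros)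
  then obtain g0 where g0: "g0 \<in> Hs" "\<And>g. g \<in> Hs \<Longrightarrow> \<tau> (blinfun_apply g0 x) h \<le> \<tau> (blinfun_apply g x) h"
    using continuous_attains_inf[OF compact] one_mem by blast
  define y where "y = blinfun_apply g0 x"
  have yp: "y \<in> p_part s" using comm[OF g0(1), of x] x by (simp add: y_def p_part_def blinfun.minus_right)
  \<comment> \<open>At a minimum the one-sided difference quotients along directions of k are
    nonnegative.\<close>
  have ge: "0 \<le> \<tau> (br z y) h" if z: "z \<in> k_part s" for z
  proof -
    obtain g t where gt: "\<And>n::nat. g n \<in> Hs" "\<And>n. t n > 0"
      "\<And>x. (\<lambda>n. (1 / t n) *\<^sub>R (blinfun_apply (g n) x - x)) \<longlonglongrightarrow> br z x" using tangent[OF z] by blast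
    have "(\<lambda>n. \<tau> ((1 / t n) *\<^sub>R (blinfun_apply (g n) y - y)) h) \<longlonglongrightarrow> \<tau> (br z y) h"
      by (intro \<tau>.tendsto gt(3) tendsto_const)
    moreover have "0 \<le> \<tau> ((1 / t n) *\<^sub>R (blinfun_apply (g n) y - y)) h" for n
      using g0(2)[OF mult_mem[OF gt(1) g0(1)], of n] gt(2)[of n]
      by (simp add: \<tau>.scaleR_left \<tau>.diff_left y_def)
    ultimately show ?thesis by (intro LIMSEQ_le_const) auto
  qed
  have zero: "\<tau> z (br y h) = 0" if z: "z \<in> k_part s" for z
  proof -
    \<comment> \<open>The opposite direction turns the inequality into an equality.\<close>
    have "- z \<in> k_part s" using z subspace_k by (simp add: subspace_neg)
    then have "0 \<le> - \<tau> (br z y) h" using ge[of "- z"] by (simp add: br_simps \<tau>.minus_left)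
    then have "\<tau> (br z y) h = 0" using ge[OF z] by simp
    then show ?thesis using \<tau>(2) by simp
  qed
  \<comment> \<open>Take z = \<open>br y h\<close>, which lies in k as a bracket of elements of p;
    there the form is definite.\<close>
  have "br y h = 0"
    using zero[OF br_pp[OF yp hp]] \<tau>(3) br_pp[OF yp hp] by force
  then have "br h y = 0" using br_anti[of h y] by simp
  then show ?thesis using h(2)[OF yp] g0(1) by (auto simp: y_def)
qed

end

section \<open>Measurable selection\<close>

lemma measurable_borel_of_iff:
  "f \<in> \<Omega> \<rightarrow>\<^sub>M borel_of X \<longleftrightarrow> f \<in> space \<Omega> \<rightarrow> topspace X \<and> (\<forall>S. openin X S \<longrightarrow> {\<omega> \<in> space \<Omega>. f \<omega> \<in> S} \<in> sets \<Omega>)"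
proof
  have sub: "{S. openin X S} \<subseteq> Pow (topspace X)" using openin_subset by blast
  assume f: "f \<in> \<Omega> \<rightarrow>\<^sub>M borel_of X"
  have "{\<omega> \<in> space \<Omega>. f \<omega> \<in> S} \<in> sets \<Omega>" if S: "openin X S" for S
  proof -
    have "S \<in> sets (borel_of X)" unfolding borel_of_def using S sub by (simp add: sets_measure_of)
    from measurable_sets[OF f this] show ?thesis by (simp add: vimage_def Int_def conj_commute)
  qed
  moreover have "space (borel_of X) = topspace X" unfolding borel_of_def using sub by (simp add: space_measure_of)
  ultimately show "f \<in> space \<Omega> \<rightarrow> topspace X \<and> (\<forall>S. openin X S \<longrightarrow> {\<omega> \<in> space \<Omega>. f \<omega> \<in> S} \<in> sets \<Omega>)"
    using measurable_space[OF f] by auto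
next
  assume f: "f \<in> space \<Omega> \<rightarrow> topspace X \<and> (\<forall>S. openin X S \<longrightarrow> {\<omega> \<in> space \<Omega>. f \<omega> \<in> S} \<in> sets \<Omega>)"
  show "f \<in> \<Omega> \<rightarrow>\<^sub>M borel_of X"
    unfolding borel_of_def
  proof (rule measurable_measure_of)
    show "{S. openin X S} \<subseteq> Pow (topspace X)" using openin_subset by blast
    show "f \<in> space \<Omega> \<rightarrow> topspace X" using f by blast
    show "f -` S \<inter> space \<Omega> \<in> sets \<Omega>" if "S \<in> {S. openin X S}" for S
      using f that by (simp add: vimage_def Int_def conj_commute)
  qed
qed

text \<open>The compact closures of base sets are countably many and still small: a base set around
  x lies in a compact subset of \<open>W\<close>, which is closed in a Hausdorff space and so
  contains the closure.\<close>

lemma manifold_compact_base: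
  assumes M: "topological_atlas M" and E: "finite_dim_subspace (model M)"
    and X: "Hausdorff_space (manifold_topology M)" "second_countable (manifold_topology M)"
  obtains C :: "nat \<Rightarrow> 'p set" where "\<And>n. compactin (manifold_topology (M :: ('p, 'e::real_normed_vector) manifold)) (C n)"
    "\<And>W x. openin (manifold_topology M) W \<Longrightarrow> x \<in> W \<Longrightarrow> \<exists>n. x \<in> C n \<and> C n \<subseteq> W"
proof -
  let ?X = "manifold_topology M"
  obtain \<B> where \<B>: "countable \<B>" "\<forall>V\<in>\<B>. openin ?X V" "\<forall>U x. openin ?X U \<and> x \<in> U \<longrightarrow> (\<exists>V\<in>\<B>. x \<in> V \<and> V \<subseteq> U)"
    using X(2) unfolding second_countable_def by blast
  \<comment> \<open>The empty set makes the family nonempty, as its enumeration requires.\<close>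
  define \<C> where "\<C> = insert {} {K \<in> (\<lambda>B. ?X closure_of B) ` \<B>. compactin ?X K}"
  have c: "countable \<C>" using \<B>(1) by (simp add: \<C>_def)
  have ne: "\<C> \<noteq> {}" by (simp add: \<C>_def)
  show thesis
  proof (rule that[of "from_nat_into \<C>"])
    show "compactin ?X (from_nat_into \<C> n)" for n
      using from_nat_into[OF ne, of n] by (auto simp: \<C>_def)
    fix W x assume W: "openin ?X W" "x \<in> W"
    obtain V K where VK: "openin ?X V" "x \<in> V" "V \<subseteq> K" "K \<subseteq> W" "compactin ?X K"
      using manifold_compact_neighbourhood[OF M E W] .
    obtain B where B: "B \<in> \<B>" "x \<in> B" "B \<subseteq> V" using \<B>(3) VK by blast
    have "?X closure_of B \<subseteq> K"
      using B VK compactin_imp_closedin[OF X(1) VK(5)] by (intro closure_of_minimal) auto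
    moreover have "compactin ?X (?X closure_of B)"
      by (rule closed_compactin[OF VK(5) calculation closedin_closure_of])
    moreover have "x \<in> ?X closure_of B"
      using B closure_of_subset[of B ?X] openin_subset[of ?X B] \<B>(2) by blast
    ultimately have "?X closure_of B \<in> \<C>" "x \<in> ?X closure_of B" "?X closure_of B \<subseteq> W"
      using B VK(4) by (auto simp: \<C>_def)
    moreover obtain n where "from_nat_into \<C> n = ?X closure_of B"
      using from_nat_into_surj[OF c calculation(1)] by blast
    ultimately show "\<exists>n. x \<in> from_nat_into \<C> n \<and> from_nat_into \<C> n \<subseteq> W" by metis
  qed
qed

text \<open>Shrinking \<open>F \<omega>\<close> along an enumeration of small compact sets, keeping it nonempty, leaves a single
  point; each step depends measurably on \<open>\<omega>\<close>.\<close>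

lemma measurable_selection:
  fixes X :: "'p topology" and F :: "'w \<Rightarrow> 'p set" and C :: "nat \<Rightarrow> 'p set"
  assumes H: "Hausdorff_space X" and C: "\<And>n. compactin X (C n)"
    and base: "\<And>W x. openin X W \<Longrightarrow> x \<in> W \<Longrightarrow> \<exists>n. x \<in> C n \<and> C n \<subseteq> W"
    and F: "\<And>\<omega>. \<omega> \<in> space \<Omega> \<Longrightarrow> F \<omega> \<noteq> {}" "\<And>\<omega>. \<omega> \<in> space \<Omega> \<Longrightarrow> closedin X (F \<omega>)"
    and meas: "\<And>D. compactin X D \<Longrightarrow> {\<omega> \<in> space \<Omega>. F \<omega> \<inter> D \<noteq> {}} \<in> sets \<Omega>"
  shows "\<exists>V. V \<in> \<Omega> \<rightarrow>\<^sub>M borel_of X \<and> (\<forall>\<omega>\<in>space \<Omega>. V \<omega> \<in> F \<omega>)"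
proof -
  define Dn where "Dn = rec_nat (\<lambda>\<omega>. topspace X) (\<lambda>n D \<omega>. if F \<omega> \<inter> D \<omega> \<inter> C n \<noteq> {} then D \<omega> \<inter> C n else D \<omega>)"
  have Dn0: "Dn 0 \<omega> = topspace X" and DnS: "Dn (Suc n) \<omega> = (if F \<omega> \<inter> Dn n \<omega> \<inter> C n \<noteq> {} then Dn n \<omega> \<inter> C n else Dn n \<omega>)" for n \<omega>
    by (simp_all add: Dn_def)
  \<comment> \<open>A finite family containing every possible value of \<open>Dn n\<close>, so that
    events about \<open>Dn n \<omega>\<close> become finite unions over fixed sets.\<close>
  define fam where "fam = rec_nat {topspace X} (\<lambda>n Fm. Fm \<union> (\<lambda>D. D \<inter> C n) ` Fm)"
  have fam0: "fam 0 = {topspace X}" and famS: "fam (Suc n) = fam n \<union> (\<lambda>D. D \<inter> C n) ` fam n" for n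
    by (simp_all add: fam_def)
  have finfam: "finite (fam n)" for n by (induction n) (simp_all add: fam0 famS)
  have Dnfam: "Dn n \<omega> \<in> fam n" for n \<omega> by (induction n) (simp_all add: fam0 famS Dn0 DnS)
  have cl: "closedin X D" if "D \<in> fam n" for n D
    using that by (induction n arbitrary: D) (auto simp: fam0 famS intro: closedin_Int compactin_imp_closedin[OF H C])
  have comp: "compactin X (D \<inter> C m)" if "D \<in> fam n" for n m D
    by (rule closed_Int_compactin[OF cl[OF that] C])
  have hit: "{\<omega> \<in> space \<Omega>. F \<omega> \<inter> D \<inter> C m \<noteq> {}} \<in> sets \<Omega>" if "D \<in> fam n" for n m D
    using meas[OF comp[OF that, of m]] by (simp add: Int_assoc)
  have Dmeas: "{\<omega> \<in> space \<Omega>. Dn n \<omega> = D} \<in> sets \<Omega>" for n D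
  proof (induction n arbitrary: D)
    case 0 then show ?case by (cases "topspace X = D") (simp_all add: Dn0)
  next
    case (Suc n)
    let ?hit = "\<lambda>D'. {\<omega> \<in> space \<Omega>. F \<omega> \<inter> D' \<inter> C n \<noteq> {}}"
    \<comment> \<open>For each fixed previous value D', acceptance of the set \<open>C n\<close> is
      a measurable event.\<close>
    have "{\<omega> \<in> space \<Omega>. Dn (Suc n) \<omega> = D} =
        (\<Union>D'\<in>fam n. {\<omega> \<in> space \<Omega>. Dn n \<omega> = D'} \<inter>
          ((if D' \<inter> C n = D then ?hit D' else {}) \<union> (if D' = D then space \<Omega> - ?hit D' else {})))"
      using Dnfam[of n] by (auto simp: DnS split: if_splits)
    also have "\<dots> \<in> sets \<Omega>"
      using Suc.IH hit by (intro sets.finite_UN finfam sets.Int sets.Un) auto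
    finally show ?case .
  qed
  have V: "\<exists>x. \<forall>n. x \<in> F \<omega> \<inter> Dn n \<omega>" "\<And>x y. \<forall>n. x \<in> F \<omega> \<inter> Dn n \<omega> \<Longrightarrow> \<forall>n. y \<in> F \<omega> \<inter> Dn n \<omega> \<Longrightarrow> x = y"
    if \<omega>: "\<omega> \<in> space \<Omega>" for \<omega>
  proof -
    let ?G = "\<lambda>n. F \<omega> \<inter> Dn n \<omega>"
    have Ft: "F \<omega> \<subseteq> topspace X" using F(2)[OF \<omega>] closedin_subset by blast
    have ne: "?G n \<noteq> {}" for n
      by (induction n) (use F(1)[OF \<omega>] Ft in \<open>auto simp: Dn0 DnS\<close>)
    have dec: "?G m \<subseteq> ?G n" if "n \<le> m" for m n
      using that by (induction rule: dec_induct) (auto simp: DnS split: if_splits)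
    have clG: "closedin X (?G n)" for n by (intro closedin_Int F(2)[OF \<omega>] cl[OF Dnfam])
    \<comment> \<open>If no set were ever accepted, \<open>Dn\<close> would remain the whole space,
      although some \<open>C n\<close> contains a given point of \<open>F \<omega>\<close>. From an
      accepted step on, everything lies in one compact set.\<close>
    have "\<exists>n. ?G n \<inter> C n \<noteq> {}"
    proof (rule ccontr)
      assume no: "\<not> ?thesis"
      have Dt: "Dn n \<omega> = topspace X" for n by (induction n) (use no in \<open>auto simp: Dn0 DnS\<close>)
      obtain x where x: "x \<in> F \<omega>" using F(1)[OF \<omega>] by blast
      then obtain n where "x \<in> C n" using base[OF openin_topspace, of x] Ft by blast
      then show False using no x Ft Dt by blast
    qed
    then obtain n0 where n0: "?G n0 \<inter> C n0 \<noteq> {}" by blast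
    then have G0: "?G (Suc n0) \<subseteq> C n0" by (auto simp: DnS)
    have "C n0 \<inter> \<Inter>(range ?G) \<noteq> {}"
    proof -
      have "C n0 \<inter> \<Inter>\<F> \<noteq> {}" if fin: "finite \<F>" "\<F> \<subseteq> range ?G" for \<F>
      proof -
        obtain I where I: "finite I" "\<F> = ?G ` I" using finite_subset_image[OF fin] by blast
        define N where "N = Max (insert (Suc n0) I)"
        have N: "Suc n0 \<le> N" "\<And>i. i \<in> I \<Longrightarrow> i \<le> N" using I(1) by (auto simp: N_def)
        have "?G N \<subseteq> C n0" using dec[OF N(1)] G0 by blast
        moreover have "?G N \<subseteq> \<Inter>\<F>" using dec[OF N(2)] I(2) by blast
        ultimately show ?thesis using ne[of N] by blast
      qed
      moreover have "\<forall>\<U>. (\<forall>S\<in>\<U>. closedin X S) \<and> (\<forall>\<F>. finite \<F> \<and> \<F> \<subseteq> \<U> \<longrightarrow> C n0 \<inter> \<Inter>\<F> \<noteq> {}) \<longrightarrow> C n0 \<inter> \<Inter>\<U> \<noteq> {}"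
        using C[of n0] unfolding compactin_fip by (rule conjunct2)
      moreover have "\<forall>S\<in>range ?G. closedin X S" using clG by blast
      ultimately show ?thesis by (elim allE[of _ "range ?G"]) simp
    qed
    then show "\<exists>x. \<forall>n. x \<in> ?G n" by blast
    fix x y assume x: "\<forall>n. x \<in> ?G n" and y: "\<forall>n. y \<in> ?G n"
    show "x = y"
    proof (rule ccontr)
      assume "x \<noteq> y"
      have "y \<in> topspace X" using y Ft by blast
      then have "closedin X {y}" using closedin_Hausdorff_singleton[OF H] by blast
      then have "openin X (topspace X - {y})" by blast
      moreover have "x \<in> topspace X - {y}" using x Ft \<open>x \<noteq> y\<close> by blast
      \<comment> \<open>A set \<open>C n\<close> that contains x but not y is accepted, as x belongs
        to all stages; this excludes y.\<close>
      ultimately obtain n where n: "x \<in> C n" "C n \<subseteq> topspace X - {y}" using base by blast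
      then have "?G n \<inter> C n \<noteq> {}" using x by blast
      then have "?G (Suc n) \<subseteq> C n" by (auto simp: DnS)
      then show False using y n(2) by blast
    qed
  qed
  define V where "V \<omega> = (SOME x. \<forall>n. x \<in> F \<omega> \<inter> Dn n \<omega>)" for \<omega>
  have V1: "\<forall>n. V \<omega> \<in> F \<omega> \<inter> Dn n \<omega>" if "\<omega> \<in> space \<Omega>" for \<omega>
    unfolding V_def by (rule someI_ex[OF V(1)[OF that]])
  have VF: "V \<omega> \<in> F \<omega>" if "\<omega> \<in> space \<Omega>" for \<omega> using V1[OF that] by blast
  \<comment> \<open>Membership of the selected point in \<open>C m\<close> is decided at step m,
    which reduces measurability of V to events already known.\<close>
  have VC: "V \<omega> \<in> C m \<longleftrightarrow> F \<omega> \<inter> Dn m \<omega> \<inter> C m \<noteq> {}" if "\<omega> \<in> space \<Omega>" for \<omega> m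
  proof
    show "V \<omega> \<in> C m \<Longrightarrow> F \<omega> \<inter> Dn m \<omega> \<inter> C m \<noteq> {}" using V1[OF that] by blast
    assume "F \<omega> \<inter> Dn m \<omega> \<inter> C m \<noteq> {}"
    then have "Dn (Suc m) \<omega> \<subseteq> C m" by (simp add: DnS)
    then show "V \<omega> \<in> C m" using V1[OF that] by blast
  qed
  have VCm: "{\<omega> \<in> space \<Omega>. V \<omega> \<in> C m} \<in> sets \<Omega>" for m
  proof -
    have "{\<omega> \<in> space \<Omega>. V \<omega> \<in> C m} =
        (\<Union>D\<in>fam m. {\<omega> \<in> space \<Omega>. Dn m \<omega> = D} \<inter> {\<omega> \<in> space \<Omega>. F \<omega> \<inter> D \<inter> C m \<noteq> {}})"
      using Dnfam[of m] VC by auto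
    also have "\<dots> \<in> sets \<Omega>" using Dmeas hit by (intro sets.finite_UN finfam sets.Int) auto
    finally show ?thesis .
  qed
  have "V \<in> \<Omega> \<rightarrow>\<^sub>M borel_of X"
    unfolding measurable_borel_of_iff
  proof (intro conjI allI impI)
    show "V \<in> space \<Omega> \<rightarrow> topspace X" using VF F(2) closedin_subset by blast
    fix W assume W: "openin X W"
    have "{\<omega> \<in> space \<Omega>. V \<omega> \<in> W} = (\<Union>m\<in>{m. C m \<subseteq> W}. {\<omega> \<in> space \<Omega>. V \<omega> \<in> C m})"
      using base[OF W] by blast
    also have "\<dots> \<in> sets \<Omega>" using VCm by (intro sets.countable_UN') auto
    finally show "{\<omega> \<in> space \<Omega>. V \<omega> \<in> W} \<in> sets \<Omega>" .
  qed
  then show ?thesis using VF by blast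
qed

text \<open>The sort of the target type does not include second countability, on which measurability
  of sums relies. The coordinates are therefore collected in \<open>nat \<Rightarrow> real\<close>
  and mapped back by a continuous function.\<close>

lemma (in coordinate_basis) borel_measurable_coords:
  assumes E: "E = UNIV" and f: "\<And>b. b \<in> B \<Longrightarrow> (\<lambda>\<omega>. r b (f \<omega>)) \<in> borel_measurable \<Omega>"
  shows "f \<in> borel_measurable \<Omega>"
proof -
  obtain e where e: "bij_betw e {0..<card B} B" using ex_bij_betw_nat_finite[OF finite_B] by blast
  define c where "c \<omega> i = (if i < card B then r (e i) (f \<omega>) else 0)" for \<omega> and i :: nat
  define \<Phi> where "\<Phi> x = (\<Sum>i\<in>{0..<card B}. x i *\<^sub>R e i)" for x :: "nat \<Rightarrow> real"
  have eB: "e i \<in> B" if "i < card B" for i using e that by (auto simp: bij_betw_def)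
  have "c \<in> borel_measurable \<Omega>"
  proof (rule measurable_coordinatewise_then_product)
    show "(\<lambda>\<omega>. c \<omega> i) \<in> borel_measurable \<Omega>" for i
      using f[OF eB] by (cases "i < card B") (simp_all add: c_def)
  qed
  moreover have "continuous_on UNIV \<Phi>"
    unfolding \<Phi>_def[abs_def] by (intro continuous_intros continuous_on_product_coordinates)
  then have "\<Phi> \<in> borel_measurable borel" by (rule borel_measurable_continuous_onI)
  ultimately have "(\<lambda>\<omega>. \<Phi> (c \<omega>)) \<in> borel_measurable \<Omega>" by (rule measurable_compose)
  moreover have "\<Phi> (c \<omega>) = f \<omega>" for \<omega>
  proof -
    have "\<Phi> (c \<omega>) = (\<Sum>i\<in>{0..<card B}. r (e i) (f \<omega>) *\<^sub>R e i)" unfolding \<Phi>_def c_def by (intro sum.cong) auto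
    also have "\<dots> = (\<Sum>b\<in>B. r b (f \<omega>) *\<^sub>R b)" by (rule sum.reindex_bij_betw[OF e])
    also have "\<dots> = f \<omega>" using expand E by simp
    finally show ?thesis .
  qed
  ultimately show ?thesis by simp
qed

section \<open>The measurable decomposition\<close>

context orthogonal_pair
begin

text \<open>The sequence consists of the points with coordinates \<open>t n *\<^sub>R v\<close> in
  \<open>H\<close>, where \<open>T v = ad z\<close> and \<open>t n\<close> tends to 0.\<close>

lemma H_tangent:
  assumes z: "z \<in> k_part s"
  shows "\<exists>g t. (\<forall>n::nat. g n \<in> carrier H \<and> t n > 0) \<and> g \<longlonglongrightarrow> id_blinfun \<and>
      (\<forall>x. (\<lambda>n. (1 / t n) *\<^sub>R (blinfun_apply (g n) x - x)) \<longlonglongrightarrow> br z x)"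
proof -
  interpret T: bounded_linear T using T has_derivative_bounded_linear by blast
  obtain v where v: "v \<in> HH.E" "T v = ad z" using T_onto[OF z] by blast
  obtain r where r: "r > 0" "\<forall>v\<in>HH.E. norm v < r \<longrightarrow> HH.\<kappa> v \<in> HH.U0 \<and> HH.\<kappa> v \<in> HH.U0 \<and> HH.\<phi>0 (HH.\<kappa> v) = HH.e0 + v"
    using HH.\<kappa>_ball[OF HH.openin_U0 HH.chart0(2)] .
  \<comment> \<open>Since \<open>t n \<le> c\<close> and \<open>c * norm v < r\<close>, all these
    points stay within the chart; the 1 avoids division by 0 when v vanishes.\<close>
  define c where "c = r / (norm v + 1)"
  have nv: "norm v + 1 > 0" by (intro add_nonneg_pos) auto
  have c: "c > 0" using r nv by (simp add: c_def)
  have cv: "c * norm v < r"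
  proof -
    have "c * norm v < c * (norm v + 1)" using c by simp
    also have "\<dots> = r" using nv by (simp add: c_def)
    finally show ?thesis .
  qed
  define t where "t n = c * (1 / real (Suc n))" for n
  define g where "g n = HH.\<kappa> (t n *\<^sub>R v)" for n
  have t0: "t n > 0" and tE: "t n *\<^sub>R v \<in> HH.E" for n
    using c v HH.subspace_E by (simp_all add: t_def subspace_scale)
  have tlim: "t \<longlonglongrightarrow> 0"
    using tendsto_mult_right_zero[OF LIMSEQ_inverse_real_of_nat, of c] by (simp add: t_def[abs_def] inverse_eq_divide)
  have gH: "g n \<in> carrier H" for n
  proof -
    have "t n \<le> c * 1" unfolding t_def using c by (intro mult_left_mono) auto
    then have "norm (t n *\<^sub>R v) \<le> c * norm v" using t0[of n] by (simp add: mult_right_mono)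
    then show ?thesis using r(2) tE[of n] cv HH.U0_carrier unfolding g_def by (metis order_le_less_trans)
  qed
  have lim: "(\<lambda>n. (1 / t n) *\<^sub>R (g n - id_blinfun)) \<longlonglongrightarrow> ad z"
  proof (rule LIMSEQ_I)
    fix \<epsilon> :: real assume e: "\<epsilon> > 0"
    have e': "\<epsilon> / (norm v + 1) > 0" using e nv by simp
    obtain d where d: "d > 0" "\<forall>u\<in>HH.E. norm u < d \<longrightarrow> norm (HH.\<kappa> u - id_blinfun - T u) \<le> \<epsilon> / (norm v + 1) * norm u"
      using H_estimate[OF e'] by blast
    have "(\<lambda>n. norm (t n *\<^sub>R v)) \<longlonglongrightarrow> norm (0 *\<^sub>R v)" by (intro tendsto_intros tlim)
    then have "(\<lambda>n. norm (t n *\<^sub>R v)) \<longlonglongrightarrow> 0" by simp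
    from LIMSEQ_D[OF this d(1)] obtain N where N: "\<And>n. n \<ge> N \<Longrightarrow> norm (t n *\<^sub>R v) < d" by auto
    have "norm ((1 / t n) *\<^sub>R (g n - id_blinfun) - ad z) < \<epsilon>" if n: "n \<ge> N" for n
    proof -
      have 1: "norm (g n - id_blinfun - T (t n *\<^sub>R v)) \<le> \<epsilon> / (norm v + 1) * norm (t n *\<^sub>R v)"
        unfolding g_def using d(2) tE N[OF n] by blast
      have "(1 / t n) *\<^sub>R (g n - id_blinfun) - ad z = (1 / t n) *\<^sub>R (g n - id_blinfun - T (t n *\<^sub>R v))"
        using t0[of n] by (simp add: T.scale v(2) scaleR_right_diff_distrib)
      then have "norm ((1 / t n) *\<^sub>R (g n - id_blinfun) - ad z) = (1 / t n) * norm (g n - id_blinfun - T (t n *\<^sub>R v))"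
        using t0[of n] by simp
      also have "\<dots> \<le> (1 / t n) * (\<epsilon> / (norm v + 1) * norm (t n *\<^sub>R v))" using t0[of n] 1 by (intro mult_left_mono) auto
      also have "\<dots> = \<epsilon> / (norm v + 1) * norm v" using t0[of n] by simp
      also have "\<dots> < \<epsilon> / (norm v + 1) * (norm v + 1)" using e' by (intro mult_strict_left_mono) auto
      also have "\<dots> = \<epsilon>" using nv by simp
      finally show ?thesis .
    qed
    then show "\<exists>N. \<forall>n\<ge>N. norm ((1 / t n) *\<^sub>R (g n - id_blinfun) - ad z) < \<epsilon>" by blast
  qed
  have "(\<lambda>n. id_blinfun + t n *\<^sub>R ((1 / t n) *\<^sub>R (g n - id_blinfun))) \<longlonglongrightarrow> id_blinfun + 0 *\<^sub>R ad z"
    by (intro tendsto_intros tlim lim)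
  moreover have "id_blinfun + t n *\<^sub>R ((1 / t n) *\<^sub>R (g n - id_blinfun)) = g n" for n using t0[of n] by simp
  ultimately have "g \<longlonglongrightarrow> id_blinfun" by simp
  moreover have "(\<lambda>n. (1 / t n) *\<^sub>R (blinfun_apply (g n) x - x)) \<longlonglongrightarrow> br z x" for x
  proof -
    have "(\<lambda>n. blinfun_apply ((1 / t n) *\<^sub>R (g n - id_blinfun)) x) \<longlonglongrightarrow> blinfun_apply (ad z) x"
      by (intro blinfun.tendsto lim tendsto_const)
    then show ?thesis by (simp add: blinfun.scaleR_left blinfun.diff_left)
  qed
  ultimately show ?thesis using gH t0 by blast
qed

text \<open>\<open>H\<close> enters as a compact group of operators, and \<open>H_lift\<close> turns
  the operator found in it into an element of \<open>K\<close>.\<close>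

lemma orbit_meets:
  assumes ss: "semisimple br" and max: "maximal_abelian_subspace br s A" and x: "x \<in> p_part s"
  shows "\<exists>k\<in>carrier K. blinfun_apply (AdB k) x \<in> A"
proof -
  interpret compact_symmetric "carrier H" br s
  proof unfold_locales
    show "finite_dim_subspace (UNIV :: 'a set)" by (rule finite_dim)
    show "compact (carrier H)" by (rule H_compact)
    show "id_blinfun \<in> carrier H" using HH.one_closed H_one by simp
    show "g o\<^sub>L h \<in> carrier H" if "g \<in> carrier H" "h \<in> carrier H" for g h
      using HH.m_closed[OF that] H_mult[OF that] by simp
    show "\<exists>h\<in>carrier H. h o\<^sub>L g = id_blinfun \<and> g o\<^sub>L h = id_blinfun" if "g \<in> carrier H" for g
      using H_inv[OF that] HH.inv_closed[OF that] by blast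
    show "s (blinfun_apply h x) = blinfun_apply h (s x)" if "h \<in> carrier H" for h x by (rule H_lift(2)[OF that])
  qed (use sym ss H_tangent in auto)
  show ?thesis using orbit_meets_maximal_abelian[OF max x] H_lift(1) by blast
qed

lemma measurable_decomposition:
  fixes \<rho> :: "'w \<Rightarrow> 'a"
  assumes ss: "semisimple br" and max: "maximal_abelian_subspace br s A"
    and \<rho>: "\<rho> \<in> \<Omega> \<rightarrow>\<^sub>M restrict_space borel (p_part s)"
  shows "\<exists>U l. U \<in> \<Omega> \<rightarrow>\<^sub>M borel_of (lie_topology K) \<and> l \<in> \<Omega> \<rightarrow>\<^sub>M restrict_space borel A \<and>
     (\<forall>\<omega>\<in>space \<Omega>. \<rho> \<omega> = Ad G \<theta> (U \<omega>) (l \<omega>))"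
proof -
  have \<rho>m: "\<rho> \<in> borel_measurable \<Omega>" and \<rho>p: "\<And>\<omega>. \<omega> \<in> space \<Omega> \<Longrightarrow> \<rho> \<omega> \<in> p_part s"
    using \<rho> by (auto simp: measurable_restrict_space2_iff)
  have subA: "subspace A" using max by (simp add: maximal_abelian_subspace_def abelian_subspace_def)
  have clA: "closed A" by (rule finite_dim_closed[OF finite_dim_subspace_mono[OF finite_dim subA subset_UNIV]])
  have XH: "Hausdorff_space (lie_topology K)" and X2: "second_countable (lie_topology K)"
    using KK.manifold by (auto simp: smooth_manifold_def)
  obtain C where C: "\<And>n::nat. compactin (lie_topology K) (C n)"
    "\<And>W x. openin (lie_topology K) W \<Longrightarrow> x \<in> W \<Longrightarrow> \<exists>n. x \<in> C n \<and> C n \<subseteq> W"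
    using manifold_compact_base[OF KK.top_atlas KK.finite_dim_E XH X2] by blast
  define F where "F \<omega> = {k \<in> carrier K. blinfun_apply (AdB k) (\<rho> \<omega>) \<in> A}" for \<omega>
  have "\<exists>V. V \<in> \<Omega> \<rightarrow>\<^sub>M borel_of (lie_topology K) \<and> (\<forall>\<omega>\<in>space \<Omega>. V \<omega> \<in> F \<omega>)"
  proof (rule measurable_selection[OF XH C])
    fix \<omega> assume \<omega>: "\<omega> \<in> space \<Omega>"
    show "F \<omega> \<noteq> {}" using orbit_meets[OF ss max \<rho>p[OF \<omega>]] by (auto simp: F_def)
    have "continuous_map euclidean euclidean (\<lambda>f. blinfun_apply f (\<rho> \<omega>))"
      by (simp add: continuous_intros)
    from continuous_map_compose[OF AdB_K_continuous this]
    have "continuous_map (lie_topology K) euclidean (\<lambda>k. blinfun_apply (AdB k) (\<rho> \<omega>))" by (simp add: o_def)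
    from closedin_continuous_map_preimage[OF this, of A] clA
    show "closedin (lie_topology K) (F \<omega>)" by (simp add: F_def KK.topspace)
  next
    fix D assume D: "compactin (lie_topology K) D"
    have Dc: "D \<subseteq> carrier K" using compactin_subset_topspace[OF D] by (simp add: KK.topspace)
    have P: "compact (AdB ` D)" using image_compactin[OF D AdB_K_continuous] by simp
    \<comment> \<open>\<open>F \<omega>\<close> meets \<open>D\<close> iff
      \<open>\<rho> \<omega>\<close> lies in \<open>Y\<close>, which is closed because the operators
      range over a compact set.\<close>
    define Y where "Y = {x. \<exists>f\<in>AdB ` D. blinfun_apply f x \<in> A}"
    have "closed Y"
      unfolding closed_sequential_limits
    proof (intro allI impI, elim conjE)
      fix x l assume x: "\<forall>n. x n \<in> Y" and l: "x \<longlonglongrightarrow> l"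
      have "\<forall>n. \<exists>f. f \<in> AdB ` D \<and> blinfun_apply f (x n) \<in> A" using x by (auto simp: Y_def)
      then obtain f where f: "\<And>n. f n \<in> AdB ` D" "\<And>n. blinfun_apply (f n) (x n) \<in> A" by metis
      obtain f0 q where q: "f0 \<in> AdB ` D" "strict_mono (q::nat\<Rightarrow>nat)" "(f \<circ> q) \<longlonglongrightarrow> f0"
        using P f(1) unfolding compact_def by metis
      have "(\<lambda>n. blinfun_apply ((f \<circ> q) n) ((x \<circ> q) n)) \<longlonglongrightarrow> blinfun_apply f0 l"
        by (intro blinfun.tendsto q(3) LIMSEQ_subseq_LIMSEQ[OF l q(2)])
      then have "blinfun_apply f0 l \<in> A" by (rule closed_sequentially[OF clA, rotated]) (simp add: f(2))
      then show "l \<in> Y" using q(1) by (auto simp: Y_def)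
    qed
    then have "Y \<in> sets borel" by simp
    from measurable_sets[OF \<rho>m this] have "\<rho> -` Y \<inter> space \<Omega> \<in> sets \<Omega>" .
    moreover have "{\<omega> \<in> space \<Omega>. F \<omega> \<inter> D \<noteq> {}} = \<rho> -` Y \<inter> space \<Omega>"
      using Dc by (auto simp: F_def Y_def)
    ultimately show "{\<omega> \<in> space \<Omega>. F \<omega> \<inter> D \<noteq> {}} \<in> sets \<Omega>" by simp
  qed
  then obtain V where V: "V \<in> \<Omega> \<rightarrow>\<^sub>M borel_of (lie_topology K)" "\<And>\<omega>. \<omega> \<in> space \<Omega> \<Longrightarrow> V \<omega> \<in> F \<omega>" by blast
  define U where "U \<omega> = inv\<^bsub>K\<^esub> (V \<omega>)" for \<omega>
  define l where "l \<omega> = blinfun_apply (AdB (V \<omega>)) (\<rho> \<omega>)" for \<omega>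
  have Vc: "V \<omega> \<in> carrier K" "l \<omega> \<in> A" if "\<omega> \<in> space \<Omega>" for \<omega> using V(2)[OF that] by (auto simp: F_def l_def)
  have VS: "{\<omega> \<in> space \<Omega>. V \<omega> \<in> S} \<in> sets \<Omega>" if "openin (lie_topology K) S" for S
    using V(1) that by (simp add: measurable_borel_of_iff)
  have Um: "U \<in> \<Omega> \<rightarrow>\<^sub>M borel_of (lie_topology K)"
    unfolding measurable_borel_of_iff
  proof (intro conjI allI impI)
    show "U \<in> space \<Omega> \<rightarrow> topspace (lie_topology K)" using Vc by (auto simp: U_def KK.topspace)
    fix S assume S: "openin (lie_topology K) S"
    have "{\<omega> \<in> space \<Omega>. U \<omega> \<in> S} = {\<omega> \<in> space \<Omega>. V \<omega> \<in> {k \<in> carrier K. inv\<^bsub>K\<^esub> k \<in> S}}"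
      using Vc by (auto simp: U_def)
    also have "\<dots> \<in> sets \<Omega>" by (rule VS[OF KK.preimage_open[OF KK.inv_continuous S]])
    finally show "{\<omega> \<in> space \<Omega>. U \<omega> \<in> S} \<in> sets \<Omega>" .
  qed
  have lm: "l \<in> borel_measurable \<Omega>"
  proof -
    obtain B c r where cb: "coordinate_basis (UNIV :: 'a set) B c r" using finite_dim_coords[OF finite_dim] .
    interpret coordinate_basis "UNIV :: 'a set" B c r by fact
    have lin: "linear (r b)" for b by (intro linearI) (simp_all add: coord_add coord_scale)
    have rc: "continuous_on UNIV (r b)" for b
      by (rule linear_continuous_on[OF finite_dim_linear_bounded[OF finite_dim lin]])
    have rm: "r b \<in> borel_measurable borel" for b by (rule borel_measurable_continuous_onI[OF rc])
    \<comment> \<open>Matrix coefficients of \<open>Ad\<close> are continuous real functions on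
      \<open>K\<close>, so measurability of \<open>l\<close> reduces to sums and products of real
      functions.\<close>
    have am: "(\<lambda>\<omega>. r b (blinfun_apply (AdB (V \<omega>)) b')) \<in> borel_measurable \<Omega>" for b b'
    proof (rule borel_measurableI)
      fix S :: "real set" assume "open S"
      have "continuous_map euclidean euclidean (\<lambda>f. r b (blinfun_apply f b'))"
        using continuous_on_compose2[OF rc, of UNIV "\<lambda>f. blinfun_apply f b'"] by (simp add: continuous_intros)
      from continuous_map_compose[OF AdB_K_continuous this]
      have "continuous_map (lie_topology K) euclidean (\<lambda>k. r b (blinfun_apply (AdB k) b'))" by (simp add: o_def)
      from openin_continuous_map_preimage[OF this, of S] \<open>open S\<close>
      have "openin (lie_topology K) {k \<in> carrier K. r b (blinfun_apply (AdB k) b') \<in> S}" by (simp add: KK.topspace)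
      from VS[OF this] have "{\<omega> \<in> space \<Omega>. V \<omega> \<in> {k \<in> carrier K. r b (blinfun_apply (AdB k) b') \<in> S}} \<in> sets \<Omega>" .
      moreover have "{\<omega> \<in> space \<Omega>. V \<omega> \<in> {k \<in> carrier K. r b (blinfun_apply (AdB k) b') \<in> S}}
          = (\<lambda>\<omega>. r b (blinfun_apply (AdB (V \<omega>)) b')) -` S \<inter> space \<Omega>" using Vc by auto
      ultimately show "(\<lambda>\<omega>. r b (blinfun_apply (AdB (V \<omega>)) b')) -` S \<inter> space \<Omega> \<in> sets \<Omega>" by simp
    qed
    show ?thesis
    proof (rule borel_measurable_coords[OF refl])
      fix b assume "b \<in> B"
      have "r b (l \<omega>) = (\<Sum>b'\<in>B. r b' (\<rho> \<omega>) * r b (blinfun_apply (AdB (V \<omega>)) b'))" for \<omega>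
      proof -
        have "l \<omega> = blinfun_apply (AdB (V \<omega>)) (\<Sum>b'\<in>B. r b' (\<rho> \<omega>) *\<^sub>R b')" using expand by (simp add: l_def)
        then show ?thesis by (simp add: blinfun.sum_right blinfun.scaleR_right linear_sum[OF lin] linear_scale[OF lin])
      qed
      then show "(\<lambda>\<omega>. r b (l \<omega>)) \<in> borel_measurable \<Omega>"
        using am measurable_compose[OF \<rho>m rm] by simp
    qed
  qed
  have "l \<in> \<Omega> \<rightarrow>\<^sub>M restrict_space borel A" using lm Vc by (auto simp: measurable_restrict_space2_iff)
  moreover have "\<rho> \<omega> = Ad G \<theta> (U \<omega>) (l \<omega>)" if \<omega>: "\<omega> \<in> space \<Omega>" for \<omega>
  proof -
    have VG: "V \<omega> \<in> carrier G" using K_carrier Vc(1)[OF \<omega>] by blast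
    have "Ad G \<theta> (U \<omega>) (l \<omega>) = blinfun_apply (AdB (inv (V \<omega>))) (l \<omega>)"
      using VG by (simp add: U_def K_inv[OF Vc(1)[OF \<omega>]] AdB_apply)
    also have "\<dots> = blinfun_apply (AdB (inv (V \<omega>)) o\<^sub>L AdB (V \<omega>)) (\<rho> \<omega>)" by (simp add: l_def)
    also have "\<dots> = \<rho> \<omega>" by (simp add: AdB_inv[OF VG])
    finally show ?thesis ..
  qed
  ultimately show ?thesis using Um by blast
qed

end

theorem theorem2p30:
  fixes br :: "'a::real_normed_vector \<Rightarrow> 'a \<Rightarrow> 'a"
    and s :: "'a \<Rightarrow> 'a"
    and G :: "('g, 'm::real_normed_vector) lie_group"
    and \<theta> :: "'a \<Rightarrow> ('g, 'm) tangent"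
    and K :: "('g, 'n::real_normed_vector) lie_group"
    and \<aa> :: "'a set"
    and \<Omega> :: "'w measure"
    and \<rho> :: "'w \<Rightarrow> 'a"
  assumes "symmetric_lie_algebra br s"
    and "semisimple br"
    and "orthogonal_symmetric br s"
    and "associated_pair br s G \<theta> K"
    and "connected_space (lie_topology K)"
    and "maximal_abelian_subspace br s \<aa>"
    and "\<rho> \<in> \<Omega> \<rightarrow>\<^sub>M restrict_space borel (p_part s)"
  shows "\<exists>U l. U \<in> \<Omega> \<rightarrow>\<^sub>M borel_of (lie_topology K) \<and>
                l \<in> \<Omega> \<rightarrow>\<^sub>M restrict_space borel \<aa> \<and>
                (\<forall>\<omega>\<in>space \<Omega>. \<rho> \<omega> = Ad G \<theta> (U \<omega>) (l \<omega>))"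
proof -
  obtain H :: "('a \<Rightarrow>\<^sub>L 'a, 'a \<Rightarrow>\<^sub>L 'a) lie_group" where H: "lie_subgroup H GL"
    "connected_space (lie_topology H)"
    "lie_algebra_of_subgroup H GL = (\<lambda>x. GL_tangent (Blinfun (br x))) ` k_part s"
    "compact_space (lie_topology H)"
    using assms(3) unfolding orthogonal_symmetric_def by blast
  have GK: "is_lie_group G" "lie_algebra_identification br G \<theta>" "lie_subgroup K G"
    "lie_algebra_of_subgroup K G = \<theta> ` k_part s"
    using assms(4) by (auto simp: associated_pair_def)
  have KH: "is_lie_group K" "is_lie_group H" using GK(3) H(1) by (auto simp: lie_subgroup_def)
  have grp: "group G" "group K" "group H" using GK(1) KH by (auto simp: is_lie_group_def)
  have la: "lie_algebra br" using assms(1) by (simp add: symmetric_lie_algebra_def)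
  interpret orthogonal_pair G br \<theta> K H s
    by (intro orthogonal_pair.intro lie_grp_ident.intro lie_grp.intro lie_grp_axioms.intro
        lie_grp_ident_axioms.intro orthogonal_pair_axioms.intro) (fact assms H GK KH grp la)+
  show ?thesis by (rule measurable_decomposition[OF assms(2,6,7)])
qed

end
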